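(* Let $r\ge k\ge 2$ be integers and let $\Delta=r-k$. Let $T$ be a tight $k$-tree, let $S$ be a spanning subgraph of $T$ with at least two edges, and let $F=S^{(+r)}$. There exists a constant $C>0$ such that the following holds. Let $$p_0=Cn^{-s(F)}(\log n)^{\Delta+2+\frac{\Delta s(F)}{\Delta+1}}\quad\text{and}\quad p_1=n^{-\frac{\Delta}{\Delta+1}s(F)}(\log n)^{\Delta+2+\frac{\Delta s(F)}{\Delta+1}}.$$ Then for $p=p(n)\in[0,1]$, asymptotically almost surely $$\mathrm{ex}(G^r_{n,p},F)\le \begin{cases} Cpn^{r-1}, & \text{if } p\ge p_1;\\[2pt] Cp^{\frac{s(F)-\Delta-1}{s(F)}}n^{k-1}(\log n)^{\Delta+\frac{(\Delta+2)(\Delta+1)}{s(F)}}, & \text{if } p_0\le p\le p_1.\end{cases}$$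
   Context: An $r$-graph is a hypergraph all of whose edges have size $r$; $v(H)$ and $e(H)$ denote the numbers of vertices and edges of $H$. A $k$-graph $T$ is a tight $k$-tree if its edges can be ordered $e_1,\dots,e_t$ so that for every $i\ge 2$ there exist $v\in e_i$ and $1\le s\le i-1$ with $v\notin\bigcup_{j=1}^{i-1}e_j$ and $e_i\setminus\{v\}\subset e_s$. A spanning subgraph $S$ of $T$ is a subgraph with the same vertex set as $T$. For a $k$-graph $H$ and $r\ge k$, the $r$-expansion $H^{(+r)}$ is the $r$-graph obtained from $H$ by enlarging each edge of $H$ by a set of $r-k$ new vertices of degree one (the sets added to different edges being disjoint); $H^{(+k)}=H$. For an $r$-graph $H$ with at least two edges, $s(H)=\min\left\{\frac{v(G)-r}{e(G)-1}: G\subset H,\ e(G)\ge 2\right\}$. $G^r_{n,p}$ is the random $r$-graph on $n$ vertices in which each $r$-set is an edge independently with probability $p$. $\mathrm{ex}(G^r_{n,p},F)$ is the maximum number of edges in an $F$-free subgraph of $G^r_{n,p}$. A statement depending on $n$ holds asymptotically almost surely if its probability tends to $1$ as $n\to\infty$. *)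

theory Defs
  imports "HOL-Probability.Probability"
begin

datatype 'a hgraph = HGraph (verts: "'a set") (edges: "'a set set")

definition is_rgraph :: "nat \<Rightarrow> 'a hgraph \<Rightarrow> bool" where
  "is_rgraph r H \<longleftrightarrow>
     finite (verts H) \<and> (\<forall>e\<in>edges H. e \<subseteq> verts H \<and> card e = r)"

definition subhgraph :: "'a hgraph \<Rightarrow> 'a hgraph \<Rightarrow> bool" where
  "subhgraph G H \<longleftrightarrow>
     verts G \<subseteq> verts H \<and> edges G \<subseteq> edges H \<and> (\<forall>e\<in>edges G. e \<subseteq> verts G)"

definition spanning_subhgraph :: "'a hgraph \<Rightarrow> 'a hgraph \<Rightarrow> bool" where
  "spanning_subhgraph S T \<longleftrightarrow> subhgraph S T \<and> verts S = verts T"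

definition tight_tree :: "nat \<Rightarrow> 'a hgraph \<Rightarrow> bool" where
  "tight_tree k T \<longleftrightarrow> is_rgraph k T \<and>
     (\<exists>es. distinct es \<and> set es = edges T \<and>
        (\<forall>i. 1 \<le> i \<and> i < length es \<longrightarrow>
           (\<exists>v\<in>es ! i. \<exists>s<i. v \<notin> (\<Union>j<i. es ! j) \<and> es ! i - {v} \<subseteq> es ! s)))"

text \<open>The new vertices attached to an edge \<open>e\<close> are \<open>Inr (e, i)\<close> with \<open>i < r - k\<close>; the old
  vertices, isolated ones included, are the \<open>Inl x\<close>.\<close>

definition expand_edge :: "nat \<Rightarrow> nat \<Rightarrow> 'a set \<Rightarrow> ('a + 'a set \<times> nat) set" where
  "expand_edge k r e = Inl ` e \<union> Inr ` ({e} \<times> {..<r - k})"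

definition expansion :: "nat \<Rightarrow> nat \<Rightarrow> 'a hgraph \<Rightarrow> ('a + 'a set \<times> nat) hgraph" where
  "expansion k r H =
     HGraph (Inl ` verts H \<union> Inr ` (edges H \<times> {..<r - k})) (expand_edge k r ` edges H)"

text \<open>\<open>s(H)\<close>, meaningful for an \<open>r\<close>-graph \<open>H\<close> with at least two edges.\<close>

definition s_param :: "nat \<Rightarrow> 'a hgraph \<Rightarrow> real" where
  "s_param r H =
     Min {(real (card (verts G)) - real r) / (real (card (edges G)) - 1) | G.
            subhgraph G H \<and> card (edges G) \<ge> 2}"

text \<open>Copies are not necessarily induced, and isolated vertices of \<open>F\<close> are embedded as well.\<close>

definition contains_copy :: "'b hgraph \<Rightarrow> 'a hgraph \<Rightarrow> bool" where
  "contains_copy G F \<longleftrightarrow>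
     (\<exists>\<phi>. inj_on \<phi> (verts F) \<and> \<phi> ` verts F \<subseteq> verts G \<and> (\<forall>e\<in>edges F. \<phi> ` e \<in> edges G))"

definition ex_number :: "'b hgraph \<Rightarrow> 'a hgraph \<Rightarrow> nat" where
  "ex_number G F = Max {card (edges G') | G'. subhgraph G' G \<and> \<not> contains_copy G' F}"

definition r_sets :: "nat \<Rightarrow> nat \<Rightarrow> nat set set" where
  "r_sets r n = {e. e \<subseteq> {..<n} \<and> card e = r}"

definition random_rgraph :: "nat \<Rightarrow> nat \<Rightarrow> real \<Rightarrow> nat hgraph pmf" where
  "random_rgraph r n p =
     map_pmf (\<lambda>f. HGraph {..<n} {e \<in> r_sets r n. f e})
       (Pi_pmf (r_sets r n) False (\<lambda>_. bernoulli_pmf p))"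

text \<open>\<open>aas M Q\<close>: for \<open>G\<close> distributed according to \<open>M n\<close>, the statement \<open>Q n G\<close> holds
  asymptotically almost surely.\<close>

definition aas :: "(nat \<Rightarrow> 'a pmf) \<Rightarrow> (nat \<Rightarrow> 'a \<Rightarrow> bool) \<Rightarrow> bool" where
  "aas M Q \<longleftrightarrow> (\<lambda>n. measure_pmf.prob (M n) {G. Q n G}) \<longlonglongrightarrow> 1"

end

(*
  Let G be an r-graph on n vertices with at least B n^(r-1) edges. Passing to a subfamily X and
  choosing a k-subset kappa f of every edge f, one may assume that every k-set is chosen at most D
  times, that X has y = Omega(e(G) / n^(k-1)) edges through every (k-1)-subset of a chosen k-set, and
  that D = O(y^(Delta / (Delta + 1))): either all of G is degenerate enough for this, or the core of
  largest minimum k-degree is used, where links of (k-1)-sets have large minimum degree and hence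
  many edges. A tree-indexed random walk, each step of which replaces an edge by a uniformly random
  edge of X through the same (k-1)-set, then gives a random copy of the expansion. The walk is
  reversible, so it may be started at any edge, and fixing j edges that span u vertices of the tree
  has probability at most |X|^-1 y^-(j-1) (D/y)^(u-k-(j-1)). This is the balanced supersaturation
  needed for an online container algorithm; iterating it produces exp(O(p M)) containers with at
  most M edges, and a union bound over them finishes the proof.
*)

theory Submission
  imports Defs
begin

section \<open>Hypergraph containers\<close>

text \<open>The relation between D and y fixes the exponents. If j edges of S span u tree vertices,
  then u - k is at least (s - \<Delta>)(j - 1), so every further fixed edge costs a factor \<tau> of
  order y^-1 (D/y)^(s - \<Delta> - 1), which is y^(-s/(\<Delta> + 1)) for D of order
  y^(\<Delta>/(\<Delta> + 1)). Thus \<tau> depends on e(G)/n^(k-1) alone. M is taken so large that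
  \<tau> times (log n)^2 is at most p, and \<open>p1\<close> is where this M comes down to the order
  n^(r-1). X can be far smaller than G, so a step must not be charged to all of G: it removes a
  constant proportion of X, and the logarithm of the number of its containers is proportional to the
  size of X as well. As s is at least \<Delta> + 1, the product \<tau> e(G) is largest near the end,
  and the costs add up to a logarithm. A walk on k-sets has to know which vertex each step replaces.
  Therefore the elements of a chosen k-set are addressed by their ranks, and the ranks are matched
  with the colours of a k-colouring of the tree in which every edge is rainbow.\<close>

lemma sum_UN_le:
  fixes w :: "'b \<Rightarrow> real"
  assumes "finite I" "\<And>x. 0 \<le> w x" "\<And>i. i \<in> I \<Longrightarrow> finite (A i)"
  shows "(\<Sum>x\<in>(\<Union>i\<in>I. A i). w x) \<le> (\<Sum>i\<in>I. \<Sum>x\<in>A i. w x)"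
  using assms
proof (induction I rule: finite_induct)
  case (insert i I)
  have "(\<Sum>x\<in>(\<Union>i\<in>insert i I. A i). w x) \<le> (\<Sum>x\<in>A i. w x) + (\<Sum>x\<in>(\<Union>i\<in>I. A i). w x)"
    using insert by (simp add: sum_Un sum_nonneg)
  also have "(\<Sum>x\<in>(\<Union>i\<in>I. A i). w x) \<le> (\<Sum>i\<in>I. \<Sum>x\<in>A i. w x)" using insert by simp
  finally show ?case using insert by simp
qed simp

lemma sum_Un_le:
  fixes w :: "'b \<Rightarrow> real"
  assumes "finite A" "finite B" "\<And>x. 0 \<le> w x"
  shows "sum w (A \<union> B) \<le> sum w A + sum w B"
  using assms by (simp add: sum_Un sum_nonneg)

text \<open>Vertices are the numbers below \<open>N\<close>, so that they come with the order in
  which they are processed. Edges carry weights because the copies to be avoided will be produced by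
  a random process; \<open>\<zeta>\<close> sets the threshold at which a vertex is worth a
  query.\<close>

locale online_container =
  fixes N l :: nat and K \<tau> \<zeta> :: real and H :: "nat set \<Rightarrow> real"
  assumes N_pos: "N > 0" and l_pos: "l \<ge> 1" and K_pos: "K > 0" and \<tau>_pos: "\<tau> > 0" and \<zeta>_pos: "\<zeta> > 0"
    and H_nonneg: "H f \<ge> 0"
    and H_supp: "H f \<noteq> 0 \<Longrightarrow> f \<subseteq> {..<N} \<and> card f = l"
    and H_deg: "\<sigma> \<noteq> {} \<Longrightarrow> \<sigma> \<subseteq> {..<N} \<Longrightarrow>
      (\<Sum>f\<in>{f\<in>Pow {..<N}. \<sigma> \<subseteq> f}. H f) \<le> K / N * \<tau> ^ (card \<sigma> - 1)"
begin

definition wdeg :: "(nat set \<Rightarrow> real) \<Rightarrow> nat set \<Rightarrow> real" where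
  "wdeg w \<sigma> = (\<Sum>f\<in>{f\<in>Pow {..<N}. \<sigma> \<subseteq> f}. w f)"

text \<open>The degree meant for a \<open>j\<close>-set at level \<open>s\<close>. At
  \<open>s = l\<close> it is the bound of \<open>H_deg\<close>; taking the link of a vertex lowers
  \<open>s\<close> and \<open>j\<close> by one each and keeps the value.\<close>

definition cap :: "nat \<Rightarrow> nat \<Rightarrow> real" where
  "cap s j = K / N * \<tau> ^ (l - s + j - 1)"

definition saturated :: "(nat set \<Rightarrow> real) \<Rightarrow> nat \<Rightarrow> nat set \<Rightarrow> bool" where
  "saturated w s \<sigma> \<longleftrightarrow> \<sigma> \<noteq> {} \<and> cap s (card \<sigma>) \<le> wdeg w \<sigma>"

text \<open>Only sets above \<open>t\<close> are taken, so a set is passed on solely at its least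
  vertex and is frozen once a vertex of it has been processed. Leaving out sets with a saturated
  subset keeps all degrees within a constant factor of \<open>cap\<close>.\<close>

definition link :: "(nat \<Rightarrow> nat set \<Rightarrow> real) \<Rightarrow> nat \<Rightarrow> nat \<Rightarrow> nat set \<Rightarrow> real" where
  "link P t s f =
     (if 1 \<le> s \<and> s < l \<and> card f = s \<and> f \<subseteq> {t<..<N} \<and> (\<forall>\<sigma>\<subseteq>f. \<not> saturated (P s) s \<sigma>)
      then P (Suc s) (insert t f) else 0)"

text \<open>The weight at level \<open>s\<close> never exceeds the order of
  \<open>\<tau> ^ (l - s)\<close>, so with this threshold only O(\<tau> N) vertices can be
  selected.\<close>

definition heavy :: "(nat \<Rightarrow> nat set \<Rightarrow> real) \<Rightarrow> nat \<Rightarrow> nat \<Rightarrow> bool" where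
  "heavy P t s \<longleftrightarrow> 1 \<le> s \<and> s < l \<and> \<zeta> / N * \<tau> ^ (l - s - 1) \<le> (\<Sum>f\<in>Pow {..<N}. link P t s f)"

text \<open>\<open>state J t s\<close> weighs the \<open>s\<close>-sets found to be forbidden once the vertices below \<open>t\<close> have been
  processed; the question whether a vertex lies in the independent set is answered by \<open>J\<close>, and only
  asked at heavy vertices, so that the fingerprint gives the same run as \<open>J\<close>.\<close>

primrec state :: "nat set \<Rightarrow> nat \<Rightarrow> nat \<Rightarrow> nat set \<Rightarrow> real" where
  "state J 0 = (\<lambda>s f. if s = l then H f else 0)"
| "state J (Suc t) = (\<lambda>s f. state J t s f +
     (if t \<in> J \<and> (\<exists>s. heavy (state J t) t s) then link (state J t) t s f else 0))"

definition fingerprint :: "nat set \<Rightarrow> nat set" where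
  "fingerprint J = {t. t < N \<and> t \<in> J \<and> (\<exists>s. heavy (state J t) t s)}"

text \<open>A vertex is discarded either because a query about it was answered negatively or because
  it would complete an edge together with selected vertices. Reading the weight of
  \<open>{t}\<close> at time \<open>t\<close> loses nothing, since later links avoid
  \<open>t\<close>.\<close>

definition container :: "nat set \<Rightarrow> nat set" where
  "container J = {t. t < N \<and> ((\<exists>s. heavy (state J t) t s) \<longrightarrow> t \<in> J) \<and> state J t 1 {t} = 0}"

lemma sum_state_Suc:
  "(\<Sum>f\<in>S. state J (Suc t) s f) = (\<Sum>f\<in>S. state J t s f) +
     (if t \<in> J \<and> (\<exists>s. heavy (state J t) t s) then \<Sum>f\<in>S. link (state J t) t s f else 0)"
proof (cases "t \<in> J \<and> (\<exists>s. heavy (state J t) t s)")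
  case True
  show ?thesis by (simp only: state.simps if_P[OF True] sum.distrib)
next
  case False
  show ?thesis by (simp only: state.simps if_not_P[OF False] add_0_right)
qed

lemma cap_nonneg: "0 \<le> cap s j"
  unfolding cap_def using K_pos \<tau>_pos by simp

lemma state_nonneg: "0 \<le> state J t s f"
  by (induction t arbitrary: s f) (auto simp: H_nonneg link_def intro!: add_nonneg_nonneg)

lemma link_nonneg: "0 \<le> link (state J t) t s f"
  by (auto simp: link_def state_nonneg)

lemma state_supp: "state J t s f \<noteq> 0 \<Longrightarrow> f \<subseteq> {..<N} \<and> card f = s \<and> 1 \<le> s \<and> s \<le> l"
proof (induction t arbitrary: s f)
  case 0
  then show ?case using H_supp l_pos by (auto split: if_splits)
next
  case (Suc t)
  show ?case
  proof (cases "state J t s f = 0")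
    case True
    then have "link (state J t) t s f \<noteq> 0" using Suc.prems by (auto split: if_splits)
    then show ?thesis by (auto simp: link_def split: if_splits)
  qed (use Suc.IH in blast)
qed

lemma state_top: "state J t l = H"
  by (induction t) (auto simp: link_def)

lemma state_mono: "t \<le> t' \<Longrightarrow> state J t s f \<le> state J t' s f"
  by (induction rule: dec_induct) (auto simp: link_nonneg intro: order_trans)

text \<open>Links taken at time \<open>n\<close> consist of vertices above \<open>n\<close>, so a
  set with an element \<open>v \<le> t\<close> receives nothing from time \<open>t\<close>
  on.\<close>

lemma state_final: "t \<le> t' \<Longrightarrow> v \<in> A \<Longrightarrow> v \<le> t \<Longrightarrow> state J t' s A = state J t s A"
proof (induction t' rule: dec_induct)
  case (step n)
  have "link (state J n) n s A = 0"
    using step by (auto simp: link_def)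
  then show ?case using step by simp
qed auto

lemma state_fingerprint: "t \<le> N \<Longrightarrow> state (fingerprint J) t = state J t"
proof (induction t)
  case (Suc t)
  then have IH: "state (fingerprint J) t = state J t" by simp
  have "t \<in> fingerprint J \<and> (\<exists>s. heavy (state J t) t s) \<longleftrightarrow> t \<in> J \<and> (\<exists>s. heavy (state J t) t s)"
    using Suc.prems by (auto simp: fingerprint_def)
  then show ?case by (simp only: state.simps IH)
qed simp

text \<open>Weight on \<open>f\<close> descends from an edge of \<open>H\<close> by removing
  selected vertices, and these form \<open>B\<close>. Hence a weighted singleton never lies in an
  independent set that answers the queries.\<close>

lemma state_indep:
  assumes "state J t s f \<noteq> 0"
  shows "\<exists>B\<subseteq>J. H (f \<union> B) \<noteq> 0"
  using assms
proof (induction t arbitrary: s f)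
  case 0
  then show ?case by (intro exI[of _ "{}"]) (auto split: if_splits)
next
  case (Suc t)
  show ?case
  proof (cases "state J t s f = 0")
    case True
    then have "link (state J t) t s f \<noteq> 0" "t \<in> J" using Suc.prems by (auto split: if_splits)
    then have "state J t (Suc s) (insert t f) \<noteq> 0" by (auto simp: link_def split: if_splits)
    then obtain B where "B \<subseteq> J" "H (insert t f \<union> B) \<noteq> 0" using Suc.IH by blast
    then show ?thesis using \<open>t \<in> J\<close> by (intro exI[of _ "insert t B"]) auto
  qed (use Suc.IH in blast)
qed

lemma independent_subset_container:
  assumes I: "I \<subseteq> {..<N}" and indep: "\<And>A. A \<subseteq> I \<Longrightarrow> H A = 0"
  shows "I \<subseteq> container (fingerprint I)"
proof
  fix t assume t: "t \<in> I"
  then have tN: "t < N" using I by auto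
  have "state I t 1 {t} = 0"
  proof (rule ccontr)
    assume "state I t 1 {t} \<noteq> 0"
    then obtain B where "B \<subseteq> I" "H ({t} \<union> B) \<noteq> 0" using state_indep by blast
    then show False using indep[of "{t} \<union> B"] t by auto
  qed
  moreover have "state (fingerprint I) t = state I t"
    using state_fingerprint tN by simp
  ultimately show "t \<in> container (fingerprint I)"
    using tN t unfolding container_def by (auto simp: fingerprint_def)
qed

section \<open>Degrees during the run and the size of the fingerprint\<close>

lemma link_degree_le:
  assumes "\<sigma> \<noteq> {}"
  shows "(\<Sum>f\<in>{f\<in>Pow {..<N}. \<sigma> \<subseteq> f}. link (state J t) t s f) \<le> wdeg (state J t (Suc s)) (insert t \<sigma>)"
proof -
  let ?A = "{f\<in>Pow {..<N}. \<sigma> \<subseteq> f \<and> f \<subseteq> {t<..<N}}"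
  have "(\<Sum>f\<in>{f\<in>Pow {..<N}. \<sigma> \<subseteq> f}. link (state J t) t s f) = (\<Sum>f\<in>?A. link (state J t) t s f)"
    by (rule sum.mono_neutral_right) (auto simp: link_def)
  also have "\<dots> \<le> (\<Sum>f\<in>?A. state J t (Suc s) (insert t f))"
    by (rule sum_mono) (auto simp: link_def state_nonneg)
  also have "\<dots> = (\<Sum>g\<in>insert t ` ?A. state J t (Suc s) g)"
  proof (subst sum.reindex)
    show "inj_on (insert t) ?A"
    proof (rule inj_onI)
      fix f g assume "f \<in> ?A" "g \<in> ?A" and eq: "insert t f = insert t g"
      then have "t \<notin> f" "t \<notin> g" by auto
      then show "f = g" using eq by (metis insert_ident)
    qed
  qed simp
  also have "\<dots> \<le> wdeg (state J t (Suc s)) (insert t \<sigma>)"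
    unfolding wdeg_def
  proof (rule sum_mono2)
    show "insert t ` ?A \<subseteq> {f \<in> Pow {..<N}. insert t \<sigma> \<subseteq> f}"
    proof
      fix g assume "g \<in> insert t ` ?A"
      then obtain f where f: "f \<in> ?A" "g = insert t f" by auto
      then obtain x where "x \<in> f" using assms by blast
      then have "t < N" using f by auto
      then show "g \<in> {f \<in> Pow {..<N}. insert t \<sigma> \<subseteq> f}" using f by auto
    qed
  qed (auto simp: state_nonneg)
  finally show ?thesis .
qed

lemma wdeg_infeasible: "\<not> \<sigma> \<subseteq> {..<N} \<Longrightarrow> wdeg w \<sigma> = 0"
  unfolding wdeg_def by (rule sum.neutral) auto

text \<open>A set gains weight only while it is below its cap, so it overshoots by at most one step.
  That step adds at most the degree of \<open>insert t \<sigma>\<close> one level up, which is at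
  most \<open>l - s\<close> caps by the hypothesis for the same time \<open>t\<close>. The induction
  is therefore on time, with the level left arbitrary.\<close>

lemma wdeg_state_le_aux:
  assumes "1 \<le> s" "s \<le> l" "\<sigma> \<noteq> {}"
  shows "wdeg (state J t s) \<sigma> \<le> real (l - s + 1) * cap s (card \<sigma>)"
  using assms
proof (induction t arbitrary: s \<sigma>)
  case 0
  show ?case
  proof (cases "s = l \<and> \<sigma> \<subseteq> {..<N}")
    case True
    then show ?thesis using H_deg[of \<sigma>] 0 by (simp add: wdeg_def cap_def)
  next
    case False
    then have "wdeg (state J 0 s) \<sigma> = 0"
      using wdeg_infeasible by (cases "s = l") (auto simp: wdeg_def)
    then show ?thesis using cap_nonneg[of s "card \<sigma>"] by simp
  qed
next
  case (Suc t)
  show ?case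
  proof (cases "s = l \<or> \<not> \<sigma> \<subseteq> {..<N}")
    case True
    then show ?thesis
    proof
      assume "s = l"
      then have "state J (Suc t) s = state J t s" using state_top by metis
      then show ?thesis using Suc.IH[OF Suc.prems] by metis
    next
      assume "\<not> \<sigma> \<subseteq> {..<N}"
      then show ?thesis using wdeg_infeasible cap_nonneg[of s "card \<sigma>"] by simp
    qed
  next
    case False
    then have sl: "s < l" and \<sigma>: "\<sigma> \<subseteq> {..<N}" using Suc.prems by auto
    have fin: "finite \<sigma>" using \<sigma> finite_subset by blast
    let ?S = "{f\<in>Pow {..<N}. \<sigma> \<subseteq> f}"
    let ?L = "\<Sum>f\<in>?S. link (state J t) t s f"
    have L0: "0 \<le> ?L" by (auto intro!: sum_nonneg simp: link_nonneg)
    have dec: "wdeg (state J (Suc t) s) \<sigma> \<le> wdeg (state J t s) \<sigma> + ?L"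
      using L0 unfolding wdeg_def sum_state_Suc by simp
    show ?thesis
    proof (cases "saturated (state J t s) s \<sigma>")
      case True
      have "?L = 0"
        by (rule sum.neutral) (use True in \<open>auto simp: link_def\<close>)
      then show ?thesis using dec Suc.IH[OF Suc.prems] by linarith
    next
      case False
      then have 1: "wdeg (state J t s) \<sigma> \<le> cap s (card \<sigma>)"
        using Suc.prems unfolding saturated_def by auto
      have 2: "?L \<le> real (l - s) * cap s (card \<sigma>)"
      proof (cases "t \<in> \<sigma>")
        case True
        then have "?L = 0" by (intro sum.neutral) (auto simp: link_def)
        then show ?thesis using cap_nonneg by simp
      next
        case False
        have "?L \<le> wdeg (state J t (Suc s)) (insert t \<sigma>)"
          using link_degree_le Suc.prems by blast
        also have "\<dots> \<le> real (l - Suc s + 1) * cap (Suc s) (card (insert t \<sigma>))"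
          by (rule Suc.IH) (use sl in auto)
        also have "cap (Suc s) (card (insert t \<sigma>)) = cap s (card \<sigma>)"
          using False fin sl by (simp add: cap_def)
        also have "l - Suc s + 1 = l - s" using sl by simp
        finally show ?thesis .
      qed
      have "real (l - s + 1) * cap s (card \<sigma>) = cap s (card \<sigma>) + real (l - s) * cap s (card \<sigma>)"
        by (simp add: algebra_simps)
      then show ?thesis using dec 1 2 by linarith
    qed
  qed
qed

lemma wdeg_state_le:
  assumes "1 \<le> s" "s \<le> l" "\<sigma> \<noteq> {}"
  shows "wdeg (state J t s) \<sigma> \<le> real l * cap s (card \<sigma>)"
proof -
  have "wdeg (state J t s) \<sigma> \<le> real (l - s + 1) * cap s (card \<sigma>)"
    using wdeg_state_le_aux assms by blast
  also have "\<dots> \<le> real l * cap s (card \<sigma>)"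
    using assms cap_nonneg by (intro mult_right_mono) auto
  finally show ?thesis .
qed

lemma cap_one: "s \<le> l \<Longrightarrow> cap s 1 = K / N * \<tau> ^ (l - s)"
  by (simp add: cap_def)

lemma weight_touching_le:
  assumes "1 \<le> s" "s \<le> l" "W \<subseteq> {..<N}" "\<And>f. f \<in> A \<Longrightarrow> f \<subseteq> {..<N} \<and> f \<inter> W \<noteq> {}"
  shows "(\<Sum>f\<in>A. state J t s f) \<le> real (card W) * (real l * (K / N * \<tau> ^ (l - s)))"
proof -
  have finW: "finite W" using assms finite_subset by blast
  have "(\<Sum>f\<in>A. state J t s f) \<le> (\<Sum>f\<in>(\<Union>v\<in>W. {f\<in>Pow {..<N}. {v} \<subseteq> f}). state J t s f)"
  proof (rule sum_mono2)
    show "A \<subseteq> (\<Union>v\<in>W. {f\<in>Pow {..<N}. {v} \<subseteq> f})" using assms(4) by fast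
  qed (use finW in \<open>auto simp: state_nonneg\<close>)
  also have "\<dots> \<le> (\<Sum>v\<in>W. wdeg (state J t s) {v})"
    unfolding wdeg_def by (rule sum_UN_le) (auto simp: finW state_nonneg)
  also have "\<dots> \<le> (\<Sum>v\<in>W. real l * (K / N * \<tau> ^ (l - s)))"
    using wdeg_state_le[OF assms(1,2), where \<sigma> = "{_}"] cap_one assms by (intro sum_mono) auto
  finally show ?thesis by simp
qed

definition total :: "nat set \<Rightarrow> nat \<Rightarrow> real" where
  "total J s = (\<Sum>f\<in>Pow {..<N}. state J N s f)"

lemma total_le:
  assumes "1 \<le> s" "s \<le> l"
  shows "total J s \<le> real l * K * \<tau> ^ (l - s)"
proof -
  have "total J s = (\<Sum>f\<in>{f\<in>Pow {..<N}. f \<inter> {..<N} \<noteq> {}}. state J N s f)"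
    unfolding total_def
  proof (rule sum.mono_neutral_right)
    show "\<forall>i\<in>Pow {..<N} - {f \<in> Pow {..<N}. f \<inter> {..<N} \<noteq> {}}. state J N s i = 0"
    proof
      fix f assume "f \<in> Pow {..<N} - {f \<in> Pow {..<N}. f \<inter> {..<N} \<noteq> {}}"
      then have "f = {}" by auto
      then show "state J N s f = 0" using state_supp[of J N s f] by fastforce
    qed
  qed auto
  also have "\<dots> \<le> real (card {..<N}) * (real l * (K / N * \<tau> ^ (l - s)))"
    by (rule weight_touching_le) (use assms in auto)
  also have "\<dots> = real l * K * \<tau> ^ (l - s)" using N_pos by simp
  finally show ?thesis .
qed

lemma total_eq_sum_links:
  assumes "t \<le> N" "1 \<le> s" "s < l"
  shows "(\<Sum>f\<in>Pow {..<N}. state J t s f) = (\<Sum>v\<in>fingerprint J \<inter> {..<t}. \<Sum>f\<in>Pow {..<N}. link (state J v) v s f)"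
  using assms(1)
proof (induction t)
  case 0
  then show ?case using assms by simp
next
  case (Suc t)
  have *: "(\<Sum>f\<in>Pow {..<N}. state J (Suc t) s f) = (\<Sum>f\<in>Pow {..<N}. state J t s f)
     + (if t \<in> fingerprint J then \<Sum>f\<in>Pow {..<N}. link (state J t) t s f else 0)"
    unfolding sum_state_Suc using Suc.prems by (auto simp: fingerprint_def)
  have "fingerprint J \<inter> {..<Suc t} = (if t \<in> fingerprint J then insert t (fingerprint J \<inter> {..<t}) else fingerprint J \<inter> {..<t})"
    by (auto simp: less_Suc_eq)
  then show ?case using * Suc by auto
qed

lemma finite_fingerprint: "finite (fingerprint J)"
  by (rule finite_subset[of _ "{..<N}"]) (auto simp: fingerprint_def)

text \<open>Every selected vertex is heavy at some level \<open>s\<close> and adds at least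
  \<open>\<zeta> / N * \<tau> ^ (l - s - 1)\<close> to a total that \<open>total_le\<close> bounds
  by \<open>l * K * \<tau> ^ (l - s)\<close>. The quotient is counted once for each of fewer than
  \<open>l\<close> levels.\<close>

lemma card_fingerprint_le: "real (card (fingerprint J)) \<le> real l * real l * K * \<tau> * N / \<zeta>"
proof -
  let ?T = "\<lambda>s. {t \<in> fingerprint J. heavy (state J t) t s}"
  have one: "real (card (?T s)) \<le> real l * K * \<tau> * N / \<zeta>" if s: "1 \<le> s" "s < l" for s
  proof -
    have "real (card (?T s)) * (\<zeta> / N * \<tau> ^ (l - s - 1)) = (\<Sum>v\<in>?T s. \<zeta> / N * \<tau> ^ (l - s - 1))"
      by simp
    also have "\<dots> \<le> (\<Sum>v\<in>?T s. \<Sum>f\<in>Pow {..<N}. link (state J v) v s f)"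
      by (rule sum_mono) (auto simp: heavy_def)
    also have "\<dots> \<le> (\<Sum>v\<in>fingerprint J. \<Sum>f\<in>Pow {..<N}. link (state J v) v s f)"
      by (rule sum_mono2) (auto simp: finite_fingerprint link_nonneg intro!: sum_nonneg)
    also have "\<dots> = (\<Sum>v\<in>fingerprint J \<inter> {..<N}. \<Sum>f\<in>Pow {..<N}. link (state J v) v s f)"
      by (rule sum.cong) (auto simp: fingerprint_def)
    also have "\<dots> = total J s" unfolding total_def using total_eq_sum_links[of N s J] s by simp
    also have "\<dots> \<le> real l * K * \<tau> ^ (l - s)" using total_le s by simp
    also have "\<tau> ^ (l - s) = \<tau> * \<tau> ^ (l - s - 1)"
      using s by (metis Suc_diff_Suc diff_Suc_1 diff_diff_left plus_1_eq_Suc add.commute power_Suc)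
    finally have "real (card (?T s)) * \<zeta> / N * \<tau> ^ (l - s - 1) \<le> (real l * K * \<tau>) * \<tau> ^ (l - s - 1)"
      by simp
    then have "real (card (?T s)) * \<zeta> / N \<le> real l * K * \<tau>"
      by (rule mult_right_le_imp_le) (use \<tau>_pos in simp)
    then show ?thesis using N_pos \<zeta>_pos by (simp add: field_simps)
  qed
  have "fingerprint J = (\<Union>s\<in>{1..<l}. ?T s)"
    by (auto simp: fingerprint_def heavy_def)
  then have "card (fingerprint J) \<le> (\<Sum>s\<in>{1..<l}. card (?T s))"
    using card_UN_le[of "{1..<l}" ?T] by (simp del: UN_simps)
  then have "real (card (fingerprint J)) \<le> (\<Sum>s\<in>{1..<l}. real (card (?T s)))"
    by (simp flip: of_nat_sum)
  also have "\<dots> \<le> (\<Sum>s\<in>{1..<l}. real l * K * \<tau> * N / \<zeta>)"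
    by (rule sum_mono) (use one in auto)
  also have "\<dots> = real (l - 1) * (real l * K * \<tau> * N / \<zeta>)" by simp
  also have "\<dots> \<le> real l * (real l * K * \<tau> * N / \<zeta>)"
    using K_pos \<tau>_pos \<zeta>_pos by (intro mult_right_mono) auto
  finally show ?thesis by (simp add: mult.assoc)
qed

section \<open>Weight left inside a container\<close>

lemma saturated_mono:
  assumes "t \<le> t'" "saturated (state J t s) s \<sigma>"
  shows "saturated (state J t' s) s \<sigma>"
proof -
  have "wdeg (state J t s) \<sigma> \<le> wdeg (state J t' s) \<sigma>"
    unfolding wdeg_def by (rule sum_mono) (rule state_mono[OF assms(1)])
  then show ?thesis using assms(2) unfolding saturated_def by linarith
qed

text \<open>A saturated set has degree at least its cap at level \<open>s\<close> and at most
  \<open>l\<close> caps at level \<open>Suc s\<close>. The caps of the two levels differ by the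
  factor \<open>\<tau>\<close>, so the upper degree is at most \<open>l / \<tau>\<close> times the
  lower one. Summing the lower degrees over all \<open>\<sigma>\<close> counts each
  \<open>s\<close>-set \<open>2 ^ s\<close> times.\<close>

lemma saturated_weight_le:
  assumes s: "1 \<le> s" "s < l"
  shows "(\<Sum>A\<in>{A\<in>Pow {..<N}. \<exists>\<sigma>\<subseteq>A. saturated (state J N s) s \<sigma>}. state J N (Suc s) A)
    \<le> real l * 2 ^ l / \<tau> * total J s" (is "?lhs \<le> _")
proof -
  let ?G = "{\<sigma>\<in>Pow {..<N}. saturated (state J N s) s \<sigma>}"
  have fin: "finite ?G" by simp
  have "(\<Sum>A\<in>{A\<in>Pow {..<N}. \<exists>\<sigma>\<subseteq>A. saturated (state J N s) s \<sigma>}. state J N (Suc s) A)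
     \<le> (\<Sum>A\<in>(\<Union>\<sigma>\<in>?G. {f\<in>Pow {..<N}. \<sigma> \<subseteq> f}). state J N (Suc s) A)"
    by (rule sum_mono2) (auto simp: state_nonneg)
  also have "\<dots> \<le> (\<Sum>\<sigma>\<in>?G. wdeg (state J N (Suc s)) \<sigma>)"
    unfolding wdeg_def by (rule sum_UN_le) (auto simp: state_nonneg)
  also have "\<dots> \<le> (\<Sum>\<sigma>\<in>?G. real l / \<tau> * wdeg (state J N s) \<sigma>)"
  proof (rule sum_mono)
    fix \<sigma> assume \<sigma>: "\<sigma> \<in> ?G"
    then have ne: "\<sigma> \<noteq> {}" and fin\<sigma>: "finite \<sigma>" and c: "cap s (card \<sigma>) \<le> wdeg (state J N s) \<sigma>"
      by (auto simp: saturated_def intro: finite_subset)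
    have "card \<sigma> \<ge> 1" using ne fin\<sigma> by (simp add: Suc_leI card_gt_0_iff)
    then have "l - s + card \<sigma> - 1 = Suc (l - Suc s + card \<sigma> - 1)" using s by simp
    then have "cap s (card \<sigma>) = \<tau> * cap (Suc s) (card \<sigma>)"
      unfolding cap_def by (metis power_Suc mult.left_commute)
    then have capS: "cap (Suc s) (card \<sigma>) = cap s (card \<sigma>) / \<tau>" using \<tau>_pos by simp
    have "wdeg (state J N (Suc s)) \<sigma> \<le> real l * cap (Suc s) (card \<sigma>)"
      by (rule wdeg_state_le) (use s ne in auto)
    also have "\<dots> = real l / \<tau> * cap s (card \<sigma>)" by (simp add: capS)
    also have "\<dots> \<le> real l / \<tau> * wdeg (state J N s) \<sigma>"
      using c \<tau>_pos by (intro mult_left_mono) auto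
    finally show "wdeg (state J N (Suc s)) \<sigma> \<le> real l / \<tau> * wdeg (state J N s) \<sigma>" .
  qed
  also have "\<dots> \<le> (\<Sum>\<sigma>\<in>Pow {..<N}. real l / \<tau> * wdeg (state J N s) \<sigma>)"
    using \<tau>_pos by (intro sum_mono2) (auto simp: wdeg_def state_nonneg intro!: mult_nonneg_nonneg divide_nonneg_nonneg sum_nonneg)
  also have "\<dots> = real l / \<tau> * (\<Sum>\<sigma>\<in>Pow {..<N}. \<Sum>f\<in>{f\<in>Pow {..<N}. \<sigma> \<subseteq> f}. state J N s f)"
    by (simp add: wdeg_def sum_distrib_left)
  finally have main: "?lhs \<le> real l / \<tau> * (\<Sum>\<sigma>\<in>Pow {..<N}. \<Sum>f\<in>{f\<in>Pow {..<N}. \<sigma> \<subseteq> f}. state J N s f)" .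
  have "(\<Sum>\<sigma>\<in>Pow {..<N}. \<Sum>f\<in>{f\<in>Pow {..<N}. \<sigma> \<subseteq> f}. state J N s f)
      = (\<Sum>f\<in>Pow {..<N}. \<Sum>\<sigma>\<in>{\<sigma>\<in>Pow {..<N}. \<sigma> \<subseteq> f}. state J N s f)"
    by (rule sum.swap_restrict) auto
  also have "\<dots> \<le> (\<Sum>f\<in>Pow {..<N}. 2 ^ l * state J N s f)"
  proof (rule sum_mono)
    fix f assume f: "f \<in> Pow {..<N}"
    show "(\<Sum>\<sigma>\<in>{\<sigma>\<in>Pow {..<N}. \<sigma> \<subseteq> f}. state J N s f) \<le> 2 ^ l * state J N s f"
    proof (cases "state J N s f = 0")
      case False
      have "finite f" using f finite_subset by blast
      have "{\<sigma>\<in>Pow {..<N}. \<sigma> \<subseteq> f} = Pow f" using f by auto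
      then have "card {\<sigma>\<in>Pow {..<N}. \<sigma> \<subseteq> f} = 2 ^ s"
        using state_supp[OF False] card_Pow[OF \<open>finite f\<close>] by simp
      then show ?thesis using s state_nonneg by (auto intro!: mult_right_mono)
    qed simp
  qed
  also have "\<dots> = 2 ^ l * total J s" by (simp add: total_def sum_distrib_left)
  finally have "real l / \<tau> * (\<Sum>\<sigma>\<in>Pow {..<N}. \<Sum>f\<in>{f\<in>Pow {..<N}. \<sigma> \<subseteq> f}. state J N s f)
      \<le> real l / \<tau> * (2 ^ l * total J s)"
    by (rule mult_left_mono) (use \<tau>_pos in simp)
  then show ?thesis using main by simp
qed

text \<open>A weighted set inside the container meets the fingerprint (\<open>A1\<close>), or has a
  subset that ends up saturated (\<open>A2\<close>), or belongs to \<open>A3\<close>. In the last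
  case its least vertex lies in the container but was not selected, and the link at that vertex sees
  the set with its full final weight, so light links bound this part.\<close>

lemma weight_inside_le:
  assumes s: "1 \<le> s" "s < l"
  shows "(\<Sum>A\<in>Pow (container J). state J N (Suc s) A)
    \<le> \<zeta> * \<tau> ^ (l - s - 1) + real l * 2 ^ l / \<tau> * total J s
       + real (card (fingerprint J)) * (real l * (K / N * \<tau> ^ (l - s - 1)))"
proof -
  let ?C = "container J" and ?T = "fingerprint J" and ?w = "state J N (Suc s)"
  have CN: "?C \<subseteq> {..<N}" by (auto simp: container_def)
  then have finC: "finite ?C" using finite_subset by blast
  define A1 where "A1 = {A\<in>Pow ?C. A \<inter> ?T \<noteq> {}}"
  define A2 where "A2 = {A\<in>Pow {..<N}. \<exists>\<sigma>\<subseteq>A. saturated (state J N s) s \<sigma>}"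
  define A3 where "A3 = {A\<in>Pow ?C. A \<inter> ?T = {} \<and> card A = Suc s \<and>
     (\<forall>\<sigma>\<subseteq>A. \<not> saturated (state J (Min A) s) s \<sigma>)}"
  have fins: "finite A1" "finite A2" "finite A3"
    unfolding A1_def A2_def A3_def using finC by auto
  have w0: "0 \<le> ?w A" for A by (rule state_nonneg)
  have "(\<Sum>A\<in>Pow ?C. ?w A) = (\<Sum>A\<in>{A\<in>Pow ?C. ?w A \<noteq> 0}. ?w A)"
    by (rule sum.mono_neutral_right) (use finC in auto)
  also have "\<dots> \<le> (\<Sum>A\<in>A1 \<union> A2 \<union> A3. ?w A)"
  proof (rule sum_mono2)
    show "{A \<in> Pow ?C. ?w A \<noteq> 0} \<subseteq> A1 \<union> A2 \<union> A3"
    proof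
      fix A assume A: "A \<in> {A \<in> Pow ?C. ?w A \<noteq> 0}"
      then have "?w A \<noteq> 0" by simp
      from state_supp[OF this] have cA: "card A = Suc s" "A \<subseteq> {..<N}" by auto
      have finA: "finite A" "A \<noteq> {}" using cA by (auto intro: card_ge_0_finite)
      have "Min A \<in> A" using finA by simp
      then have "Min A \<le> N" using cA by (auto simp: less_imp_le)
      then have "\<forall>\<sigma>. saturated (state J (Min A) s) s \<sigma> \<longrightarrow> saturated (state J N s) s \<sigma>"
        using saturated_mono by blast
      then show "A \<in> A1 \<union> A2 \<union> A3"
        using A cA unfolding A1_def A2_def A3_def by blast
    qed
  qed (use fins w0 in auto)
  also have "\<dots> \<le> (\<Sum>A\<in>A1. ?w A) + (\<Sum>A\<in>A2. ?w A) + (\<Sum>A\<in>A3. ?w A)"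
    using sum_Un_le[of "A1 \<union> A2" A3 ?w] sum_Un_le[of A1 A2 ?w] fins w0 by simp
  finally have main: "(\<Sum>A\<in>Pow ?C. ?w A) \<le> (\<Sum>A\<in>A1. ?w A) + (\<Sum>A\<in>A2. ?w A) + (\<Sum>A\<in>A3. ?w A)" .
  have 1: "(\<Sum>A\<in>A1. ?w A) \<le> real (card ?T) * (real l * (K / N * \<tau> ^ (l - s - 1)))"
    using weight_touching_le[of "Suc s" ?T A1 J N] s CN by (auto simp: A1_def fingerprint_def)
  have 2: "(\<Sum>A\<in>A2. ?w A) \<le> real l * 2 ^ l / \<tau> * total J s"
    unfolding A2_def by (rule saturated_weight_le[OF s])
  have 3: "(\<Sum>A\<in>A3. ?w A) \<le> \<zeta> * \<tau> ^ (l - s - 1)"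
  proof -
    let ?g = "\<lambda>A. (Min A, A - {Min A})"
    have inA: "finite A \<and> Min A \<in> A \<and> A \<subseteq> ?C \<and> card A = Suc s" if "A \<in> A3" for A
    proof -
      have "finite A" "A \<noteq> {}" using that by (auto simp: A3_def intro: card_ge_0_finite)
      then show ?thesis using that by (auto simp: A3_def)
    qed
    have inj: "inj_on ?g A3"
    proof (rule inj_onI)
      fix A B assume AB: "A \<in> A3" "B \<in> A3" "?g A = ?g B"
      have "A = insert (Min A) (A - {Min A})" using inA[OF AB(1)] by blast
      also have "\<dots> = insert (Min B) (B - {Min B})" using AB(3) by (metis prod.inject)
      also have "\<dots> = B" using inA[OF AB(2)] by blast
      finally show "A = B" .
    qed
    have "(\<Sum>A\<in>A3. ?w A) = (\<Sum>A\<in>A3. link (state J (Min A)) (Min A) s (A - {Min A}))"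
    proof (rule sum.cong)
      fix A assume A: "A \<in> A3"
      note a = inA[OF A]
      have "Min A \<le> N" using a CN by (auto simp: less_imp_le)
      then have "?w A = state J (Min A) (Suc s) A"
        using a by (intro state_final) auto
      moreover have "link (state J (Min A)) (Min A) s (A - {Min A}) = state J (Min A) (Suc s) A"
      proof -
        have "A - {Min A} \<subseteq> {Min A<..<N}"
        proof
          fix x assume x: "x \<in> A - {Min A}"
          then have "Min A \<le> x" "x \<noteq> Min A" "x < N" using a CN by auto
          then show "x \<in> {Min A<..<N}" by simp
        qed
        moreover have "card (A - {Min A}) = s" using a by simp
        moreover have "\<forall>\<sigma>\<subseteq>A - {Min A}. \<not> saturated (state J (Min A) s) s \<sigma>"
          using A by (auto simp: A3_def)
        ultimately show ?thesis using s a by (simp add: link_def insert_absorb)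
      qed
      ultimately show "?w A = link (state J (Min A)) (Min A) s (A - {Min A})" by simp
    qed simp
    also have "\<dots> = (\<Sum>(v, f)\<in>?g ` A3. link (state J v) v s f)"
      by (simp add: sum.reindex[OF inj])
    also have "\<dots> \<le> (\<Sum>(v, f)\<in>(?C - ?T) \<times> Pow {..<N}. link (state J v) v s f)"
    proof (rule sum_mono2)
      show "?g ` A3 \<subseteq> (?C - ?T) \<times> Pow {..<N}"
      proof
        fix z assume "z \<in> ?g ` A3"
        then obtain A where A: "A \<in> A3" "z = ?g A" by blast
        then have "A \<inter> ?T = {}" by (simp add: A3_def)
        moreover have "Min A \<in> A" "A \<subseteq> ?C" using inA[OF A(1)] by auto
        ultimately have "Min A \<in> ?C - ?T" "A - {Min A} \<subseteq> {..<N}" using CN by blast+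
        then show "z \<in> (?C - ?T) \<times> Pow {..<N}" using A(2) by blast
      qed
    qed (use finC in \<open>auto simp: link_nonneg\<close>)
    also have "\<dots> = (\<Sum>v\<in>?C - ?T. \<Sum>f\<in>Pow {..<N}. link (state J v) v s f)"
      by (rule sum.cartesian_product[symmetric])
    also have "\<dots> \<le> (\<Sum>v\<in>?C - ?T. \<zeta> / N * \<tau> ^ (l - s - 1))"
    proof (rule sum_mono)
      fix v assume "v \<in> ?C - ?T"
      \<comment> \<open>A heavy vertex stays in the container only if it belongs to
        \<open>J\<close>, and then it is in the fingerprint.\<close>
      then have "\<not> heavy (state J v) v s" by (auto simp: container_def fingerprint_def)
      then show "(\<Sum>f\<in>Pow {..<N}. link (state J v) v s f) \<le> \<zeta> / N * \<tau> ^ (l - s - 1)"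
        using s by (auto simp: heavy_def)
    qed
    also have "\<dots> \<le> (\<Sum>v\<in>{..<N}. \<zeta> / N * \<tau> ^ (l - s - 1))"
      by (rule sum_mono2) (use CN \<zeta>_pos \<tau>_pos in auto)
    also have "\<dots> = \<zeta> * \<tau> ^ (l - s - 1)" using N_pos by simp
    finally show ?thesis .
  qed
  show ?thesis using main 1 2 3 by linarith
qed

text \<open>The induction looks for the lowest level that still carries weight of full order. At
  level 1 all weight sits on singletons outside the container. If level \<open>Suc n\<close> is rich
  and level \<open>n\<close> poor, the three terms of \<open>weight_inside_le\<close> are at most an
  eighth of the required weight each, so more than half of it touches the complement, and bounded
  vertex degrees force the complement to be large.\<close>

lemma complement_container_large:
  assumes "\<delta> > 0" "\<theta> > 0" and \<theta>: "\<theta> * (8 * real l * 2 ^ l) \<le> 1"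
    and \<zeta>: "\<zeta> \<le> \<delta> * \<theta> ^ (l - 1) / 8"
    and fp: "real l * K * real (card (fingerprint J)) / N \<le> \<delta> * \<theta> ^ (l - 1) / 8"
    and s: "1 \<le> s" "s \<le> l" and tot: "total J s \<ge> \<delta> * \<theta> ^ (l - s) * \<tau> ^ (l - s)"
  shows "real (card ({..<N} - container J)) \<ge> \<delta> * \<theta> ^ (l - 1) * N / (2 * real l * K)"
  using s tot
proof (induction s rule: dec_induct)
  case base
  let ?W = "{..<N} - container J"
  have "total J 1 = (\<Sum>f\<in>{f\<in>Pow {..<N}. f \<inter> ?W \<noteq> {}}. state J N 1 f)"
    unfolding total_def
  proof (rule sum.mono_neutral_right)
    show "\<forall>i\<in>Pow {..<N} - {f \<in> Pow {..<N}. f \<inter> ?W \<noteq> {}}. state J N 1 i = 0"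
    proof
      fix A assume A: "A \<in> Pow {..<N} - {f \<in> Pow {..<N}. f \<inter> ?W \<noteq> {}}"
      show "state J N 1 A = 0"
      proof (rule ccontr)
        assume nz: "state J N 1 A \<noteq> 0"
        then obtain v where v: "A = {v}" using state_supp[OF nz] by (auto simp: card_1_singleton_iff)
        then have vC: "v \<in> container J" using A by auto
        then have "v \<le> N" by (auto simp: container_def)
        then have "state J N 1 {v} = state J v 1 {v}" by (intro state_final) auto
        then show False using nz v vC by (auto simp: container_def)
      qed
    qed
  qed auto
  also have "\<dots> \<le> real (card ?W) * (real l * (K / N * \<tau> ^ (l - 1)))"
    by (rule weight_touching_le) (use l_pos in auto)
  finally have "\<delta> * \<theta> ^ (l - 1) * \<tau> ^ (l - 1) \<le> (real (card ?W) * (real l * K / N)) * \<tau> ^ (l - 1)"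
    using base by (simp add: mult.assoc)
  then have "\<delta> * \<theta> ^ (l - 1) \<le> real (card ?W) * (real l * K / N)"
    by (rule mult_right_le_imp_le) (use \<tau>_pos in simp)
  then have "\<delta> * \<theta> ^ (l - 1) * N / (real l * K) \<le> real (card ?W)"
    using N_pos l_pos K_pos by (simp add: field_simps)
  moreover have "\<delta> * \<theta> ^ (l - 1) * N / (2 * real l * K) \<le> \<delta> * \<theta> ^ (l - 1) * N / (real l * K)"
    using assms l_pos K_pos by (intro divide_left_mono) (auto simp: mult_ac)
  ultimately show ?case by linarith
next
  case (step n)
  let ?W = "{..<N} - container J"
  have "1 \<le> n" "n < l" using step by auto
  show ?case
  proof (cases "total J n \<ge> \<delta> * \<theta> ^ (l - n) * \<tau> ^ (l - n)")
    case True
    then show ?thesis using step by simp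
  next
    case False
    define q where "q = \<tau> ^ (l - n - 1)"
    define e1 where "e1 = \<delta> * \<theta> ^ (l - 1)"
    define es where "es = \<delta> * \<theta> ^ (l - n - 1)"
    have q: "q > 0" unfolding q_def using \<tau>_pos by simp
    have "1 \<le> 8 * real l * 2 ^ l" using l_pos by (simp add: mult_ge1_I)
    then have "\<theta> * 1 \<le> \<theta> * (8 * real l * 2 ^ l)" using assms(2) by (intro mult_left_mono) auto
    then have \<theta>1: "\<theta> \<le> 1" using \<theta> by linarith
    have ees: "e1 \<le> es" unfolding e1_def es_def using \<theta>1 assms step
      by (intro mult_left_mono power_decreasing) auto
    have lsq: "l - n = Suc (l - n - 1)" using step by simp
    have "total J n \<le> (\<theta> * es) * (\<tau> * q)"
      using False unfolding es_def q_def by (subst (asm) (1 2) lsq) (simp add: mult_ac)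
    then have "real l * 2 ^ l / \<tau> * total J n \<le> real l * 2 ^ l / \<tau> * ((\<theta> * es) * (\<tau> * q))"
      using \<tau>_pos by (intro mult_left_mono) auto
    also have "\<dots> = (\<theta> * (8 * real l * 2 ^ l)) * (es * q / 8)" using \<tau>_pos by (simp add: field_simps)
    also have "\<dots> \<le> 1 * (es * q / 8)"
      by (rule mult_right_mono) (use \<theta> q assms in \<open>auto simp: es_def\<close>)
    finally have i1: "real l * 2 ^ l / \<tau> * total J n \<le> es * q / 8" by simp
    have "\<zeta> \<le> es / 8" using \<zeta> ees unfolding e1_def[symmetric] by linarith
    then have i2: "\<zeta> * q \<le> es * q / 8" using q by (simp add: mult_right_mono flip: times_divide_eq_left)
    have "real (card (fingerprint J)) * (real l * (K / N * q)) = (real l * K * real (card (fingerprint J)) / N) * q"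
      by simp
    also have "\<dots> \<le> (e1 / 8) * q" using fp q unfolding e1_def by (intro mult_right_mono) auto
    also have "\<dots> \<le> es * q / 8" using ees q by simp
    finally have i3: "real (card (fingerprint J)) * (real l * (K / N * q)) \<le> es * q / 8" .
    have ins: "(\<Sum>A\<in>Pow (container J). state J N (Suc n) A) \<le> 3 * (es * q / 8)"
      using weight_inside_le[of n J, folded q_def, OF \<open>1 \<le> n\<close> \<open>n < l\<close>] i1 i2 i3 by linarith
    have CN: "container J \<subseteq> {..<N}" by (auto simp: container_def)
    have "total J (Suc n) = (\<Sum>A\<in>Pow (container J). state J N (Suc n) A) +
        (\<Sum>A\<in>Pow {..<N} - Pow (container J). state J N (Suc n) A)"
      unfolding total_def using CN by (subst sum.subset_diff[of "Pow (container J)"]) auto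
    also have "(\<Sum>A\<in>Pow {..<N} - Pow (container J). state J N (Suc n) A)
        \<le> real (card ?W) * (real l * (K / N * \<tau> ^ (l - Suc n)))"
      by (rule weight_touching_le) (use step in auto)
    finally have "total J (Suc n) \<le> 3 * (es * q / 8) + real (card ?W) * (real l * (K / N * q))"
      using ins by (simp add: q_def)
    moreover have "es * q \<le> total J (Suc n)" using step.prems by (simp add: es_def q_def)
    ultimately have "es / 2 * q \<le> real (card ?W) * (real l * (K / N * q))"
      using mult_pos_pos[OF _ q, of es] assms(1,2) by (simp add: es_def)
    then have "es / 2 * q \<le> (real (card ?W) * (real l * K / N)) * q" by (simp add: mult_ac)
    then have "es / 2 \<le> real (card ?W) * (real l * K / N)"
      by (rule mult_right_le_imp_le) (use q in simp)
    then have "e1 / 2 \<le> real (card ?W) * (real l * K / N)" using ees by simp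
    then have "e1 * N / (2 * real l * K) \<le> real (card ?W)"
      using N_pos l_pos K_pos by (simp add: field_simps)
    then show ?thesis by (simp add: e1_def)
  qed
qed

end

section \<open>From fingerprints to a family of containers\<close>

lemma card_small_subsets_le:
  assumes "finite V"
  shows "finite {T. T \<subseteq> V \<and> card T \<le> b}" and "card {T. T \<subseteq> V \<and> card T \<le> b} \<le> (card V + 1) ^ b"
proof -
  show "finite {T. T \<subseteq> V \<and> card T \<le> b}" for b
    by (rule finite_subset[of _ "Pow V"]) (use assms in auto)
  show "card {T. T \<subseteq> V \<and> card T \<le> b} \<le> (card V + 1) ^ b"
  proof (induction b)
    case 0
    have "{T. T \<subseteq> V \<and> card T \<le> 0} = {{}}" using assms by (auto dest: finite_subset)
    then show ?case by simp
  next
    case (Suc b)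
    let ?S = "\<lambda>b. {T. T \<subseteq> V \<and> card T \<le> b}"
    let ?f = "\<lambda>(T, x). case x of None \<Rightarrow> T | Some v \<Rightarrow> insert v T"
    have fin: "finite (?S b \<times> insert None (Some ` V))"
      using assms by (auto intro: finite_subset[of _ "Pow V"])
    have "?S (Suc b) \<subseteq> ?f ` (?S b \<times> insert None (Some ` V))"
    proof
      fix T assume T: "T \<in> ?S (Suc b)"
      show "T \<in> ?f ` (?S b \<times> insert None (Some ` V))"
      proof (cases "T = {}")
        case True
        then show ?thesis by (intro image_eqI[of _ _ "({}, None)"]) auto
      next
        case False
        then obtain v where v: "v \<in> T" by auto
        have "finite T" using T assms finite_subset by blast
        then have "card (T - {v}) = card T - 1" using v by simp
        moreover have "card T \<le> Suc b" using T by blast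
        ultimately have "card (T - {v}) \<le> b" by linarith
        then show ?thesis using T v by (intro image_eqI[of _ _ "(T - {v}, Some v)"]) auto
      qed
    qed
    then have "card (?S (Suc b)) \<le> card (?S b \<times> insert None (Some ` V))"
      by (rule surj_card_le[OF fin])
    also have "\<dots> = card (?S b) * (card V + 1)"
      using assms by (simp add: card_cartesian_product card_image card_insert_if image_iff)
    also have "\<dots> \<le> (card V + 1) ^ b * (card V + 1)" using Suc by (rule mult_right_mono) simp
    finally show ?case by (simp add: mult.commute)
  qed
qed

lemma container_family:
  fixes l :: nat and K \<delta> :: real
  assumes "l \<ge> 1" "K > 0" "\<delta> > 0"
  obtains c C :: real where "0 < c" "c \<le> 1" "0 < C"
    and "\<And>(V :: 'v set) H \<tau>. \<lbrakk>finite V; V \<noteq> {}; 0 < \<tau>; \<tau> \<le> c; \<And>f. 0 \<le> H f;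
      \<And>f. H f \<noteq> 0 \<Longrightarrow> f \<subseteq> V \<and> card f = l;
      \<And>\<sigma>. \<sigma> \<noteq> {} \<Longrightarrow> \<sigma> \<subseteq> V \<Longrightarrow> (\<Sum>f\<in>{f\<in>Pow V. \<sigma> \<subseteq> f}. H f) \<le> K / real (card V) * \<tau> ^ (card \<sigma> - 1);
      \<delta> \<le> (\<Sum>f\<in>Pow V. H f)\<rbrakk> \<Longrightarrow>
      \<exists>\<C>. finite \<C> \<and> real (card \<C>) \<le> real (card V + 1) powr (C * \<tau> * real (card V)) \<and>
        (\<forall>D\<in>\<C>. D \<subseteq> V \<and> real (card D) \<le> (1 - c) * real (card V)) \<and>
        (\<forall>I\<subseteq>V. (\<forall>A\<subseteq>I. H A = 0) \<longrightarrow> (\<exists>D\<in>\<C>. I \<subseteq> D))"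
proof -
  \<comment> \<open>Each error term of \<open>weight_inside_le\<close> has to be at most an eighth
    of the main term: \<open>\<theta>\<close> serves the saturated sets, \<open>\<zeta>\<close> the
    light links, and the bound on \<open>c\<close> that involves \<open>C\<close> keeps the
    fingerprint small enough. The last bound on \<open>c\<close> is the proportion that a container
    loses.\<close>
  define \<theta> :: real where "\<theta> = 1 / (8 * real l * 2 ^ l)"
  define e where "e = \<delta> * \<theta> ^ (l - 1)"
  define \<zeta> where "\<zeta> = e / 8"
  define C where "C = real l * real l * K / \<zeta>"
  define c where "c = min 1 (min (e / (8 * real l * K * C)) (e / (2 * real l * K)))"
  have \<theta>: "\<theta> > 0" "\<theta> * (8 * real l * 2 ^ l) \<le> 1" unfolding \<theta>_def using assms(1) by auto
  have e: "e > 0" "\<zeta> > 0" unfolding \<zeta>_def e_def using \<theta> assms by auto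
  have C: "C > 0" unfolding C_def using e assms by simp
  have c: "c > 0" "c \<le> 1" "c \<le> e / (8 * real l * K * C)" "c \<le> e / (2 * real l * K)"
    unfolding c_def using e C assms by auto
  show ?thesis
  proof (rule that[OF c(1,2) C])
    fix V :: "'v set" and H :: "'v set \<Rightarrow> real" and \<tau> :: real
    assume V: "finite V" "V \<noteq> {}" and \<tau>: "0 < \<tau>" "\<tau> \<le> c" and H0: "\<And>f. 0 \<le> H f"
      and Hs: "\<And>f. H f \<noteq> 0 \<Longrightarrow> f \<subseteq> V \<and> card f = l"
      and Hd: "\<And>\<sigma>. \<sigma> \<noteq> {} \<Longrightarrow> \<sigma> \<subseteq> V \<Longrightarrow> (\<Sum>f\<in>{f\<in>Pow V. \<sigma> \<subseteq> f}. H f) \<le> K / real (card V) * \<tau> ^ (card \<sigma> - 1)"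
      and tot: "\<delta> \<le> (\<Sum>f\<in>Pow V. H f)"
    define N where "N = card V"
    have N: "N > 0" unfolding N_def using V by (simp add: card_gt_0_iff)
    obtain en where en: "bij_betw en {..<N} V"
      using V(1) ex_bij_betw_nat_finite[of V] unfolding N_def atLeast0LessThan by blast
    then have inj: "inj_on en {..<N}" and im: "en ` {..<N} = V" by (auto simp: bij_betw_def)
    have enPow: "bij_betw ((`) en) (Pow {..<N}) (Pow V)" using bij_betw_Pow[OF en] .
    define H' where "H' f = (if f \<subseteq> {..<N} then H (en ` f) else 0)" for f
    have cardim: "card (en ` f) = card f" if "f \<subseteq> {..<N}" for f
      using card_image inj_on_subset[OF inj that] by blast
    interpret online_container N l K \<tau> \<zeta> H'
    proof
      show "(\<Sum>f\<in>{f\<in>Pow {..<N}. \<sigma> \<subseteq> f}. H' f) \<le> K / real N * \<tau> ^ (card \<sigma> - 1)"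
        if \<sigma>: "\<sigma> \<noteq> {}" "\<sigma> \<subseteq> {..<N}" for \<sigma>
      proof -
        have "(\<Sum>f\<in>{f\<in>Pow {..<N}. \<sigma> \<subseteq> f}. H' f) = (\<Sum>f\<in>{f\<in>Pow {..<N}. \<sigma> \<subseteq> f}. H (en ` f))"
          by (rule sum.cong) (auto simp: H'_def)
        also have "\<dots> = (\<Sum>g\<in>(`) en ` {f\<in>Pow {..<N}. \<sigma> \<subseteq> f}. H g)"
        proof (subst sum.reindex)
          show "inj_on ((`) en) {f \<in> Pow {..<N}. \<sigma> \<subseteq> f}"
            by (rule inj_on_subset[OF bij_betw_imp_inj_on[OF enPow]]) auto
        qed simp
        also have "\<dots> \<le> (\<Sum>g\<in>{g\<in>Pow V. en ` \<sigma> \<subseteq> g}. H g)"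
          by (rule sum_mono2) (use V H0 im in auto)
        also have "\<dots> \<le> K / real N * \<tau> ^ (card \<sigma> - 1)"
          using Hd[of "en ` \<sigma>"] \<sigma> im cardim by (auto simp: N_def)
        finally show ?thesis .
      qed
      show "H' f \<noteq> 0 \<Longrightarrow> f \<subseteq> {..<N} \<and> card f = l" for f
        using Hs[of "en ` f"] cardim[of f] by (auto simp: H'_def split: if_splits)
    qed (use N assms \<tau> e H0 in \<open>auto simp: H'_def\<close>)
    have tot': "\<delta> \<le> total J l" for J
    proof -
      have "(\<Sum>f\<in>Pow {..<N}. H' f) = (\<Sum>f\<in>Pow {..<N}. H (en ` f))"
        by (rule sum.cong) (auto simp: H'_def)
      also have "\<dots> = (\<Sum>g\<in>Pow V. H g)"
        by (rule sum.reindex_bij_betw[OF enPow])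
      finally show ?thesis using tot by (simp add: total_def state_top)
    qed
    define b where "b = nat \<lfloor>C * \<tau> * N\<rfloor>"
    have fpC: "real (card (fingerprint J)) \<le> C * \<tau> * N" for J
      using card_fingerprint_le[of J] by (simp add: C_def)
    then have fpb: "card (fingerprint J) \<le> b" for J unfolding b_def by (simp add: le_nat_floor)
    have big: "real (card ({..<N} - container J)) \<ge> c * N" for J
    proof -
      have "real l * K * real (card (fingerprint J)) / N \<le> real l * K * (C * \<tau> * N) / N"
        using fpC[of J] assms by (intro divide_right_mono mult_left_mono) auto
      also have "\<dots> = real l * K * C * \<tau>" using N by simp
      also have "\<dots> \<le> real l * K * C * (e / (8 * real l * K * C))"
        using \<tau> c assms C by (intro mult_left_mono) auto
      also have "\<dots> = e / 8" using assms C by simp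
      finally have "real (card ({..<N} - container J)) \<ge> \<delta> * \<theta> ^ (l - 1) * N / (2 * real l * K)"
        using \<theta> assms tot' by (intro complement_container_large[where s = l]) (auto simp: \<zeta>_def e_def)
      also have "\<delta> * \<theta> ^ (l - 1) * N / (2 * real l * K) = e / (2 * real l * K) * N" by (simp add: e_def)
      finally have "e / (2 * real l * K) * N \<le> real (card ({..<N} - container J))" .
      moreover have "c * N \<le> e / (2 * real l * K) * N" using c by (intro mult_right_mono) auto
      ultimately show ?thesis by linarith
    qed
    have Csub: "container J \<subseteq> {..<N}" for J by (auto simp: container_def)
    have small: "real (card (container J)) \<le> (1 - c) * N" for J
    proof -
      have "card (container J) \<le> N" using card_mono[OF _ Csub] by fastforce
      moreover have "card ({..<N} - container J) = N - card (container J)"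
        using card_Diff_subset[OF _ Csub] finite_subset[OF Csub] by simp
      ultimately show ?thesis using big[of J] by (simp add: of_nat_diff algebra_simps)
    qed
    let ?T = "{T. T \<subseteq> {..<N} \<and> card T \<le> b}"
    \<comment> \<open>All sets of at most \<open>b\<close> vertices are used, whether or not they
      arise as fingerprints of independent sets; \<open>small\<close> holds for every one of
      them.\<close>
    define \<C> where "\<C> = (\<lambda>T. en ` container T) ` ?T"
    have "card \<C> \<le> card ?T" unfolding \<C>_def by (rule card_image_le) (simp add: card_small_subsets_le)
    also have "\<dots> \<le> (N + 1) ^ b" using card_small_subsets_le(2)[of "{..<N}" b] by simp
    finally have "real (card \<C>) \<le> real (N + 1) ^ b"
      by (metis of_nat_le_iff of_nat_power)
    also have "\<dots> = real (N + 1) powr b" by (simp add: powr_realpow)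
    also have "\<dots> \<le> real (N + 1) powr (C * \<tau> * N)"
      unfolding b_def using \<tau> C by (intro powr_mono) auto
    finally have 1: "real (card \<C>) \<le> real (N + 1) powr (C * \<tau> * N)" .
    have 2: "finite \<C>" unfolding \<C>_def by (intro finite_imageI card_small_subsets_le) simp
    have 3: "D \<subseteq> V \<and> real (card D) \<le> (1 - c) * N" if "D \<in> \<C>" for D
      using that Csub im small cardim[OF Csub] unfolding \<C>_def by fastforce
    have 4: "\<exists>D\<in>\<C>. I \<subseteq> D" if I: "I \<subseteq> V" "\<forall>A\<subseteq>I. H A = 0" for I
    proof -
      define I' where "I' = {x. x < N \<and> en x \<in> I}"
      have I': "I' \<subseteq> {..<N}" "en ` I' = I" using I im by (auto simp: I'_def)
      have "I' \<subseteq> container (fingerprint I')"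
      proof (rule independent_subset_container[OF I'(1)])
        fix A assume "A \<subseteq> I'"
        then have "en ` A \<subseteq> I" using I' by blast
        then show "H' A = 0" using I by (auto simp: H'_def)
      qed
      then have "I \<subseteq> en ` container (fingerprint I')" using I' by blast
      moreover have "fingerprint I' \<in> ?T" using fpb by (auto simp: fingerprint_def)
      ultimately show ?thesis unfolding \<C>_def by blast
    qed
    show "\<exists>\<C>. finite \<C> \<and> real (card \<C>) \<le> real (card V + 1) powr (C * \<tau> * real (card V)) \<and>
        (\<forall>D\<in>\<C>. D \<subseteq> V \<and> real (card D) \<le> (1 - c) * real (card V)) \<and>
        (\<forall>I\<subseteq>V. (\<forall>A\<subseteq>I. H A = 0) \<longrightarrow> (\<exists>D\<in>\<C>. I \<subseteq> D))"
      using 1 2 3 4 unfolding N_def by (intro exI[of _ \<C>]) auto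
  qed
qed

section \<open>Dense subfamilies with controlled degrees\<close>

text \<open>Extremal form of greedy deletion. In a maximiser of \<open>v\<close>, a class with fewer
  than \<open>y\<close> elements cannot occur: removing it would lose less than \<open>y\<close>
  elements and save one class, worth \<open>y\<close>. The hypothesis says that \<open>v X\<close>
  is positive, which keeps the maximiser nonempty.\<close>

lemma deletion:
  fixes y :: real
  assumes X: "finite X" and I: "finite I" and y: "y \<ge> 0"
    and less: "(\<Sum>i\<in>I. real (card (g i ` X))) * y < real (card X)"
  obtains X' where "X' \<subseteq> X" "X' \<noteq> {}"
    "\<And>x i. x \<in> X' \<Longrightarrow> i \<in> I \<Longrightarrow> y \<le> real (card {x'\<in>X'. g i x' = g i x})"
proof -
  define v where "v Z = real (card Z) - (\<Sum>i\<in>I. real (card (g i ` Z))) * y" for Z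
  define m where "m = Max (v ` Pow X)"
  have fin: "finite (v ` Pow X)" using X by simp
  obtain Z where Z: "Z \<subseteq> X" "v Z = m"
    using Max_in[OF fin] unfolding m_def by fastforce
  have max: "v Z' \<le> m" if "Z' \<subseteq> X" for Z' unfolding m_def using fin that by auto
  have "0 < v X" unfolding v_def using less by simp
  then have pos: "0 < v Z" using max[of X] Z by simp
  have finZ: "finite Z" using X Z finite_subset by blast
  show ?thesis
  proof (rule that[OF Z(1)])
    show "Z \<noteq> {}" using pos by (auto simp: v_def)
    fix x i assume x: "x \<in> Z" and i: "i \<in> I"
    show "y \<le> real (card {x'\<in>Z. g i x' = g i x})"
    proof (rule ccontr)
      assume c: "\<not> ?thesis"
      let ?F = "{x'\<in>Z. g i x' = g i x}" and ?Z = "{x'\<in>Z. g i x' \<noteq> g i x}"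
      have cZ: "card Z = card ?F + card ?Z"
      proof -
        have "Z = ?F \<union> ?Z" by auto
        then show ?thesis using card_Un_disjoint[of ?F ?Z] finZ by auto
      qed
      have le: "card (g j ` ?Z) \<le> card (g j ` Z)" for j using finZ by (intro card_mono) auto
      have "g i ` ?Z \<subseteq> g i ` Z - {g i x}" by auto
      then have "card (g i ` ?Z) \<le> card (g i ` Z - {g i x})" using finZ by (intro card_mono) auto
      also have "\<dots> = card (g i ` Z) - 1" using x finZ by simp
      finally have "card (g i ` ?Z) \<le> card (g i ` Z) - 1" .
      moreover have "card (g i ` Z) > 0" using x finZ by (auto simp: card_gt_0_iff)
      ultimately have "card (g i ` ?Z) + 1 \<le> card (g i ` Z)" by linarith
      then have "real (card (g i ` ?Z)) + 1 \<le> real (card (g i ` Z))" by linarith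
      then have "(\<Sum>j\<in>I. real (card (g j ` ?Z))) + 1 \<le> (\<Sum>j\<in>I. real (card (g j ` Z)))"
        using sum_mono[of "I - {i}" "\<lambda>j. real (card (g j ` ?Z))" "\<lambda>j. real (card (g j ` Z))"]
        unfolding sum.remove[OF I i] by (simp add: le)
      then have "((\<Sum>j\<in>I. real (card (g j ` ?Z))) + 1) * y \<le> (\<Sum>j\<in>I. real (card (g j ` Z))) * y"
        using y by (rule mult_right_mono)
      then have "v Z < v ?Z" using c cZ unfolding v_def by (simp add: algebra_simps)
      then show False using max[of ?Z] Z by auto
    qed
  qed
qed

text \<open>Peeling: all edges through a set \<open>e\<close> of low degree are assigned to
  \<open>e\<close> and removed. No later edge contains \<open>e\<close>, so the class of
  \<open>e\<close> never grows again.\<close>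

lemma degenerate_assignment:
  assumes "finite E"
    and "\<And>E'. E' \<subseteq> E \<Longrightarrow> E' \<noteq> {} \<Longrightarrow> \<exists>e. P e \<and> {f\<in>E'. e \<subseteq> f} \<noteq> {} \<and> card {f\<in>E'. e \<subseteq> f} \<le> A"
  shows "\<exists>\<kappa>. (\<forall>f\<in>E. P (\<kappa> f) \<and> \<kappa> f \<subseteq> f) \<and> (\<forall>e. card {f\<in>E. \<kappa> f = e} \<le> A)"
  using assms
proof (induction "card E" arbitrary: E rule: less_induct)
  case less
  show ?case
  proof (cases "E = {}")
    case False
    then obtain e where e: "P e" "{f\<in>E. e \<subseteq> f} \<noteq> {}" "card {f\<in>E. e \<subseteq> f} \<le> A"
      using less.prems(2)[of E] by blast
    let ?E = "{f\<in>E. \<not> e \<subseteq> f}"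
    have "?E \<subset> E" using e by auto
    then have "card ?E < card E" using less.prems(1) psubset_card_mono by blast
    moreover have "\<exists>e. P e \<and> {f\<in>E'. e \<subseteq> f} \<noteq> {} \<and> card {f\<in>E'. e \<subseteq> f} \<le> A" if "E' \<subseteq> ?E" "E' \<noteq> {}" for E'
      using less.prems(2)[of E'] that by blast
    ultimately obtain \<kappa> where \<kappa>: "\<forall>f\<in>?E. P (\<kappa> f) \<and> \<kappa> f \<subseteq> f" "\<forall>e. card {f\<in>?E. \<kappa> f = e} \<le> A"
      using less.hyps[of ?E] less.prems(1) by auto
    define \<kappa>' where "\<kappa>' f = (if e \<subseteq> f then e else \<kappa> f)" for f
    have "card {f\<in>E. \<kappa>' f = e'} \<le> A" for e'
    proof (cases "e' = e")
      case True
      have "{f\<in>E. \<kappa>' f = e} \<subseteq> {f\<in>E. e \<subseteq> f}" using \<kappa>(1) by (auto simp: \<kappa>'_def split: if_splits)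
      then have "card {f\<in>E. \<kappa>' f = e} \<le> card {f\<in>E. e \<subseteq> f}" using less.prems(1) by (intro card_mono) auto
      then show ?thesis using e True by simp
    next
      case False
      then have "{f\<in>E. \<kappa>' f = e'} = {f\<in>?E. \<kappa> f = e'}" by (auto simp: \<kappa>'_def)
      then show ?thesis using \<kappa>(2) by simp
    qed
    moreover have "\<forall>f\<in>E. P (\<kappa>' f) \<and> \<kappa>' f \<subseteq> f" using \<kappa>(1) e by (auto simp: \<kappa>'_def)
    ultimately show ?thesis by blast
  qed auto
qed

text \<open>Degeneracy of the edge set with respect to \<open>k\<close>-subsets: the least \<open>A\<close> for which the
  assignment above exists is witnessed by a subfamily of minimum positive \<open>k\<close>-degree \<open>A\<close>.\<close>

lemma degenerate_core:
  assumes E: "finite E" "E \<noteq> {}" "\<And>f. f \<in> E \<Longrightarrow> finite f \<and> card f = r" and k: "k \<le> r"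
  obtains A E' where "A \<ge> 1" "E' \<subseteq> E" "E' \<noteq> {}"
    and "\<And>f e. f \<in> E' \<Longrightarrow> e \<subseteq> f \<Longrightarrow> card e = k \<Longrightarrow> A \<le> card {f\<in>E'. e \<subseteq> f}"
    and "\<And>E''. E'' \<subseteq> E \<Longrightarrow> E'' \<noteq> {} \<Longrightarrow> \<exists>e. card e = k \<and> {f\<in>E''. e \<subseteq> f} \<noteq> {} \<and> card {f\<in>E''. e \<subseteq> f} \<le> A"
proof -
  define Q where "Q A \<longleftrightarrow> (\<forall>E''\<subseteq>E. E'' \<noteq> {} \<longrightarrow> (\<exists>e. card e = k \<and> {f\<in>E''. e \<subseteq> f} \<noteq> {} \<and> card {f\<in>E''. e \<subseteq> f} \<le> A))" for A
  have "Q (card E)"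
    unfolding Q_def
  proof (intro allI impI)
    fix E'' assume E'': "E'' \<subseteq> E" "E'' \<noteq> {}"
    then obtain f where f: "f \<in> E''" by auto
    then have "card f = r" using E E'' by auto
    then obtain e where e: "e \<subseteq> f" "card e = k" using k obtain_subset_with_card_n by metis
    have "card {f\<in>E''. e \<subseteq> f} \<le> card E" using E E'' by (intro card_mono) auto
    then show "\<exists>e. card e = k \<and> {f\<in>E''. e \<subseteq> f} \<noteq> {} \<and> card {f\<in>E''. e \<subseteq> f} \<le> card E"
      using e f by blast
  qed
  define A where "A = (LEAST A. Q A)"
  have QA: "Q A" unfolding A_def using \<open>Q (card E)\<close> by (rule LeastI)
  have A1: "A \<ge> 1"
  proof (rule ccontr)
    assume "\<not> 1 \<le> A"
    then have "Q 0" using QA by (metis less_one not_le)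
    then obtain e where "{f\<in>E. e \<subseteq> f} \<noteq> {}" "card {f\<in>E. e \<subseteq> f} \<le> 0"
      using E(2) Q_def[of 0, THEN iffD1, rule_format, of E] by auto
    then show False using E(1) by fastforce
  qed
  \<comment> \<open>Positivity of \<open>A\<close> makes the truncated subtraction harmless.
    Minimality of \<open>A\<close> yields a subfamily in which every \<open>k\<close>-set of
    positive degree has degree at least \<open>A\<close>.\<close>
  then have "A - 1 < A" by simp
  then have "\<not> Q (A - 1)" using not_less_Least[of "A - 1" Q] by (simp only: A_def not_False_eq_True)
  then obtain E' where E': "E' \<subseteq> E" "E' \<noteq> {}"
    "\<And>e. card e = k \<Longrightarrow> {f\<in>E'. e \<subseteq> f} \<noteq> {} \<Longrightarrow> \<not> card {f\<in>E'. e \<subseteq> f} \<le> A - 1"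
    using Q_def[of "A - 1"] by meson
  show ?thesis
  proof (rule that[OF A1 E'(1,2)])
    show "A \<le> card {f\<in>E'. e \<subseteq> f}" if "f \<in> E'" "e \<subseteq> f" "card e = k" for f e
      using E'(3)[of e] that A1 by fastforce
  qed (use QA Q_def in blast)
qed

text \<open>In a uniform family whose \<open>k\<close>-sets have degree at least \<open>A\<close>, the link of a \<open>(k - 1)\<close>-set
  has minimum degree \<open>A\<close>, so it needs many vertices and hence many edges.\<close>

lemma core_codegree:
  assumes E: "finite E" "\<And>f. f \<in> E \<Longrightarrow> finite f \<and> card f = r" and k: "1 \<le> k" "k < r"
    and deg: "\<And>f e. f \<in> E \<Longrightarrow> e \<subseteq> f \<Longrightarrow> card e = k \<Longrightarrow> A \<le> card {f\<in>E. e \<subseteq> f}"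
    and f: "f \<in> E" "\<sigma> \<subseteq> f" "card \<sigma> = k - 1"
  shows "(real A / real (r - k + 1)) powr (real (r - k + 1) / real (r - k)) \<le> real (card {f\<in>E. \<sigma> \<subseteq> f})"
proof -
  define q where "q = r - k + 1"
  define L where "L = {f\<in>E. \<sigma> \<subseteq> f}"
  define W where "W = \<Union>L - \<sigma>"
  have q: "q \<ge> 2" unfolding q_def using k by simp
  have finL: "finite L" unfolding L_def using E by simp
  have "finite (\<Union>L)" by (rule finite_Union) (use finL E in \<open>auto simp: L_def\<close>)
  then have finW: "finite W" unfolding W_def by simp
  have fin\<sigma>: "finite \<sigma>" using f E finite_subset by blast
  have cL: "card (g - \<sigma>) = q" "g - \<sigma> \<subseteq> W" if "g \<in> L" for g
    using that E f fin\<sigma> k unfolding L_def W_def q_def by (auto simp: card_Diff_subset)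
  have "real (card L) \<le> real (card W) ^ q"
  proof -
    have "card L = card ((\<lambda>g. g - \<sigma>) ` L)"
      by (rule card_image[symmetric]) (auto simp: L_def inj_on_def)
    also have "\<dots> \<le> card {T. T \<subseteq> W \<and> card T = q}"
      using cL finW by (intro card_mono) auto
    also have "\<dots> = card W choose q" using n_subsets[OF finW] by simp
    also have "\<dots> \<le> card W ^ q"
      by (cases "q \<le> card W") (auto simp: binomial_le_pow binomial_eq_0)
    finally show ?thesis by (metis of_nat_le_iff of_nat_power)
  qed
  moreover have "A * card W \<le> card L * q"
  proof -
    have "A * card W = (\<Sum>w\<in>W. A)" by simp
    also have "\<dots> \<le> (\<Sum>w\<in>W. card {g\<in>L. w \<in> g})"
    proof (rule sum_mono)
      fix w assume "w \<in> W"
      then obtain g where g: "g \<in> L" "w \<in> g" "w \<notin> \<sigma>" unfolding W_def by auto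
      then have "A \<le> card {f\<in>E. insert w \<sigma> \<subseteq> f}"
        using fin\<sigma> f k by (intro deg[of g]) (auto simp: L_def)
      also have "{f\<in>E. insert w \<sigma> \<subseteq> f} = {g\<in>L. w \<in> g}" by (auto simp: L_def)
      finally show "A \<le> card {g\<in>L. w \<in> g}" .
    qed
    also have "\<dots> = (\<Sum>w\<in>W. \<Sum>g\<in>{g\<in>L. w \<in> g}. 1)" by simp
    also have "\<dots> = (\<Sum>g\<in>L. \<Sum>w\<in>{w\<in>W. w \<in> g}. 1)"
      by (rule sum.swap_restrict) (use finL finW in auto)
    also have "\<dots> = (\<Sum>g\<in>L. q)"
    proof (rule sum.cong)
      fix g assume g: "g \<in> L"
      then have "{w\<in>W. w \<in> g} = g - \<sigma>" using cL[OF g] by (auto simp: W_def)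
      then show "(\<Sum>w\<in>{w\<in>W. w \<in> g}. 1) = q" using cL[OF g] by simp
    qed simp
    finally show ?thesis by simp
  qed
  moreover have Lpos: "card L > 0" using f finL by (auto simp: L_def card_gt_0_iff)
  \<comment> \<open>With d = \<open>card L\<close>, eliminating \<open>card W\<close> from d \<le>
    \<open>card W ^ q\<close> and \<open>A * card W\<close> \<le> q d gives A d^(1/q) \<le> q d,
    that is d^(1 - 1/q) \<ge> A/q. The exponent is then inverted.\<close>
  ultimately have 1: "real (card L) \<le> real (card W) ^ q" and 2: "real A * real (card W) \<le> real (card L) * real q"
    by (auto simp flip: of_nat_mult)
  let ?d = "real (card L)"
  have d: "?d > 0" using Lpos by simp
  have "?d powr (1 / real q) \<le> (real (card W) ^ q) powr (1 / real q)"
    using 1 by (intro powr_mono2) auto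
  also have "\<dots> = real (card W)"
  proof (cases "card W = 0")
    case True
    then show ?thesis using q by simp
  next
    case False
    then show ?thesis using q by (simp add: powr_powr flip: powr_realpow)
  qed
  finally have "real A * ?d powr (1 / real q) \<le> ?d * real q"
    using 2 by (meson mult_left_mono of_nat_0_le_iff order_trans)
  then have "real A / real q \<le> ?d / ?d powr (1 / real q)"
    using q d by (simp add: field_simps)
  also have "\<dots> = ?d powr (1 - 1 / real q)"
    using d by (simp add: powr_diff)
  finally have "(real A / real q) powr (real q / real (q - 1)) \<le> (?d powr (1 - 1 / real q)) powr (real q / real (q - 1))"
    by (intro powr_mono2) auto
  also have "\<dots> = ?d powr ((1 - 1 / real q) * (real q / real (q - 1)))" by (simp add: powr_powr)
  also have "(1 - 1 / real q) * (real q / real (q - 1)) = 1"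
    using q by (simp add: field_simps of_nat_diff)
  finally show ?thesis using d by (simp add: q_def L_def)
qed

text \<open>Removing by rank and not by element matters: two edges with the same value for the same
  \<open>i\<close> agree at every other rank, so ranks can play the part of colours.\<close>

definition drop_nth :: "(nat set \<Rightarrow> nat set) \<Rightarrow> nat \<Rightarrow> nat set \<Rightarrow> nat set" where
  "drop_nth \<kappa> i f = \<kappa> f - {sorted_list_of_set (\<kappa> f) ! i}"

lemma drop_nth_props:
  assumes "finite f" "\<kappa> f \<subseteq> f" "card (\<kappa> f) = k" "i < k"
  shows "drop_nth \<kappa> i f \<subseteq> f" "card (drop_nth \<kappa> i f) = k - 1"
proof -
  have "finite (\<kappa> f)" using assms finite_subset by blast
  then have "sorted_list_of_set (\<kappa> f) ! i \<in> \<kappa> f"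
    using assms by (metis nth_mem set_sorted_list_of_set length_sorted_list_of_set)
  then show "drop_nth \<kappa> i f \<subseteq> f" "card (drop_nth \<kappa> i f) = k - 1"
    using assms by (auto simp: drop_nth_def)
qed

text \<open>A dichotomy on the degeneracy \<open>A\<close>, which bounds the classes of
  \<open>\<kappa>\<close> in both cases. If \<open>A\<close> is at most the power \<Delta>/q of
  \<open>y0\<close>, all of \<open>E\<close> is used, since there are only
  \<open>n ^ (k - 1)\<close> candidates for a (k-1)-set. If \<open>A\<close> is larger, the core is
  used: \<open>core_codegree\<close> makes its (k-1)-sets so rich that their degree is again large
  compared with \<open>A\<close>.\<close>

lemma good_family:
  fixes r k n :: nat and E :: "nat set set"
  defines "q \<equiv> real (r - k + 1)" and "y0 \<equiv> real (card E) / real n ^ (k - 1)"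
  assumes k: "1 \<le> k" "k \<le> r" and E: "E \<subseteq> r_sets r n" and y0: "1 \<le> y0"
  obtains X \<kappa> D y where "X \<subseteq> E" "X \<noteq> {}"
    "\<And>f. f \<in> X \<Longrightarrow> \<kappa> f \<subseteq> f \<and> card (\<kappa> f) = k"
    "\<And>e. card {f\<in>X. \<kappa> f = e} \<le> D" "1 \<le> D"
    "\<And>f i. f \<in> X \<Longrightarrow> i < k \<Longrightarrow> y \<le> real (card {f'\<in>X. drop_nth \<kappa> i f' = drop_nth \<kappa> i f})"
    "y0 / (2 * real k * 2 ^ r * q ^ 2) \<le> y"
    "real D \<le> (q * (2 * real k * 2 ^ r)) * y powr (real (r - k) / q)"
proof -
  note good = that
  have finE: "finite E" using E finite_subset[of E "Pow {..<n}"] by (auto simp: r_sets_def)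
  have Ene: "E \<noteq> {}" using y0 by (auto simp: y0_def)
  have Ef: "finite f \<and> card f = r \<and> f \<subseteq> {..<n}" if "f \<in> E" for f
    using that E finite_subset[of f "{..<n}"] by (auto simp: r_sets_def)
  have n0: "n > 0"
  proof (rule ccontr)
    obtain f where "f \<in> E" using Ene by auto
    moreover assume "\<not> 0 < n"
    ultimately show False using Ef[of f] k by auto
  qed
  have q1: "q \<ge> 1" unfolding q_def by simp
  have Efr: "finite f \<and> card f = r" if "f \<in> E" for f using Ef that by blast
  obtain A E' where A1: "A \<ge> 1" and E': "E' \<subseteq> E" "E' \<noteq> {}"
    and degE': "\<And>f e. f \<in> E' \<Longrightarrow> e \<subseteq> f \<Longrightarrow> card e = k \<Longrightarrow> A \<le> card {f\<in>E'. e \<subseteq> f}"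
    and degen: "\<And>E''. E'' \<subseteq> E \<Longrightarrow> E'' \<noteq> {} \<Longrightarrow> \<exists>e. card e = k \<and> {f\<in>E''. e \<subseteq> f} \<noteq> {} \<and> card {f\<in>E''. e \<subseteq> f} \<le> A"
    using degenerate_core[OF finE Ene Efr k(2)] by blast
  have "\<exists>\<kappa>. (\<forall>f\<in>E. card (\<kappa> f) = k \<and> \<kappa> f \<subseteq> f) \<and> (\<forall>e. card {f\<in>E. \<kappa> f = e} \<le> A)"
    by (rule degenerate_assignment[OF finE degen])
  then obtain \<kappa> where \<kappa>: "\<And>f. f \<in> E \<Longrightarrow> card (\<kappa> f) = k \<and> \<kappa> f \<subseteq> f" and \<kappa>A: "\<And>e. card {f\<in>E. \<kappa> f = e} \<le> A"
    by blast
  \<comment> \<open>\<open>B\<close> bounds the number of (k-1)-sets that occur for one rank. The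
    factor 2 in \<open>y\<close> lets the \<open>k\<close> ranks together account for at most half
    of \<open>Z\<close>, which gives the strict inequality needed for
    \<open>deletion\<close>.\<close>
  have main: thesis if Z: "Z \<subseteq> E" "Z \<noteq> {}" and B: "B > 0"
      "\<And>i. i < k \<Longrightarrow> real (card (drop_nth \<kappa> i ` Z)) \<le> B"
      and y: "y = real (card Z) / (2 * real k * B)"
      and b1: "y0 / (2 * real k * 2 ^ r * q ^ 2) \<le> y"
      and b2: "real A \<le> (q * (2 * real k * 2 ^ r)) * y powr (real (r - k) / q)" for Z B y
  proof -
    have finZ: "finite Z" using Z finE finite_subset by blast
    have cZ: "card Z > 0" using Z finZ by (simp add: card_gt_0_iff)
    have y0': "y > 0" using y B cZ k by simp
    have "(\<Sum>i\<in>{..<k}. real (card (drop_nth \<kappa> i ` Z))) \<le> (\<Sum>i\<in>{..<k}. B)"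
      using B by (intro sum_mono) auto
    then have "(\<Sum>i\<in>{..<k}. real (card (drop_nth \<kappa> i ` Z))) * y \<le> (real k * B) * y"
      using y0' by (intro mult_right_mono) auto
    also have "\<dots> = real (card Z) / 2" using y B k by simp
    also have "\<dots> < real (card Z)" using cZ by simp
    finally have lt: "(\<Sum>i\<in>{..<k}. real (card (drop_nth \<kappa> i ` Z))) * y < real (card Z)" .
    obtain X where X: "X \<subseteq> Z" "X \<noteq> {}"
      "\<And>f i. f \<in> X \<Longrightarrow> i \<in> {..<k} \<Longrightarrow> y \<le> real (card {f'\<in>X. drop_nth \<kappa> i f' = drop_nth \<kappa> i f})"
      using deletion[OF finZ finite_lessThan less_imp_le[OF y0'] lt] by blast
    show thesis
    proof (rule good[of X \<kappa> A y])
      show "card {f\<in>X. \<kappa> f = e} \<le> A" for e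
      proof -
        have "card {f\<in>X. \<kappa> f = e} \<le> card {f\<in>E. \<kappa> f = e}"
          using X Z finE by (intro card_mono) auto
        then show ?thesis using \<kappa>A[of e] by simp
      qed
      show "\<kappa> f \<subseteq> f \<and> card (\<kappa> f) = k" if "f \<in> X" for f
        using \<kappa>[of f] that X(1) Z(1) by blast
      show "X \<subseteq> E" using X(1) Z(1) by simp
      show "y \<le> real (card {f'\<in>X. drop_nth \<kappa> i f' = drop_nth \<kappa> i f})" if "f \<in> X" "i < k" for f i
        using X(3)[of f i] that by simp
    qed (use X(2) A1 b1 b2 in blast)+
  qed
  have sub: "drop_nth \<kappa> i f \<subseteq> f \<and> card (drop_nth \<kappa> i f) = k - 1" if "f \<in> E" "i < k" for f i
    using drop_nth_props[of f \<kappa> k i] that \<kappa> Ef by blast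
  have qe: "real (r - k) / q \<le> 1" "0 \<le> real (r - k) / q" unfolding q_def by auto
  have k2: "2 * real k * 2 ^ r \<ge> 1" using k by (simp add: mult_ge1_I)
  have k2q: "2 * real k * 2 ^ r * q ^ 2 \<ge> 2 * real k"
  proof -
    have "(2 * real k) * 1 \<le> (2 * real k) * (2 ^ r * q ^ 2)"
      using q1 by (intro mult_left_mono) (auto simp: mult_ge1_I)
    then show ?thesis by (simp add: mult.assoc)
  qed
  have powr_const: "(c * y) powr (real (r - k) / q) \<le> c * y powr (real (r - k) / q)" if "c \<ge> 1" "y \<ge> 0" for c y
  proof -
    have "(c * y) powr (real (r - k) / q) = c powr (real (r - k) / q) * y powr (real (r - k) / q)"
      using that by (simp add: powr_mult)
    also have "c powr (real (r - k) / q) \<le> c powr 1" using that qe by (intro powr_mono) auto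
    finally show ?thesis using that by (simp add: mult_right_mono)
  qed
  show thesis
  proof (cases "real A \<le> y0 powr (real (r - k) / q)")
    case True
    define y where "y = y0 / (2 * real k)"
    show thesis
    proof (rule main[of E "real n ^ (k - 1)" y])
      show "real (card (drop_nth \<kappa> i ` E)) \<le> real n ^ (k - 1)" if "i < k" for i
      proof -
        have "drop_nth \<kappa> i ` E \<subseteq> {\<sigma>. \<sigma> \<subseteq> {..<n} \<and> card \<sigma> = k - 1}"
          using sub that Ef by blast
        then have "card (drop_nth \<kappa> i ` E) \<le> card {\<sigma>. \<sigma> \<subseteq> {..<n} \<and> card \<sigma> = k - 1}"
          by (intro card_mono) auto
        also have "\<dots> = n choose (k - 1)" by (simp add: n_subsets)
        also have "\<dots> \<le> n ^ (k - 1)"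
          by (cases "k - 1 \<le> n") (auto simp: binomial_le_pow binomial_eq_0)
        finally show ?thesis by (metis of_nat_le_iff of_nat_power)
      qed
      show "y = real (card E) / (2 * real k * real n ^ (k - 1))" by (simp add: y_def y0_def)
      show "y0 / (2 * real k * 2 ^ r * q ^ 2) \<le> y"
        unfolding y_def
      proof (rule divide_left_mono[OF k2q])
        show "0 < 2 * real k * 2 ^ r * q\<^sup>2 * (2 * real k)"
          using k q1 by (intro mult_pos_pos) auto
      qed (use y0 in simp)
      have y0y: "y0 = (2 * real k) * y" using k by (simp add: y_def)
      have ypos: "y \<ge> 0" unfolding y_def using y0 by simp
      have "real A \<le> ((2 * real k) * y) powr (real (r - k) / q)" using True y0y by simp
      also have "\<dots> \<le> (2 * real k) * y powr (real (r - k) / q)"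
        by (rule powr_const) (use k ypos in auto)
      also have "\<dots> \<le> (q * (2 * real k * 2 ^ r)) * y powr (real (r - k) / q)"
      proof (rule mult_right_mono)
        have "(2 * real k) * 1 \<le> (2 * real k) * (q * 2 ^ r)"
          using q1 by (intro mult_left_mono) (auto simp: mult_ge1_I)
        then show "2 * real k \<le> q * (2 * real k * 2 ^ r)" by (simp add: mult_ac)
      qed simp
      finally show "real A \<le> (q * (2 * real k * 2 ^ r)) * y powr (real (r - k) / q)" .
    qed (use Ene n0 in auto)
  next
    case False
    have finE': "finite E'" using E' finE finite_subset by blast
    \<comment> \<open>For \<open>k = r\<close> the exponent is 0 and this case would mean
      \<open>A > 1\<close>, whereas an \<open>r\<close>-set lies in only one edge of the
      core.\<close>
    have kr: "k < r"
    proof (rule ccontr)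
      assume "\<not> k < r"
      then have kr: "k = r" using k by simp
      obtain f where f: "f \<in> E'" using E' by auto
      have "A \<le> card {g\<in>E'. f \<subseteq> g}" using degE'[of f f] f E' Ef kr by auto
      also have "{g\<in>E'. f \<subseteq> g} = {f}"
        using f E' Ef by (auto simp: subset_iff intro: card_subset_eq[symmetric])
           (metis Ef card_subset_eq subsetD subsetI)+
      finally show False using False kr y0 by simp
    qed
    \<comment> \<open>\<open>Y\<close> is the codegree supplied by \<open>core_codegree\<close>; it
      is defined by inverting the desired relation between \<open>D\<close> and
      \<open>y\<close>.\<close>
    define Y where "Y = (real A / q) powr (q / real (r - k))"
    have Ypos: "Y > 0" unfolding Y_def using A1 q1 by simp
    have AY: "real A = q * Y powr (real (r - k) / q)"
      unfolding Y_def using q1 kr A1 by (simp add: powr_powr)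
    have Yy0: "y0 / q ^ 2 \<le> Y"
    proof -
      have le2: "q / real (r - k) \<le> 2" unfolding q_def using kr by (simp add: field_simps)
      have "(y0 powr (real (r - k) / q) / q) powr (q / real (r - k)) \<le> Y"
        unfolding Y_def using False q1 by (intro powr_mono2) (auto simp: divide_right_mono)
      moreover have "(y0 powr (real (r - k) / q) / q) powr (q / real (r - k)) = y0 / q powr (q / real (r - k))"
        using q1 kr y0 by (simp add: powr_divide powr_powr)
      moreover have "y0 / q ^ 2 \<le> y0 / q powr (q / real (r - k))"
      proof (rule divide_left_mono)
        have "q powr (q / real (r - k)) \<le> q powr 2" using q1 le2 by (intro powr_mono) auto
        then show "q powr (q / real (r - k)) \<le> q ^ 2" using q1 by (simp add: powr_numeral)
      qed (use q1 y0 in auto)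
      ultimately show ?thesis by linarith
    qed
    \<comment> \<open>Counting pairs of a (k-1)-set and a core edge containing it shows that the
      core has few (k-1)-sets: each has degree at least \<open>Y\<close>, and an edge has at most
      \<open>2 ^ r\<close> subsets.\<close>
    define S where "S = {\<sigma>. card \<sigma> = k - 1 \<and> (\<exists>f\<in>E'. \<sigma> \<subseteq> f)}"
    have finS: "finite S"
    proof (rule finite_subset)
      show "S \<subseteq> Pow {..<n}" using E' Ef unfolding S_def by blast
    qed simp
    have cS: "real (card S) * Y \<le> real (card E') * 2 ^ r"
    proof -
      have "real (card S) * Y = (\<Sum>\<sigma>\<in>S. Y)" by simp
      also have "\<dots> \<le> (\<Sum>\<sigma>\<in>S. real (card {f\<in>E'. \<sigma> \<subseteq> f}))"
      proof (rule sum_mono)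
        fix \<sigma> assume "\<sigma> \<in> S"
        then obtain f where f: "f \<in> E'" "\<sigma> \<subseteq> f" "card \<sigma> = k - 1" unfolding S_def by auto
        show "Y \<le> real (card {f\<in>E'. \<sigma> \<subseteq> f})"
          unfolding Y_def q_def
          by (rule core_codegree[OF finE' _ k(1) kr degE' f]) (use Ef E' in auto)
      qed
      also have "\<dots> = real (\<Sum>\<sigma>\<in>S. \<Sum>f\<in>{f\<in>E'. \<sigma> \<subseteq> f}. 1)" by simp
      also have "(\<Sum>\<sigma>\<in>S. \<Sum>f\<in>{f\<in>E'. \<sigma> \<subseteq> f}. 1) = (\<Sum>f\<in>E'. \<Sum>\<sigma>\<in>{\<sigma>\<in>S. \<sigma> \<subseteq> f}. 1)"
        by (rule sum.swap_restrict[OF finS finE'])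
      also have "\<dots> \<le> (\<Sum>f\<in>E'. (2::nat) ^ r)"
      proof (rule sum_mono)
        fix f assume "f \<in> E'"
        then have "finite f" "card f = r" using Ef E' by auto
        then have "card {\<sigma>\<in>S. \<sigma> \<subseteq> f} \<le> card (Pow f)" by (intro card_mono) auto
        then show "(\<Sum>\<sigma>\<in>{\<sigma>\<in>S. \<sigma> \<subseteq> f}. 1) \<le> (2::nat) ^ r"
          using card_Pow[OF \<open>finite f\<close>] \<open>card f = r\<close> by simp
      qed
      finally show ?thesis by simp
    qed
    define B where "B = real (card E') * 2 ^ r / Y"
    have cE': "card E' > 0" using E' finE' by (simp add: card_gt_0_iff)
    show thesis
    proof (rule main[of E' B "Y / (2 * real k * 2 ^ r)"])
      show "B > 0" unfolding B_def using cE' Ypos by simp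
      show "real (card (drop_nth \<kappa> i ` E')) \<le> B" if "i < k" for i
      proof -
        have "drop_nth \<kappa> i ` E' \<subseteq> S" using sub that E' unfolding S_def by blast
        then have "real (card (drop_nth \<kappa> i ` E')) \<le> real (card S)" using finS card_mono by simp
        also have "\<dots> \<le> B" unfolding B_def using cS Ypos by (simp add: field_simps)
        finally show ?thesis .
      qed
      show "Y / (2 * real k * 2 ^ r) = real (card E') / (2 * real k * B)"
        unfolding B_def using cE' Ypos by simp
      show "y0 / (2 * real k * 2 ^ r * q\<^sup>2) \<le> Y / (2 * real k * 2 ^ r)"
        using divide_right_mono[OF Yy0, of "2 * real k * 2 ^ r"] by (simp add: mult_ac)
      have eq: "Y = (2 * real k * 2 ^ r) * (Y / (2 * real k * 2 ^ r))" using k by simp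
      have "Y powr (real (r - k) / q) = ((2 * real k * 2 ^ r) * (Y / (2 * real k * 2 ^ r))) powr (real (r - k) / q)"
        using eq by simp
      also have "\<dots> \<le> (2 * real k * 2 ^ r) * (Y / (2 * real k * 2 ^ r)) powr (real (r - k) / q)"
        by (rule powr_const[OF k2]) (use Ypos in simp)
      finally have "q * Y powr (real (r - k) / q) \<le> q * ((2 * real k * 2 ^ r) * (Y / (2 * real k * 2 ^ r)) powr (real (r - k) / q))"
        using q1 by (intro mult_left_mono) auto
      then show "real A \<le> q * (2 * real k * 2 ^ r) * (Y / (2 * real k * 2 ^ r)) powr (real (r - k) / q)"
        using AY by (simp add: mult.assoc)
    qed (use E' in auto)
  qed
qed

section \<open>Random copies of a tight tree\<close>

lemma bij_betw_comp_imageD: "bij_betw (f \<circ> g) A B \<Longrightarrow> bij_betw f (g ` A) B"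
  by (auto simp: bij_betw_def image_comp intro: inj_on_imageI)

lemma inj_on_extend:
  assumes "inj_on \<psi> A" "A \<subseteq> B" "finite B" "finite V" "card B \<le> card V" "\<psi> ` A \<subseteq> V"
  obtains \<phi> where "inj_on \<phi> B" "\<phi> ` B \<subseteq> V" "\<And>a. a \<in> A \<Longrightarrow> \<phi> a = \<psi> a"
proof -
  have finA: "finite A" using assms finite_subset by blast
  have "card (B - A) = card B - card A" using assms finA by (simp add: card_Diff_subset)
  also have "\<dots> \<le> card V - card (\<psi> ` A)" using assms by (simp add: card_image diff_le_mono)
  also have "\<dots> = card (V - \<psi> ` A)" using assms finA by (simp add: card_Diff_subset)
  finally obtain g where g: "inj_on g (B - A)" "g ` (B - A) \<subseteq> V - \<psi> ` A"
    using card_le_inj[of "B - A" "V - \<psi> ` A"] assms by auto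
  define \<phi> where "\<phi> x = (if x \<in> A then \<psi> x else g x)" for x
  have "inj_on \<phi> B"
  proof (rule inj_onI)
    fix x y assume xy: "x \<in> B" "y \<in> B" "\<phi> x = \<phi> y"
    have gx: "g z \<notin> \<psi> ` A" if "z \<in> B" "z \<notin> A" for z using g(2) that by blast
    show "x = y"
    proof (cases "x \<in> A"; cases "y \<in> A")
      assume "x \<in> A" "y \<in> A" then show ?thesis using xy assms(1) by (simp add: \<phi>_def inj_on_eq_iff)
    next
      assume "x \<in> A" "y \<notin> A" then show ?thesis using xy gx[of y] by (metis \<phi>_def imageI)
    next
      assume "x \<notin> A" "y \<in> A" then show ?thesis using xy gx[of x] by (metis \<phi>_def imageI)
    next
      assume "x \<notin> A" "y \<notin> A" then show ?thesis using xy g(1) by (simp add: \<phi>_def inj_on_eq_iff)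
    qed
  qed
  moreover have "\<phi> ` B \<subseteq> V" using assms(6) g(2) unfolding \<phi>_def by auto
  ultimately show ?thesis using that[of \<phi>] by (simp add: \<phi>_def)
qed

text \<open>The tree is given by its edges \<open>es\<close> in order, the parent
  \<open>par i\<close> and the new vertex \<open>nv i\<close> of each edge, and a colouring
  \<open>c\<close> that is bijective on every edge. The bound \<open>yM\<close> ensures that at
  least half of the possible moves avoid all vertices used before.\<close>

locale tree_walk =
  fixes X :: "nat set set" and \<kappa> :: "nat set \<Rightarrow> nat set" and k r D M :: nat and y :: real
    and es :: "nat \<Rightarrow> 'a set" and par :: "nat \<Rightarrow> nat" and nv :: "nat \<Rightarrow> 'a" and c :: "'a \<Rightarrow> nat" and m :: nat
  assumes finX: "finite X" and Xne: "X \<noteq> {}"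
    and X: "f \<in> X \<Longrightarrow> finite f \<and> card f = r \<and> \<kappa> f \<subseteq> f \<and> card (\<kappa> f) = k"
    and D: "card {f\<in>X. \<kappa> f = e} \<le> D" and D1: "1 \<le> D"
    and y: "f \<in> X \<Longrightarrow> i < k \<Longrightarrow> y \<le> real (card {f'\<in>X. drop_nth \<kappa> i f' = drop_nth \<kappa> i f})"
    and y_pos: "0 < y"
    and M: "card e = k \<Longrightarrow> card {f\<in>X. e \<subseteq> f} \<le> M"
    and yM: "2 * real r * real m * real M \<le> y"
    and k_pos: "0 < k"
    and tree: "0 < i \<Longrightarrow> i < m \<Longrightarrow> par i < i \<and> nv i \<in> es i \<and> nv i \<notin> (\<Union>j<i. es j) \<and> es i - {nv i} \<subseteq> es (par i)"
    and colour: "i < m \<Longrightarrow> bij_betw c (es i) {..<k}"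
begin

section \<open>The walk and its total weight\<close>

definition pos :: "nat set \<Rightarrow> nat \<Rightarrow> nat" where
  "pos f i = sorted_list_of_set (\<kappa> f) ! i"

abbreviation trunc :: "nat \<Rightarrow> nat set \<Rightarrow> nat set" where
  "trunc \<equiv> drop_nth \<kappa>"

definition deg :: "nat \<Rightarrow> nat set \<Rightarrow> nat" where
  "deg i f = card {f'\<in>X. trunc i f' = trunc i f}"

abbreviation cnv :: "nat \<Rightarrow> nat" where
  "cnv i \<equiv> c (nv i)"

text \<open>The new edge keeps the vertices of the parent's chosen \<open>k\<close>-set except the
  one whose rank is the colour of the new tree vertex. Outside these \<open>k - 1\<close> vertices
  it must avoid everything used so far; this is what makes a walk an embedding.\<close>

definition nexts :: "nat \<Rightarrow> nat set list \<Rightarrow> nat set set" where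
  "nexts t fs = {h\<in>X. t = 0 \<or> (trunc (cnv t) h = trunc (cnv t) (fs ! par t) \<and> h \<inter> \<Union>(set fs) \<subseteq> trunc (cnv t) h)}"

primrec walks :: "nat \<Rightarrow> nat set list set" where
  "walks 0 = {[]}"
| "walks (Suc t) = (\<lambda>(fs, h). fs @ [h]) ` (SIGMA fs:walks t. nexts t fs)"

text \<open>The denominator counts all edges with the same truncation, also those that
  \<open>nexts\<close> excludes. The weights thus form only a subprobability, but the weight of a
  step depends on the shared truncation alone and is symmetric in the edge and its parent.\<close>

definition stepwt :: "nat \<Rightarrow> nat set \<Rightarrow> real" where
  "stepwt i h = (if i = 0 then 1 / real (card X) else 1 / real (deg (cnv i) h))"

definition wt :: "nat set list \<Rightarrow> real" where
  "wt fs = (\<Prod>i<length fs. stepwt i (fs ! i))"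

lemma fin\<kappa>: "f \<in> X \<Longrightarrow> finite (\<kappa> f)"
  using X[of f] finite_subset[of "\<kappa> f" f] by auto

lemma pos_bij: "f \<in> X \<Longrightarrow> bij_betw (pos f) {..<k} (\<kappa> f)"
  unfolding pos_def using X[of f] fin\<kappa>[of f]
  by (intro bij_betw_nth) auto

lemma kappa_eq: "f \<in> X \<Longrightarrow> i < k \<Longrightarrow> \<kappa> f = insert (pos f i) (trunc i f)"
proof -
  assume "f \<in> X" "i < k"
  then have "pos f i \<in> \<kappa> f" using bij_betwE[OF pos_bij[of f]] by simp
  then show ?thesis unfolding drop_nth_def pos_def by blast
qed

lemma card_trunc: "f \<in> X \<Longrightarrow> i < k \<Longrightarrow> trunc i f \<subseteq> f \<and> card (trunc i f) = k - 1"
proof -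
  assume f: "f \<in> X" "i < k"
  then have "pos f i \<in> \<kappa> f" using bij_betwE[OF pos_bij[of f]] by simp
  then show ?thesis using X[OF f(1)] fin\<kappa>[OF f(1)] unfolding drop_nth_def pos_def by (auto simp: card_Diff_singleton)
qed

text \<open>Deleting the entry of rank \<open>i\<close> from the two sorted lists leaves the same
  list, in which the entry of rank \<open>j\<close> stands at place \<open>j\<close> or
  \<open>j - 1\<close> according to whether \<open>j < i\<close>.\<close>

lemma trunc_agree:
  assumes f: "f \<in> X" "f' \<in> X" and i: "i < k" and eq: "trunc i f = trunc i f'" and j: "j < k" "j \<noteq> i"
  shows "pos f j = pos f' j"
proof -
  have *: "pos g j = sorted_list_of_set (trunc i g) ! (if j < i then j else j - 1)" if g: "g \<in> X" for g
  proof -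
    let ?xs = "sorted_list_of_set (\<kappa> g)"
    have len: "length ?xs = k" using X[OF g] by simp
    have split: "?xs = take i ?xs @ ?xs ! i # drop (Suc i) ?xs" using len i by (simp add: id_take_nth_drop)
    have d: "distinct ?xs" by simp
    have "?xs ! i \<notin> set (take i ?xs)"
      using d len i by (metis split disjoint_insert(1) distinct_append list.simps(15))
    then have "remove1 (?xs ! i) ?xs = take i ?xs @ drop (Suc i) ?xs"
      by (subst split) (simp add: remove1_append)
    moreover have "sorted_list_of_set (trunc i g) = remove1 (?xs ! i) ?xs"
      unfolding drop_nth_def by (rule sorted_list_of_set_remove[OF fin\<kappa>[OF g]])
    ultimately show ?thesis
      using len i j unfolding pos_def by (auto simp: nth_append min_def)
  qed
  show ?thesis using *[OF f(1)] *[OF f(2)] eq by simp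
qed

lemma deg_ge: "f \<in> X \<Longrightarrow> i < k \<Longrightarrow> y \<le> real (deg i f)"
  using y unfolding deg_def .

lemma deg_cong: "trunc i f = trunc i f' \<Longrightarrow> deg i f = deg i f'"
  by (simp add: deg_def)

lemma nexts_subset: "nexts t fs \<subseteq> X"
  by (auto simp: nexts_def)

lemma finite_nexts: "finite (nexts t fs)"
  by (rule finite_subset[OF nexts_subset finX])

lemma walks_length: "fs \<in> walks t \<Longrightarrow> length fs = t \<and> set fs \<subseteq> X"
proof (induction t arbitrary: fs)
  case (Suc t)
  then obtain fs' h where "fs' \<in> walks t" "h \<in> nexts t fs'" "fs = fs' @ [h]" by auto
  then show ?case using Suc.IH[of fs'] nexts_subset by auto
qed auto

lemma finite_walks: "finite (walks t)"
  by (induction t) (auto simp: finite_nexts)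

lemma sum_walks_Suc:
  "(\<Sum>z\<in>walks (Suc t). G z) = (\<Sum>fs\<in>walks t. \<Sum>h\<in>nexts t fs. G (fs @ [h]))"
proof -
  have "inj_on (\<lambda>(fs, h). fs @ [h]) (SIGMA fs:walks t. nexts t fs)"
    by (auto simp: inj_on_def)
  then have "(\<Sum>z\<in>walks (Suc t). G z) = (\<Sum>(fs, h)\<in>(SIGMA fs:walks t. nexts t fs). G (fs @ [h]))"
    unfolding walks.simps by (subst sum.reindex) (auto simp: case_prod_unfold)
  then show ?thesis by (simp add: sum.Sigma finite_walks finite_nexts)
qed

lemma walks_nth: "fs \<in> walks t \<Longrightarrow> i < t \<Longrightarrow> fs ! i \<in> X"
  using walks_length[of fs t] nth_mem[of i fs] by auto

lemma stepwt_nonneg: "0 \<le> stepwt i h"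
  by (simp add: stepwt_def)

lemma wt_nonneg: "0 \<le> wt fs"
  by (simp add: wt_def prod_nonneg stepwt_nonneg)

lemma wt_snoc: "wt (fs @ [h]) = wt fs * stepwt (length fs) h"
  by (simp add: wt_def nth_append)

lemma cnv_less: "0 < t \<Longrightarrow> t < m \<Longrightarrow> cnv t < k"
  using tree[of t] bij_betwE[OF colour[of t]] by auto

lemma step_total_le:
  assumes fs: "fs \<in> walks t" and t: "t < m"
  shows "(\<Sum>h\<in>nexts t fs. stepwt t h) \<le> 1"
proof (cases "t = 0")
  case True
  then show ?thesis using finX Xne by (simp add: stepwt_def nexts_def)
next
  case False
  let ?p = "fs ! par t"
  let ?N = "{h\<in>X. trunc (cnv t) h = trunc (cnv t) ?p}"
  have p: "?p \<in> X" using walks_nth[OF fs] tree[of t] False t by auto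
  have "(\<Sum>h\<in>nexts t fs. stepwt t h) \<le> (\<Sum>h\<in>?N. stepwt t h)"
    by (rule sum_mono2) (use finX False in \<open>auto simp: nexts_def stepwt_nonneg\<close>)
  also have "\<dots> = (\<Sum>h\<in>?N. 1 / real (deg (cnv t) ?p))"
  proof (rule sum.cong)
    fix h assume "h \<in> ?N"
    then have "deg (cnv t) h = deg (cnv t) ?p" by (intro deg_cong) simp
    then show "stepwt t h = 1 / real (deg (cnv t) ?p)" using False by (simp add: stepwt_def)
  qed simp
  also have "\<dots> = real (deg (cnv t) ?p) * (1 / real (deg (cnv t) ?p))" by (simp add: deg_def)
  finally show ?thesis by (simp split: if_splits)
qed

text \<open>An excluded edge contains the truncation and one more old vertex, hence one of at most
  \<open>r * m\<close> specified \<open>k\<close>-sets. Each lies in at most \<open>M\<close> edges,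
  so by \<open>yM\<close> no more than half of the candidates are lost.\<close>

lemma step_total_ge:
  assumes fs: "fs \<in> walks t" and t: "t < m"
  shows "1 / 2 \<le> (\<Sum>h\<in>nexts t fs. stepwt t h)"
proof (cases "t = 0")
  case True
  then show ?thesis using finX Xne by (simp add: stepwt_def nexts_def)
next
  case False
  let ?p = "fs ! par t"
  let ?s = "trunc (cnv t) ?p"
  let ?N = "{h\<in>X. trunc (cnv t) h = ?s}"
  have p: "?p \<in> X" using walks_nth[OF fs] tree[of t] False t by auto
  have cnv: "cnv t < k" using cnv_less False t by simp
  have fin_s: "finite ?s" using card_trunc[OF p cnv] X[OF p] finite_subset by blast
  let ?d = "real (deg (cnv t) ?p)"
  have d: "y \<le> ?d" "?d > 0" using deg_ge[OF p cnv] y_pos by auto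
  let ?W = "\<Union>(set fs) - ?s"
  have W: "card ?W \<le> r * m" "finite ?W"
  proof -
    have fin: "finite (\<Union>(set fs))" using walks_length[OF fs] X by auto
    then show "finite ?W" by simp
    have "card ?W \<le> card (\<Union>(set fs))" using fin by (intro card_mono) auto
    also have "\<dots> \<le> (\<Sum>f\<in>set fs. card f)" by (rule card_Union_le_sum_card)
    also have "\<dots> \<le> (\<Sum>f\<in>set fs. r)" using walks_length[OF fs] X by (intro sum_mono) auto
    also have "\<dots> = card (set fs) * r" by simp
    also have "\<dots> \<le> t * r" using walks_length[OF fs] card_length[of fs] by (intro mult_right_mono) auto
    also have "\<dots> \<le> r * m" using t by simp
    finally show "card ?W \<le> r * m" .
  qed
  have "card (?N - nexts t fs) \<le> card (\<Union>w\<in>?W. {h\<in>X. insert w ?s \<subseteq> h})"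
  proof (rule card_mono)
    show "?N - nexts t fs \<subseteq> (\<Union>w\<in>?W. {h\<in>X. insert w ?s \<subseteq> h})"
    proof
      fix h assume h: "h \<in> ?N - nexts t fs"
      then have "h \<in> X" "trunc (cnv t) h = ?s" "\<not> h \<inter> \<Union>(set fs) \<subseteq> ?s" by (auto simp: nexts_def)
      moreover from this have "?s \<subseteq> h" using card_trunc[of h "cnv t"] cnv by auto
      ultimately show "h \<in> (\<Union>w\<in>?W. {h\<in>X. insert w ?s \<subseteq> h})" by blast
    qed
  qed (use finX W in auto)
  also have "\<dots> \<le> (\<Sum>w\<in>?W. card {h\<in>X. insert w ?s \<subseteq> h})" by (rule card_UN_le) (use W in auto)
  also have "\<dots> \<le> (\<Sum>w\<in>?W. M)"
  proof (rule sum_mono)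
    fix w assume "w \<in> ?W"
    then have "card (insert w ?s) = k" using card_trunc[OF p cnv] fin_s k_pos by simp
    then show "card {h\<in>X. insert w ?s \<subseteq> h} \<le> M" by (rule M)
  qed
  also have "\<dots> = card ?W * M" by simp
  also have "\<dots> \<le> (r * m) * M" using W by (intro mult_right_mono) auto
  finally have "real (card (?N - nexts t fs)) \<le> real r * real m * real M"
    by (simp only: of_nat_mult[symmetric] of_nat_le_iff)
  then have bad: "real (card (?N - nexts t fs)) \<le> ?d / 2" using yM d by linarith
  have "nexts t fs \<subseteq> ?N" using False by (auto simp: nexts_def)
  then have "card ?N = card (nexts t fs) + card (?N - nexts t fs)"
    using card_Diff_subset[OF finite_nexts, of t fs ?N] card_mono[of ?N "nexts t fs"] finX by simp
  moreover have "?d = real (card ?N)" by (simp add: deg_def)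
  ultimately have "?d / 2 \<le> real (card (nexts t fs))" using bad by simp
  then have "1 / 2 \<le> real (card (nexts t fs)) * (1 / ?d)" using d by (simp add: field_simps)
  also have "\<dots> = (\<Sum>h\<in>nexts t fs. 1 / ?d)" by simp
  also have "\<dots> = (\<Sum>h\<in>nexts t fs. stepwt t h)"
  proof (rule sum.cong)
    fix h assume "h \<in> nexts t fs"
    then have "deg (cnv t) h = deg (cnv t) ?p" using False by (intro deg_cong) (simp add: nexts_def)
    then show "1 / ?d = stepwt t h" using False by (simp add: stepwt_def)
  qed simp
  finally show ?thesis .
qed

lemma walks_total_ge: "t \<le> m \<Longrightarrow> (1 / 2) ^ t \<le> (\<Sum>fs\<in>walks t. wt fs)"
proof (induction t)
  case 0
  then show ?case by (simp add: wt_def)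
next
  case (Suc t)
  have "(1 / 2) ^ Suc t \<le> (\<Sum>fs\<in>walks t. wt fs) * (1 / 2 :: real)" using Suc by simp
  also have "\<dots> = (\<Sum>fs\<in>walks t. wt fs * (1 / 2))" by (simp add: sum_distrib_right)
  also have "\<dots> \<le> (\<Sum>fs\<in>walks t. wt fs * (\<Sum>h\<in>nexts t fs. stepwt t h))"
    using step_total_ge Suc.prems wt_nonneg by (intro sum_mono mult_left_mono) auto
  also have "\<dots> = (\<Sum>fs\<in>walks (Suc t). wt fs)"
    unfolding sum_walks_Suc sum_distrib_left
    by (intro sum.cong refl) (auto simp: wt_snoc dest: walks_length)
  finally show ?case .
qed

text \<open>The edges of a tight tree containing a given vertex form a subtree.\<close>

lemma walk_consistent:
  assumes "t \<le> m" "fs \<in> walks t" "i < t" "j < t" "w \<in> es i" "w \<in> es j"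
  shows "pos (fs ! i) (c w) = pos (fs ! j) (c w)"
  using assms
proof (induction t arbitrary: fs i j)
  case (Suc t)
  then obtain fs' h where fs': "fs' \<in> walks t" "h \<in> nexts t fs'" "fs = fs' @ [h]" by auto
  have len: "length fs' = t" using walks_length fs' by blast
  have last: "pos h (c w) = pos (fs' ! j) (c w)" if w: "w \<in> es t" "w \<in> es j" "j < t" for j
  proof -
    have t: "0 < t" "t < m" using w Suc.prems by auto
    note tr = tree[OF t]
    have "w \<noteq> nv t" using tr w by auto
    then have wp: "w \<in> es (par t)" using tr w by auto
    have "c w \<noteq> cnv t" "c w < k"
      using \<open>w \<noteq> nv t\<close> w tr colour[OF t(2)] by (auto simp: bij_betw_def inj_on_def)
    moreover have "h \<in> X" "trunc (cnv t) h = trunc (cnv t) (fs' ! par t)"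
      using fs'(2) t by (auto simp: nexts_def)
    moreover have "fs' ! par t \<in> X" using walks_nth[OF fs'(1)] tr by auto
    ultimately have "pos h (c w) = pos (fs' ! par t) (c w)"
      using trunc_agree[of h "fs' ! par t" "cnv t" "c w"] cnv_less[OF t] by blast
    also have "\<dots> = pos (fs' ! j) (c w)"
      using Suc.IH[OF _ fs'(1), of "par t" j] wp w tr Suc.prems by auto
    finally show ?thesis .
  qed
  have nth: "fs ! l = (if l < t then fs' ! l else h)" if "l < Suc t" for l
    using that len fs'(3) by (auto simp: nth_append)
  consider "i < t" "j < t" | "i = t" "j < t" | "i < t" "j = t" | "i = t" "j = t"
    using Suc.prems by linarith
  then show ?case
  proof cases
    case 1
    then have "pos (fs' ! i) (c w) = pos (fs' ! j) (c w)"
      using Suc.IH[OF _ fs'(1), of i j] Suc.prems by simp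
    then show ?thesis using 1 nth[of i] nth[of j] by simp
  next
    case 2
    then show ?thesis using last[of j] Suc.prems nth[of i] nth[of j] by simp
  next
    case 3
    then show ?thesis using last[of i] Suc.prems nth[of i] nth[of j] by simp
  qed simp
qed simp

section \<open>Weights of walks with prescribed edges and vertices\<close>

definition constrained :: "nat \<Rightarrow> nat set \<Rightarrow> 'a set \<Rightarrow> (nat \<Rightarrow> nat set) \<Rightarrow> ('a \<Rightarrow> nat) \<Rightarrow> nat set list set" where
  "constrained t Q U F val = {fs\<in>walks t. (\<forall>q\<in>Q. fs ! q = F q) \<and> (\<forall>i<t. \<forall>v\<in>es i \<inter> U. pos (fs ! i) (c v) = val v)}"

lemma constrained_subset: "constrained t Q U F val \<subseteq> walks t"
  by (auto simp: constrained_def)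

lemma constrainedD:
  "fs \<in> constrained t Q U F val \<Longrightarrow> i < t \<Longrightarrow> w \<in> es i \<Longrightarrow> w \<in> U \<Longrightarrow> pos (fs ! i) (c w) = val w"
  by (simp add: constrained_def)

lemma finite_constrained: "finite (constrained t Q U F val)"
  by (rule finite_subset[OF constrained_subset finite_walks])

text \<open>The truncation and the element of rank \<open>i\<close> together determine
  \<open>\<kappa> h\<close>, so the bound \<open>D\<close> on the classes of \<open>\<kappa>\<close>
  applies.\<close>

lemma card_same_kappa_le:
  assumes "i < k"
  shows "real (card {h\<in>X. trunc i h = \<sigma> \<and> pos h i = a}) \<le> real D"
proof -
  have "{h\<in>X. trunc i h = \<sigma> \<and> pos h i = a} \<subseteq> {h\<in>X. \<kappa> h = insert a \<sigma>}"
    using kappa_eq assms by auto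
  then have "card {h\<in>X. trunc i h = \<sigma> \<and> pos h i = a} \<le> card {h\<in>X. \<kappa> h = insert a \<sigma>}"
    using finX by (intro card_mono) auto
  then show ?thesis using D[of "insert a \<sigma>"] by simp
qed

lemma stepwt_le: "h \<in> X \<Longrightarrow> 0 < t \<Longrightarrow> t < m \<Longrightarrow> stepwt t h \<le> 1 / y"
  using deg_ge[of h "cnv t"] cnv_less[of t] y_pos by (simp add: stepwt_def frac_le)

text \<open>The common form of all reductions from \<open>Suc t\<close> to \<open>t\<close>:
  \<open>C\<close> contains the admissible prefixes, \<open>R fs\<close> the admissible last edges,
  and \<open>B\<close> bounds the conditional weight of the last step.\<close>

lemma sum_constrained_Suc_le:
  assumes "\<And>fs h. fs \<in> walks t \<Longrightarrow> h \<in> nexts t fs \<Longrightarrow> fs @ [h] \<in> constrained (Suc t) Q U F val \<Longrightarrow>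
      fs \<in> C \<and> h \<in> R fs"
    and C: "C \<subseteq> walks t"
    and B: "\<And>fs. fs \<in> C \<Longrightarrow> (\<Sum>h\<in>{h\<in>nexts t fs. h \<in> R fs}. stepwt t h) \<le> B"
  shows "(\<Sum>fs\<in>constrained (Suc t) Q U F val. wt fs) \<le> (\<Sum>fs\<in>C. wt fs) * B"
proof -
  let ?K = "constrained (Suc t) Q U F val"
  have finC: "finite C" using C finite_walks finite_subset by blast
  have "(\<Sum>fs\<in>?K. wt fs) = (\<Sum>z\<in>walks (Suc t). if z \<in> ?K then wt z else 0)"
  proof (rule sum.mono_neutral_cong_left)
    show "finite (walks (Suc t))" by (rule finite_walks)
    show "?K \<subseteq> walks (Suc t)" by (rule constrained_subset)
  qed auto
  also have "\<dots> = (\<Sum>fs\<in>walks t. \<Sum>h\<in>nexts t fs. if fs @ [h] \<in> ?K then wt (fs @ [h]) else 0)"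
    by (rule sum_walks_Suc)
  also have "\<dots> \<le> (\<Sum>fs\<in>walks t. if fs \<in> C then wt fs * B else 0)"
  proof (rule sum_mono)
    fix fs assume fs: "fs \<in> walks t"
    have len: "length fs = t" using walks_length[OF fs] by simp
    show "(\<Sum>h\<in>nexts t fs. if fs @ [h] \<in> ?K then wt (fs @ [h]) else 0) \<le> (if fs \<in> C then wt fs * B else 0)"
    proof (cases "fs \<in> C")
      case True
      have "(\<Sum>h\<in>nexts t fs. if fs @ [h] \<in> ?K then wt (fs @ [h]) else 0)
        \<le> (\<Sum>h\<in>nexts t fs. if h \<in> R fs then wt fs * stepwt t h else 0)"
        using assms(1)[OF fs] wt_nonneg stepwt_nonneg
        by (intro sum_mono) (auto simp: wt_snoc len)
      also have "\<dots> = (\<Sum>h\<in>{h\<in>nexts t fs. h \<in> R fs}. wt fs * stepwt t h)"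
        using finite_nexts by (simp add: sum.inter_filter)
      also have "\<dots> = wt fs * (\<Sum>h\<in>{h\<in>nexts t fs. h \<in> R fs}. stepwt t h)" by (simp add: sum_distrib_left)
      also have "\<dots> \<le> wt fs * B" using B[OF True] wt_nonneg by (rule mult_left_mono)
      finally show ?thesis using True by simp
    next
      case False
      have "(\<Sum>h\<in>nexts t fs. if fs @ [h] \<in> ?K then wt (fs @ [h]) else 0) = 0"
        using assms(1)[OF fs] False by (intro sum.neutral) auto
      then show ?thesis using False by simp
    qed
  qed
  also have "\<dots> = (\<Sum>fs\<in>C. wt fs * B)"
    using C finite_walks by (simp add: sum.inter_restrict[symmetric] Int_absorb1)
  also have "\<dots> = (\<Sum>fs\<in>C. wt fs) * B" by (simp add: sum_distrib_right)
  finally show ?thesis .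
qed

text \<open>Meant for \<open>a\<close> prescribed edges and \<open>u\<close> prescribed tree
  vertices. The exponent of \<open>D / y\<close> is the number of vertices in excess of the
  \<open>k + (a - 1)\<close> that are accounted for by the edges; real exponents avoid truncated
  subtraction.\<close>

definition bnd :: "nat \<Rightarrow> nat \<Rightarrow> real" where
  "bnd a u = 1 / real (card X) * (1 / y) powr (real a - 1) * (real D / y) powr (real u - real k - (real a - 1))"

lemma bnd_mult_D: "bnd a u * (real D / y) = bnd a (Suc u)"
proof -
  have "real D / y > 0" using D1 y_pos by simp
  moreover have "real (Suc u) - real k - (real a - 1) = (real u - real k - (real a - 1)) + 1" by simp
  ultimately show ?thesis unfolding bnd_def by (simp only: powr_add powr_one mult.assoc)
qed

lemma bnd_mult_y: "bnd a u * (1 / y) = bnd (Suc a) (Suc u)"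
proof -
  have "(1 / y) powr (real (Suc a) - 1) = (1 / y) powr (real a - 1) * (1 / y)"
    using y_pos by (simp add: powr_diff)
  moreover have "real (Suc u) - real k - (real (Suc a) - 1) = real u - real k - (real a - 1)" by simp
  ultimately show ?thesis unfolding bnd_def by (simp only: mult_ac)
qed

lemma card_edge: "i < m \<Longrightarrow> card (es i) = k \<and> finite (es i)"
  using colour[of i] bij_betw_same_card[of c "es i" "{..<k}"] bij_betw_finite[of c "es i" "{..<k}"] by auto

text \<open>The walk may be started at any of its edges, so fixing one edge costs \<open>1 / card X\<close>, each
  further fixed edge costs \<open>1 / y\<close>, and each vertex fixed without its edge costs \<open>D / y\<close>. Instead
  of rerooting the walk, the last edge is removed by induction: if it is the only fixed edge, the
  constraint is passed on to its parent.\<close>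

lemma constrained_weight_le:
  assumes "0 < t" "t \<le> m" "Q \<noteq> {}" "Q \<subseteq> {..<t}" "(\<Union>q\<in>Q. es q) \<subseteq> U" "U \<subseteq> (\<Union>i<t. es i)"
    and "\<And>q. q \<in> Q \<Longrightarrow> F q \<in> X"
  shows "(\<Sum>fs\<in>constrained t Q U F val. wt fs) \<le> bnd (card Q) (card U)"
  using assms
proof (induction t arbitrary: Q U F val)
  case (Suc t)
  show ?case
  proof (cases "t = 0")
    case True
    then have Q: "Q = {0}" and U: "U = es 0" using Suc.prems by auto
    have "constrained (Suc t) Q U F val \<subseteq> {[F 0]}"
      using True by (auto simp: constrained_def Q)
    then have "(\<Sum>fs\<in>constrained (Suc t) Q U F val. wt fs) \<le> (\<Sum>fs\<in>{[F 0]}. wt fs)"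
      by (intro sum_mono2) (auto simp: wt_nonneg)
    also have "\<dots> = 1 / real (card X)" by (simp add: wt_def stepwt_def)
    also have "\<dots> = bnd (card Q) (card U)"
      using card_edge[of 0] Suc.prems(2) y_pos D1 by (simp add: bnd_def Q U)
    finally show ?thesis .
  next
    case False
    then have t: "0 < t" "t < m" using Suc.prems by auto
    then have tm: "t \<le> m" by simp
    define v where "v = nv t"
    define p where "p = par t"
    have p: "p < t" and v: "v \<in> es t" "v \<notin> (\<Union>i<t. es i)" and ep: "es t - {v} \<subseteq> es p"
      using tree[OF t] unfolding v_def p_def by auto
    have cv: "c v < k" using cnv_less[OF t] by (simp add: v_def)
    have finU: "finite U"
    proof (rule finite_subset[OF Suc.prems(6)])
      show "finite (\<Union>i<Suc t. es i)" using card_edge t by auto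
    qed
    have finQ: "finite Q" using Suc.prems(4) finite_subset by blast
    have Uv: "U - {v} \<subseteq> (\<Union>i<t. es i)"
    proof
      fix x assume x: "x \<in> U - {v}"
      then obtain i where "i < Suc t" "x \<in> es i" using Suc.prems(6) by blast
      then show "x \<in> (\<Union>i<t. es i)" using x ep p by (cases "i = t") auto
    qed
    have snocD: "fs \<in> constrained t (Q - {t}) (U - {v}) F val"
      if "fs \<in> walks t" "fs @ [h] \<in> constrained (Suc t) Q U F val" for fs h
    proof -
      have len: "length fs = t" using walks_length that by blast
      have *: "(fs @ [h]) ! i = fs ! i" if "i < t" for i using that len by (simp add: nth_append)
      have "fs ! q = F q" if "q \<in> Q - {t}" for q
      proof -
        have "q < t" using that Suc.prems(4) by auto
        then show ?thesis using *[of q] that \<open>fs @ [h] \<in> constrained (Suc t) Q U F val\<close>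
          by (auto simp: constrained_def)
      qed
      moreover have "pos (fs ! i) (c w) = val w" if "i < t" "w \<in> es i \<inter> (U - {v})" for i w
        using *[of i] that \<open>fs @ [h] \<in> constrained (Suc t) Q U F val\<close>
        by (auto simp: constrained_def less_Suc_eq)
      ultimately show ?thesis using that by (auto simp: constrained_def)
    qed
    have lastD: "t \<in> Q \<Longrightarrow> h = F t" "w \<in> es t \<inter> U \<Longrightarrow> pos h (c w) = val w"
      if "fs \<in> walks t" "fs @ [h] \<in> constrained (Suc t) Q U F val" for fs h w
    proof -
      have len: "length fs = t" using walks_length that by blast
      then have "(fs @ [h]) ! t = h" by (simp add: nth_append)
      then show "t \<in> Q \<Longrightarrow> h = F t" "w \<in> es t \<inter> U \<Longrightarrow> pos h (c w) = val w"
        using that by (auto simp: constrained_def)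
    qed
    have nextD: "h \<in> X" "trunc (c v) h = trunc (c v) (fs ! p)" if "h \<in> nexts t fs" for fs h
      using that t by (auto simp: nexts_def v_def p_def)
    show ?thesis
    proof (cases "t \<in> Q")
      case tQ: False
      have Qt: "Q - {t} = Q" using tQ by simp
      have Q1: "Q \<subseteq> {..<t}" using tQ Suc.prems(4) by (auto simp: less_Suc_eq)
      have vQ: "v \<notin> (\<Union>q\<in>Q. es q)" using v Q1 by auto
      show ?thesis
      proof (cases "v \<in> U")
        case False
        have "(\<Sum>fs\<in>constrained (Suc t) Q U F val. wt fs) \<le> (\<Sum>fs\<in>constrained t Q U F val. wt fs) * 1"
        proof (rule sum_constrained_Suc_le[where R = "\<lambda>_. UNIV"])
          show "(\<Sum>h\<in>{h \<in> nexts t fs. h \<in> UNIV}. stepwt t h) \<le> 1" if "fs \<in> constrained t Q U F val" for fs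
            using step_total_le[of fs t] that t by (simp add: constrained_def)
          have Uv': "U - {v} = U" using False by simp
          show "fs \<in> constrained t Q U F val \<and> h \<in> UNIV"
            if "fs \<in> walks t" "h \<in> nexts t fs" "fs @ [h] \<in> constrained (Suc t) Q U F val" for fs h
            using snocD[OF that(1,3)] Qt Uv' by simp
        qed (rule constrained_subset)
        also have "\<dots> \<le> bnd (card Q) (card U) * 1"
          using Suc.IH[of Q U F val] t Suc.prems Q1 Uv False by simp
        finally show ?thesis by simp
      next
        case True
        \<comment> \<open>The prescribed image of \<open>v\<close> completes the parent's truncation
          to a known value of \<open>\<kappa>\<close>; at most \<open>D\<close> edges remain, each
          of weight at most \<open>1 / y\<close>.\<close>
        have "(\<Sum>fs\<in>constrained (Suc t) Q U F val. wt fs)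
            \<le> (\<Sum>fs\<in>constrained t Q (U - {v}) F val. wt fs) * (real D / y)"
        proof (rule sum_constrained_Suc_le[where R = "\<lambda>_. {h. pos h (c v) = val v}"])
          show "fs \<in> constrained t Q (U - {v}) F val \<and> h \<in> {h. pos h (c v) = val v}"
            if "fs \<in> walks t" "h \<in> nexts t fs" "fs @ [h] \<in> constrained (Suc t) Q U F val" for fs h
            using snocD[OF that(1,3)] lastD(2)[OF that(1,3), of v] Qt v True by simp
          fix fs assume "fs \<in> constrained t Q (U - {v}) F val"
          let ?S = "{h \<in> nexts t fs. h \<in> {h. pos h (c v) = val v}}"
          have "(\<Sum>h\<in>?S. stepwt t h) \<le> (\<Sum>h\<in>?S. 1 / y)"
            using stepwt_le t nexts_subset by (intro sum_mono) blast
          also have "\<dots> = real (card ?S) / y" by simp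
          also have "real (card ?S) \<le> real (card {h\<in>X. trunc (c v) h = trunc (c v) (fs ! p) \<and> pos h (c v) = val v})"
            using nextD finX by (intro of_nat_mono card_mono) auto
          also have "\<dots> \<le> real D" by (rule card_same_kappa_le[OF cv])
          finally show "(\<Sum>h\<in>?S. stepwt t h) \<le> real D / y" using y_pos by (simp add: divide_right_mono)
        qed (rule constrained_subset)
        also have "\<dots> \<le> bnd (card Q) (card (U - {v})) * (real D / y)"
        proof (rule mult_right_mono)
          have QU: "(\<Union>q\<in>Q. es q) \<subseteq> U - {v}" using Suc.prems(5) vQ by blast
          show "(\<Sum>fs\<in>constrained t Q (U - {v}) F val. wt fs) \<le> bnd (card Q) (card (U - {v}))"
            by (rule Suc.IH[OF t(1) tm Suc.prems(3) Q1 QU Uv Suc.prems(7)])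
        qed (use y_pos in simp)
        also have "\<dots> = bnd (card Q) (card U)"
          by (simp only: bnd_mult_D card_Suc_Diff1[OF finU True])
        finally show ?thesis .
      qed
    next
      case tQ: True
      then have vU: "v \<in> U" using Suc.prems(5) v by auto
      have cU: "card U = Suc (card (U - {v}))" by (rule card_Suc_Diff1[OF finU vU, symmetric])
      have Ft: "F t \<in> X" using Suc.prems(7) tQ by blast
      show ?thesis
      proof (cases "Q = {t}")
        case False
        \<comment> \<open>Only one outcome of the last step is left. Dropping the edge also drops
          its private vertex \<open>v\<close>, so both arguments of \<open>bnd\<close> decrease by
          one.\<close>
        let ?Q = "Q - {t}"
        have Q1: "?Q \<subseteq> {..<t}" "?Q \<noteq> {}" using False Suc.prems(3,4) tQ by (auto simp: less_Suc_eq)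
        have cQ: "card Q = Suc (card ?Q)" by (rule card_Suc_Diff1[OF finQ tQ, symmetric])
        have "(\<Sum>fs\<in>constrained (Suc t) Q U F val. wt fs)
            \<le> (\<Sum>fs\<in>constrained t ?Q (U - {v}) F val. wt fs) * (1 / y)"
        proof (rule sum_constrained_Suc_le[where R = "\<lambda>_. {F t}"])
          show "fs \<in> constrained t ?Q (U - {v}) F val \<and> h \<in> {F t}"
            if "fs \<in> walks t" "h \<in> nexts t fs" "fs @ [h] \<in> constrained (Suc t) Q U F val" for fs h
            using snocD[OF that(1,3)] lastD(1)[OF that(1,3)] tQ by simp
          fix fs assume "fs \<in> constrained t ?Q (U - {v}) F val"
          have "(\<Sum>h\<in>{h \<in> nexts t fs. h \<in> {F t}}. stepwt t h) \<le> (\<Sum>h\<in>{F t}. stepwt t h)"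
            by (rule sum_mono2) (auto simp: stepwt_nonneg)
          also have "\<dots> \<le> 1 / y" using stepwt_le[OF Ft t] by simp
          finally show "(\<Sum>h\<in>{h \<in> nexts t fs. h \<in> {F t}}. stepwt t h) \<le> 1 / y" .
        qed (rule constrained_subset)
        also have "\<dots> \<le> bnd (card ?Q) (card (U - {v})) * (1 / y)"
        proof (rule mult_right_mono)
          have "(\<Union>q\<in>?Q. es q) \<subseteq> U - {v}"
          proof -
            have "v \<notin> (\<Union>q\<in>?Q. es q)" using v Q1 by auto
            then show ?thesis using Suc.prems(5) by auto
          qed
          then show "(\<Sum>fs\<in>constrained t ?Q (U - {v}) F val. wt fs) \<le> bnd (card ?Q) (card (U - {v}))"
            by (rule Suc.IH[OF t(1) tm Q1(2,1) _ Uv]) (use Suc.prems(7) in auto)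
        qed (use y_pos in simp)
        also have "\<dots> = bnd (card Q) (card U)" by (simp only: bnd_mult_y cQ cU)
        finally show ?thesis .
      next
        case Q: True
        let ?h = "F t"
        have eU: "es t \<subseteq> U" using Suc.prems(5) Q by simp
        have pm: "p < m" using p t by simp
        have cbt: "bij_betw c (es t) {..<k}" and cbp: "bij_betw c (es p) {..<k}"
          using colour t pm by auto
        \<comment> \<open>\<open>u\<close> is the vertex of the parent edge that \<open>v\<close>
          replaces: the two edges differ only in \<open>u\<close> and \<open>v\<close>, which share
          a colour.\<close>
        obtain u where u: "u \<in> es p" "c u = c v"
          using cbp cv by (metis bij_betw_def imageE lessThan_iff)
        have uv: "u \<noteq> v" using u v p by auto
        have "es p = insert u (es t - {v})"
        proof (rule card_subset_eq[symmetric])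
          show "finite (es p)" using card_edge pm by simp
          show "insert u (es t - {v}) \<subseteq> es p" using u ep by auto
          have "u \<notin> es t" using u v uv cbt by (auto simp: bij_betw_def inj_on_def)
          then show "card (insert u (es t - {v})) = card (es p)"
            using card_edge[of p] card_edge[OF t(2)] pm v k_pos by simp
        qed
        \<comment> \<open>The constraint moves to the parent. Its edge is not known, so it is summed
          over the set \<open>R\<close> of all candidates \<open>f\<close>, and once
          \<open>f\<close> is fixed all of \<open>es p\<close> becomes prescribed;
          \<open>val'\<close> reads these values off \<open>f\<close>.\<close>
        define U' where "U' = insert u (U - {v})"
        have epU': "es p \<subseteq> U'" using \<open>es p = _\<close> eU by (auto simp: U'_def)
        have U't: "U' \<subseteq> (\<Union>i<t. es i)" using Uv u p unfolding U'_def by blast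
        define val' where "val' f w = (if w \<in> es p then pos f (c w) else val w)" for f w
        define R where "R = {f\<in>X. trunc (c v) f = trunc (c v) ?h \<and> (u \<in> U \<longrightarrow> pos f (c v) = val u)}"
        have finR: "finite R" unfolding R_def using finX by simp
        let ?C = "\<Union>f\<in>R. constrained t {p} U' (\<lambda>_. f) (val' f)"
        have h: "?h \<in> X" using Ft .
        have "(\<Sum>fs\<in>constrained (Suc t) Q U F val. wt fs) \<le> (\<Sum>fs\<in>?C. wt fs) * (1 / real (deg (c v) ?h))"
        proof (rule sum_constrained_Suc_le[where R = "\<lambda>_. {F t}"])
          fix fs h assume fs: "fs \<in> walks t" "h \<in> nexts t fs" "fs @ [h] \<in> constrained (Suc t) Q U F val"
          have heq: "h = F t" using lastD(1)[OF fs(1,3) tQ] .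
          have fsC: "fs \<in> constrained t (Q - {t}) (U - {v}) F val" using snocD[OF fs(1,3)] .
          let ?f = "fs ! p"
          have "?f \<in> X" using walks_nth[OF fs(1) p] .
          moreover have "trunc (c v) ?f = trunc (c v) ?h" using nextD(2)[OF fs(2)] heq by simp
          moreover have "pos ?f (c v) = val u" if "u \<in> U"
            using constrainedD[OF fsC p, of u] that u uv by simp
          ultimately have "?f \<in> R" by (simp add: R_def)
          moreover have "fs \<in> constrained t {p} U' (\<lambda>_. ?f) (val' ?f)"
          proof -
            have "pos (fs ! i) (c w) = val' ?f w" if i: "i < t" and w: "w \<in> es i" "w \<in> U'" for i w
            proof (cases "w \<in> es p")
              case True
              then show ?thesis using walk_consistent[OF _ fs(1) i p w(1)] t by (simp add: val'_def)
            next
              case False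
              then have "w \<in> U - {v}" using w u by (auto simp: U'_def)
              then show ?thesis using constrainedD[OF fsC i w(1)] False by (simp add: val'_def)
            qed
            then show ?thesis using fs(1) by (auto simp: constrained_def)
          qed
          ultimately show "fs \<in> ?C \<and> h \<in> {F t}" using heq by blast
        next
          show "?C \<subseteq> walks t" using constrained_subset by blast
          fix fs assume "fs \<in> ?C"
          have "(\<Sum>h\<in>{h \<in> nexts t fs. h \<in> {F t}}. stepwt t h) \<le> (\<Sum>h\<in>{F t}. stepwt t h)"
            by (rule sum_mono2) (auto simp: stepwt_nonneg)
          then show "(\<Sum>h\<in>{h \<in> nexts t fs. h \<in> {F t}}. stepwt t h) \<le> 1 / real (deg (c v) ?h)"
            using t by (simp add: stepwt_def v_def)
        qed
        also have "(\<Sum>fs\<in>?C. wt fs) \<le> (\<Sum>f\<in>R. \<Sum>fs\<in>constrained t {p} U' (\<lambda>_. f) (val' f). wt fs)"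
          by (rule sum_UN_le[OF finR wt_nonneg finite_constrained])
        also have "\<dots> \<le> (\<Sum>f\<in>R. bnd 1 (card U'))"
        proof (rule sum_mono)
          fix f assume "f \<in> R"
          then show "(\<Sum>fs\<in>constrained t {p} U' (\<lambda>_. f) (val' f). wt fs) \<le> bnd 1 (card U')"
            using U't p epU' R_def Suc.IH[OF t(1) tm, of "{p}" U' "\<lambda>_. f" "val' f"] by simp
        qed
        finally have main: "(\<Sum>fs\<in>constrained (Suc t) Q U F val. wt fs)
           \<le> real (card R) * bnd 1 (card U') * (1 / real (deg (c v) ?h))"
          by (simp add: divide_right_mono)
        have dy: "y \<le> real (deg (c v) ?h)" using deg_ge[OF h cv] .
        have b0: "0 \<le> bnd a u" for a u unfolding bnd_def using y_pos by simp
        \<comment> \<open>This is where reversibility enters. If \<open>u\<close> was free, the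
          number of candidates for the parent equals the degree in the denominator and the two
          cancel. If \<open>u\<close> was already prescribed, at most \<open>D\<close> candidates
          remain, and the resulting factor \<open>D / y\<close> is due because \<open>U'\<close> has
          one vertex less than \<open>U\<close>.\<close>
        have "real (card R) * bnd 1 (card U') * (1 / real (deg (c v) ?h)) \<le> bnd 1 (card U)"
        proof (cases "u \<in> U")
          case True
          then have cU': "card U' = card (U - {v})" using uv by (simp add: U'_def insert_absorb)
          have "R = {f\<in>X. trunc (c v) f = trunc (c v) ?h \<and> pos f (c v) = val u}"
            using True by (simp add: R_def)
          then have "real (card R) \<le> real D"
            using card_same_kappa_le[OF cv, of "trunc (c v) ?h" "val u"] by simp
          then have "real (card R) * bnd 1 (card U') * (1 / real (deg (c v) ?h)) \<le> real D * bnd 1 (card U') * (1 / y)"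
            using dy y_pos b0 by (intro mult_mono frac_le) auto
          also have "\<dots> = bnd 1 (card U') * (real D / y)" by simp
          also have "\<dots> = bnd 1 (card U)" using bnd_mult_D cU cU' by simp
          finally show ?thesis .
        next
          case False
          then have cU': "card U' = card U" using finU uv cU by (simp add: U'_def)
          have "R = {f'\<in>X. trunc (c v) f' = trunc (c v) ?h}" using False by (auto simp: R_def)
          then have "real (card R) = real (deg (c v) ?h)" by (simp add: deg_def)
          then show ?thesis using dy y_pos cU' by simp
        qed
        then show ?thesis using main Q by simp
      qed
    qed
  qed
qed simp

section \<open>Walks as copies of the expansion\<close>

lemma walk_distinct:
  assumes "k \<le> r" "t \<le> m" "fs \<in> walks t"
  shows "distinct fs"
  using assms(2,3)
proof (induction t arbitrary: fs)
  case (Suc t)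
  then obtain fs' h where fs': "fs' \<in> walks t" "h \<in> nexts t fs'" "fs = fs' @ [h]" by auto
  have hX: "h \<in> X" using fs'(2) nexts_subset by blast
  have "h \<notin> set fs'"
  proof
    assume h: "h \<in> set fs'"
    then have "t \<noteq> 0" using fs'(1) by (cases t) auto
    then have "h \<inter> \<Union>(set fs') \<subseteq> trunc (cnv t) h" using fs'(2) unfolding nexts_def by blast
    \<comment> \<open>If \<open>h\<close> occurred before, its intersection with the old vertices
      would be \<open>h\<close> itself; but \<open>r \<ge> k\<close> vertices do not fit into a
      truncation of size \<open>k - 1\<close>.\<close>
    then have sub: "h \<subseteq> trunc (cnv t) h" using h by blast
    have tr: "trunc (cnv t) h \<subseteq> h" "card (trunc (cnv t) h) = k - 1"
      using card_trunc[OF hX cnv_less[of t]] Suc.prems \<open>t \<noteq> 0\<close> by auto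
    have "card h = k - 1" using sub tr by (metis subset_antisym)
    then show False using X[OF hX] assms(1) k_pos by simp
  qed
  then show ?case using Suc.IH[OF _ fs'(1)] Suc.prems fs'(3) by simp
qed simp

lemma edge_embedding:
  assumes f: "f \<in> X" and i: "i < m"
    and v: "\<And>w. w \<in> es i \<Longrightarrow> \<psi> (Inl w) = pos f (c w)"
    and n: "\<And>j. j < r - k \<Longrightarrow> \<psi> (Inr (es i, j)) = sorted_list_of_set (f - \<kappa> f) ! j"
  shows "bij_betw \<psi> (expand_edge k r (es i)) f"
proof -
  have "bij_betw (pos f \<circ> c) (es i) (\<kappa> f)"
    using bij_betw_trans[OF colour[OF i] pos_bij[OF f]] .
  then have "bij_betw (\<psi> \<circ> Inl) (es i) (\<kappa> f)"
    by (rule bij_betw_cong[THEN iffD1, rotated]) (simp add: v)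
  then have 1: "bij_betw \<psi> (Inl ` es i) (\<kappa> f)"
    by (rule bij_betw_comp_imageD)
  have fin: "finite (f - \<kappa> f)" using X[OF f] by simp
  have "card (f - \<kappa> f) = r - k" using X[OF f] fin\<kappa>[OF f] by (simp add: card_Diff_subset)
  then have "bij_betw (\<lambda>j. sorted_list_of_set (f - \<kappa> f) ! j) {..<r - k} (f - \<kappa> f)"
    using fin by (intro bij_betw_nth) auto
  then have "bij_betw (\<psi> \<circ> (\<lambda>j. Inr (es i, j))) {..<r - k} (f - \<kappa> f)"
    by (rule bij_betw_cong[THEN iffD1, rotated]) (simp add: n)
  then have "bij_betw \<psi> ((\<lambda>j. Inr (es i, j)) ` {..<r - k}) (f - \<kappa> f)"
    by (rule bij_betw_comp_imageD)
  moreover have "(\<lambda>j. Inr (es i, j)) ` {..<r - k} = Inr ` ({es i} \<times> {..<r - k})" by auto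
  ultimately have 2: "bij_betw \<psi> (Inr ` ({es i} \<times> {..<r - k})) (f - \<kappa> f)" by metis
  have "\<kappa> f \<union> (f - \<kappa> f) = f" using X[OF f] by blast
  then show ?thesis using bij_betw_combine[OF 1 2] unfolding expand_edge_def by auto
qed

text \<open>A collision between the new edge and an earlier one happens inside the truncation. Its
  elements are the images of the vertices of \<open>es t\<close> other than \<open>nv t\<close>, and
  those already belong to the parent edge, so the colliding vertex is itself an old one and the
  induction hypothesis decides.\<close>

lemma walk_embedding:
  assumes "t \<le> m" "fs \<in> walks t"
    and "\<And>i w. i < t \<Longrightarrow> w \<in> es i \<Longrightarrow> \<psi> (Inl w) = pos (fs ! i) (c w)"
    and "\<And>i j. i < t \<Longrightarrow> j < r - k \<Longrightarrow> \<psi> (Inr (es i, j)) = sorted_list_of_set (fs ! i - \<kappa> (fs ! i)) ! j"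
  shows "inj_on \<psi> (\<Union>i<t. expand_edge k r (es i))"
  using assms
proof (induction t arbitrary: fs)
  case (Suc t)
  then obtain fs' h where fs': "fs' \<in> walks t" "h \<in> nexts t fs'" "fs = fs' @ [h]" by auto
  have len: "length fs' = t" using walks_length fs' by blast
  have nth: "fs ! i = fs' ! i" if "i < t" for i using that len fs'(3) by (simp add: nth_append)
  have nth_t: "fs ! t = h" using len fs'(3) by (simp add: nth_append)
  have hX: "h \<in> X" using fs'(2) nexts_subset by blast
  let ?FE = "\<lambda>i. expand_edge k r (es i)"
  have IH: "inj_on \<psi> (\<Union>i<t. ?FE i)"
  proof (rule Suc.IH[OF _ fs'(1)])
    show "t \<le> m" using Suc.prems(1) by simp
    show "\<psi> (Inl w) = pos (fs' ! i) (c w)" if "i < t" "w \<in> es i" for i w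
      using Suc.prems(3)[of i w] nth[of i] that by simp
    show "\<psi> (Inr (es i, j)) = sorted_list_of_set (fs' ! i - \<kappa> (fs' ! i)) ! j" if "i < t" "j < r - k" for i j
      using Suc.prems(4)[of i j] nth[of i] that by simp
  qed
  have bij: "bij_betw \<psi> (?FE i) (fs ! i)" if "i < Suc t" for i
    using Suc.prems that walks_nth[OF Suc.prems(2) that] by (intro edge_embedding) auto
  have bt: "bij_betw \<psi> (?FE t) h" using bij[of t] nth_t by simp
  show ?case
  proof (cases "t = 0")
    case True
    then show ?thesis using bt by (simp add: bij_betw_def lessThan_Suc)
  next
    case False
    then have t: "0 < t" "t < m" using Suc.prems by auto
    note tr = tree[OF t]
    have injt: "inj_on \<psi> (?FE t)" using bt by (simp add: bij_betw_def)
    let ?old = "\<Union>i<t. ?FE i"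
    have key: "a \<in> ?old" if a: "a \<in> ?FE t" and b: "b \<in> ?old" and eq: "\<psi> a = \<psi> b" for a b
    proof -
      obtain i where i: "i < t" "b \<in> ?FE i" using b by auto
      have "\<psi> b \<in> fs' ! i" using bij_betwE[OF bij[of i]] i nth by auto
      moreover have "fs' ! i \<in> set fs'" using i len by simp
      ultimately have "\<psi> a \<in> h \<inter> \<Union>(set fs')" using bij_betwE[OF bt] a eq by auto
      then have at: "\<psi> a \<in> trunc (cnv t) h" using fs'(2) t unfolding nexts_def by blast
      then have "\<psi> a \<in> \<kappa> h" "\<psi> a \<noteq> pos h (cnv t)" by (auto simp: drop_nth_def pos_def)
      obtain j where j: "j < k" "\<psi> a = pos h j"
        using \<open>\<psi> a \<in> \<kappa> h\<close> pos_bij[OF hX] by (auto simp: bij_betw_def)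
      obtain w where w: "w \<in> es t" "c w = j" using j colour[OF t(2)] by (metis bij_betw_def imageE lessThan_iff)
      have "\<psi> (Inl w) = \<psi> a" using Suc.prems(3)[of t w] w j nth_t by simp
      moreover have "Inl w \<in> ?FE t" using w by (simp add: expand_edge_def)
      ultimately have aw: "a = Inl w" using inj_onD[OF injt, of "Inl w" a] a by simp
      have "w \<noteq> nv t" using \<open>\<psi> a \<noteq> pos h (cnv t)\<close> w j by auto
      then have "w \<in> es (par t)" using w tr by blast
      then have "Inl w \<in> ?FE (par t)" by (simp add: expand_edge_def)
      then show ?thesis using aw tr by blast
    qed
    have "(\<Union>i<Suc t. ?FE i) = ?old \<union> ?FE t" unfolding lessThan_Suc by blast
    moreover have "inj_on \<psi> (?old \<union> ?FE t)"
    proof (rule inj_onI)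
      fix a b assume ab: "a \<in> ?old \<union> ?FE t" "b \<in> ?old \<union> ?FE t" "\<psi> a = \<psi> b"
      consider "a \<in> ?old" "b \<in> ?old" | "a \<in> ?FE t" "b \<in> ?FE t" | "a \<in> ?FE t" "b \<in> ?old" | "a \<in> ?old" "b \<in> ?FE t"
        using ab by blast
      then show "a = b"
      proof cases
        case 1 then show ?thesis using IH ab(3) by (meson inj_onD)
      next
        case 2 then show ?thesis using injt ab(3) by (meson inj_onD)
      next
        case 3 then show ?thesis using key[OF 3 ab(3)] IH ab(3) by (meson inj_onD)
      next
        case 4 then show ?thesis using key[OF 4(2,1) ab(3)[symmetric]] IH ab(3) by (meson inj_onD)
      qed
    qed
    ultimately show ?thesis by simp
  qed
qed simp

text \<open>The walk embeds the expansion of the whole tree, but only the edges indexed by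
  \<open>SI\<close> need to lie in \<open>G\<close>. Vertices of the expansion of \<open>S\<close>
  outside these edges are placed anew by \<open>inj_on_extend\<close>, whence the hypothesis on
  cardinalities.\<close>

lemma walk_contains_copy:
  fixes S :: "'a hgraph" and G :: "nat hgraph"
  assumes fs: "fs \<in> walks m" and inj: "inj_on es {..<m}"
    and S: "finite (verts S)" "edges S = es ` SI" "SI \<subseteq> {..<m}" "\<And>e. e \<in> edges S \<Longrightarrow> e \<subseteq> verts S"
    and G: "finite (verts G)" "\<And>i. i \<in> SI \<Longrightarrow> fs ! i \<in> edges G \<and> fs ! i \<subseteq> verts G"
    and card: "card (verts (expansion k r S)) \<le> card (verts G)"
  shows "contains_copy G (expansion k r S)"
proof -
  \<comment> \<open>Any edge containing \<open>w\<close> may be chosen here, since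
    \<open>walk_consistent\<close> gives the same image for all of them.\<close>
  define \<psi> :: "'a + 'a set \<times> nat \<Rightarrow> nat" where
    "\<psi> z = (case z of Inl w \<Rightarrow> pos (fs ! (SOME i. i < m \<and> w \<in> es i)) (c w)
      | Inr (e, j) \<Rightarrow> (let f = fs ! inv_into {..<m} es e in sorted_list_of_set (f - \<kappa> f) ! j))" for z
  have v: "\<psi> (Inl w) = pos (fs ! i) (c w)" if "i < m" "w \<in> es i" for i w
  proof -
    have "(SOME i. i < m \<and> w \<in> es i) < m \<and> w \<in> es (SOME i. i < m \<and> w \<in> es i)"
      using that by (intro someI_ex[of "\<lambda>i. i < m \<and> w \<in> es i"]) auto
    then show ?thesis using walk_consistent[OF order_refl fs _ that(1) _ that(2)] by (simp add: \<psi>_def)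
  qed
  have n: "\<psi> (Inr (es i, j)) = sorted_list_of_set (fs ! i - \<kappa> (fs ! i)) ! j" if "i < m" "j < r - k" for i j
    using inv_into_f_f[OF inj, of i] that by (simp add: \<psi>_def Let_def)
  have inj\<psi>: "inj_on \<psi> (\<Union>i<m. expand_edge k r (es i))"
    by (rule walk_embedding[OF order_refl fs v n])
  have bij: "bij_betw \<psi> (expand_edge k r (es i)) (fs ! i)" if "i < m" for i
    using edge_embedding[OF walks_nth[OF fs that] that] v n that by simp
  let ?A = "\<Union>i\<in>SI. expand_edge k r (es i)"
  let ?F = "expansion k r S"
  have "finite (edges S)" using S(2,3) finite_subset[of SI "{..<m}"] by simp
  then have finF: "finite (verts ?F)" using S(1) by (simp add: expansion_def)
  have AF: "?A \<subseteq> verts ?F" using S(2,4) unfolding expansion_def expand_edge_def by fastforce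
  have "\<psi> ` expand_edge k r (es i) \<subseteq> verts G" if "i \<in> SI" for i
    using bij[of i] G(2)[OF that] that S(3) by (auto simp: bij_betw_def)
  then have "\<psi> ` ?A \<subseteq> verts G" by blast
  moreover have "inj_on \<psi> ?A" by (rule inj_on_subset[OF inj\<psi>]) (use S(3) in auto)
  ultimately obtain \<phi> where \<phi>: "inj_on \<phi> (verts ?F)" "\<phi> ` verts ?F \<subseteq> verts G" "\<And>a. a \<in> ?A \<Longrightarrow> \<phi> a = \<psi> a"
    using inj_on_extend[OF _ AF finF G(1) card] by metis
  have "\<phi> ` e \<in> edges G" if e: "e \<in> edges ?F" for e
  proof -
    obtain i where i: "i \<in> SI" "e = expand_edge k r (es i)" using e S(2) by (auto simp: expansion_def)
    then have "\<phi> ` e = \<psi> ` e" using \<phi>(3) by (intro image_cong) auto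
    also have "\<dots> = fs ! i" using bij[of i] i S(3) by (auto simp: bij_betw_def)
    finally show ?thesis using G(2) i by simp
  qed
  then show ?thesis unfolding contains_copy_def using \<phi> by blast
qed

section \<open>The weighted hypergraph of copies and its degrees\<close>

definition copy_weight :: "nat set \<Rightarrow> nat set set \<Rightarrow> real" where
  "copy_weight SI A = (\<Sum>fs\<in>{fs\<in>walks m. (!) fs ` SI = A}. wt fs)"

lemma copy_weight_nonneg: "0 \<le> copy_weight SI A"
  by (simp add: copy_weight_def sum_nonneg wt_nonneg)

lemma copy_weight_nonzero:
  assumes "copy_weight SI A \<noteq> 0"
  shows "\<exists>fs\<in>walks m. (!) fs ` SI = A"
proof (rule ccontr)
  assume "\<not> ?thesis"
  then have "{fs\<in>walks m. (!) fs ` SI = A} = {}" by blast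
  then show False using assms unfolding copy_weight_def by (simp only: sum.empty)
qed

lemma walk_image:
  assumes "k \<le> r" "SI \<subseteq> {..<m}" "fs \<in> walks m"
  shows "(!) fs ` SI \<subseteq> X \<and> card ((!) fs ` SI) = card SI"
proof -
  have "distinct fs" "length fs = m" "set fs \<subseteq> X"
    using walk_distinct walks_length assms by auto
  then have "inj_on ((!) fs) SI" using assms(2) by (intro inj_on_nth) auto
  then show ?thesis using walks_nth[OF assms(3)] assms(2) by (auto simp: card_image)
qed

lemma sum_copy_weight:
  assumes "k \<le> r" "SI \<subseteq> {..<m}"
  shows "(\<Sum>A\<in>{A\<in>Pow X. \<sigma> \<subseteq> A}. copy_weight SI A) = (\<Sum>fs\<in>{fs\<in>walks m. \<sigma> \<subseteq> (!) fs ` SI}. wt fs)"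
proof -
  have "(\<Sum>fs\<in>{fs\<in>walks m. \<sigma> \<subseteq> (!) fs ` SI}. wt fs)
     = (\<Sum>A\<in>{A\<in>Pow X. \<sigma> \<subseteq> A}. \<Sum>fs\<in>{fs\<in>{fs\<in>walks m. \<sigma> \<subseteq> (!) fs ` SI}. (!) fs ` SI = A}. wt fs)"
    by (rule sum.group[symmetric]) (use finite_walks finX walk_image[OF assms] in auto)
  also have "\<dots> = (\<Sum>A\<in>{A\<in>Pow X. \<sigma> \<subseteq> A}. copy_weight SI A)"
    unfolding copy_weight_def by (intro sum.cong refl) auto
  finally show ?thesis by simp
qed

text \<open>Prescribed edges determine the images of all their tree vertices by
  \<open>walk_consistent\<close>; so \<open>val\<close> can be read off them and the vertex
  constraints exclude no further walk.\<close>

lemma fixed_edges_weight_le: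
  assumes m: "0 < m" and Q: "Q \<noteq> {}" "Q \<subseteq> {..<m}" and F: "\<And>q. q \<in> Q \<Longrightarrow> F q \<in> X"
  shows "(\<Sum>fs\<in>{fs\<in>walks m. \<forall>q\<in>Q. fs ! q = F q}. wt fs) \<le> bnd (card Q) (card (\<Union>q\<in>Q. es q))"
proof -
  let ?U = "\<Union>q\<in>Q. es q"
  define val where "val w = pos (F (SOME q. q \<in> Q \<and> w \<in> es q)) (c w)" for w
  have "{fs\<in>walks m. \<forall>q\<in>Q. fs ! q = F q} \<subseteq> constrained m Q ?U F val"
  proof
    fix fs assume fs: "fs \<in> {fs\<in>walks m. \<forall>q\<in>Q. fs ! q = F q}"
    have "pos (fs ! i) (c w) = val w" if i: "i < m" "w \<in> es i" and w: "w \<in> ?U" for i w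
    proof -
      let ?q = "SOME q. q \<in> Q \<and> w \<in> es q"
      have q: "?q \<in> Q \<and> w \<in> es ?q" using w by (intro someI_ex[of "\<lambda>q. q \<in> Q \<and> w \<in> es q"]) auto
      then have "pos (fs ! i) (c w) = pos (fs ! ?q) (c w)"
        using walk_consistent[OF order_refl _ i(1) _ i(2)] fs Q(2) by auto
      then show ?thesis using fs q by (simp add: val_def)
    qed
    then show "fs \<in> constrained m Q ?U F val" using fs by (auto simp: constrained_def)
  qed
  then have "(\<Sum>fs\<in>{fs\<in>walks m. \<forall>q\<in>Q. fs ! q = F q}. wt fs) \<le> (\<Sum>fs\<in>constrained m Q ?U F val. wt fs)"
    by (intro sum_mono2) (auto simp: finite_constrained wt_nonneg)
  also have "\<dots> \<le> bnd (card Q) (card ?U)"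
    by (rule constrained_weight_le) (use assms in auto)
  finally show ?thesis .
qed

text \<open>If the copy of a walk contains \<open>\<sigma>\<close>, each element of
  \<open>\<sigma>\<close> sits at some index in \<open>SI\<close>; \<open>\<rho>\<close> records the
  indices, which gives the constant \<open>card SI ^ card SI\<close>. For a fixed injective
  \<open>\<rho>\<close> the density bound and \<open>D \<le> y\<close> turn \<open>bnd\<close> into
  a power of \<open>\<tau>\<close>. The parameter \<open>s\<close> here will be
  \<open>s_param\<close> of the expansion minus \<Delta>.\<close>

lemma copy_weight_degree_le:
  fixes \<tau> s :: real
  assumes kr: "k \<le> r" and SI: "SI \<subseteq> {..<m}" "SI \<noteq> {}"
    and dens: "\<And>Q. Q \<subseteq> SI \<Longrightarrow> Q \<noteq> {} \<Longrightarrow> s * (real (card Q) - 1) \<le> real (card (\<Union>q\<in>Q. es q)) - real k"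
    and Dy: "real D \<le> y" and \<tau>: "(1 / y) * (real D / y) powr (s - 1) \<le> \<tau>"
    and \<sigma>: "\<sigma> \<noteq> {}" "\<sigma> \<subseteq> X"
  shows "(\<Sum>A\<in>{A\<in>Pow X. \<sigma> \<subseteq> A}. copy_weight SI A) \<le> real (card SI) ^ card SI / real (card X) * \<tau> ^ (card \<sigma> - 1)"
proof (cases "card \<sigma> \<le> card SI")
  case False
  have "{fs\<in>walks m. \<sigma> \<subseteq> (!) fs ` SI} = {}"
  proof (rule ccontr)
    assume "\<not> ?thesis"
    then obtain fs where fs: "fs \<in> walks m" "\<sigma> \<subseteq> (!) fs ` SI" by blast
    have "finite SI" using SI finite_subset by blast
    then have "card \<sigma> \<le> card SI" using fs(2) surj_card_le by blast
    then show False using False by simp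
  qed
  moreover have "0 \<le> \<tau>"
  proof -
    have "0 \<le> (1 / y) * (real D / y) powr (s - 1)" using y_pos by simp
    then show ?thesis using \<tau> by linarith
  qed
  ultimately show ?thesis unfolding sum_copy_weight[OF kr SI(1)] by (simp only: sum.empty) simp
next
  case True
  have fin\<sigma>: "finite \<sigma>" using \<sigma> finX finite_subset by blast
  have finSI: "finite SI" using SI finite_subset by blast
  have m: "0 < m" using SI by auto
  let ?j = "card \<sigma>"
  have j: "?j \<ge> 1" using \<sigma> fin\<sigma> by (simp add: Suc_le_eq card_gt_0_iff)
  define b where "b = 1 / real (card X) * \<tau> ^ (?j - 1)"
  have D0: "0 < real D" using D1 by simp
  have \<tau>0: "0 < \<tau>"
  proof -
    have "0 < (1 / y) * (real D / y) powr (s - 1)" using y_pos D0 by simp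
    then show ?thesis using \<tau> by linarith
  qed
  have b0: "0 \<le> b" unfolding b_def using \<tau>0 by simp
  let ?P = "PiE \<sigma> (\<lambda>_. SI)"
  let ?W = "\<lambda>\<rho>. {fs\<in>walks m. \<forall>a\<in>\<sigma>. fs ! \<rho> a = a}"
  have each: "(\<Sum>fs\<in>?W \<rho>. wt fs) \<le> b" if \<rho>: "\<rho> \<in> ?P" for \<rho>
  proof (cases "inj_on \<rho> \<sigma>")
    case False
    then obtain a a' where a: "a \<in> \<sigma>" "a' \<in> \<sigma>" "a \<noteq> a'" "\<rho> a = \<rho> a'" unfolding inj_on_def by blast
    have "fs \<notin> ?W \<rho>" for fs
    proof
      assume "fs \<in> ?W \<rho>"
      then have "fs ! \<rho> a = a" "fs ! \<rho> a' = a'" using a by blast+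
      then show False using a by simp
    qed
    then have "?W \<rho> = {}" by blast
    then show ?thesis using b0 by (simp only: sum.empty)
  next
    case inj: True
    let ?Q = "\<rho> ` \<sigma>"
    have Q: "?Q \<subseteq> SI" "?Q \<noteq> {}" using \<rho> \<sigma> by auto
    have cQ: "card ?Q = ?j" using inj by (rule card_image)
    let ?u = "card (\<Union>q\<in>?Q. es q)"
    have "?W \<rho> = {fs\<in>walks m. \<forall>q\<in>?Q. fs ! q = inv_into \<sigma> \<rho> q}"
      by (simp add: inv_into_f_f[OF inj])
    moreover have "(\<Sum>fs\<in>{fs\<in>walks m. \<forall>q\<in>?Q. fs ! q = inv_into \<sigma> \<rho> q}. wt fs) \<le> bnd (card ?Q) ?u"
    proof (rule fixed_edges_weight_le[OF m Q(2)])
      show "?Q \<subseteq> {..<m}" using Q SI by blast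
      show "inv_into \<sigma> \<rho> q \<in> X" if "q \<in> ?Q" for q using inv_into_into[OF that] \<sigma> by blast
    qed
    moreover have "bnd (card ?Q) ?u \<le> b"
    proof -
      have e: "(s - 1) * (real ?j - 1) \<le> real ?u - real k - (real ?j - 1)"
        using dens[OF Q] unfolding cQ by (simp add: algebra_simps)
      have "(real D / y) powr (real ?u - real k - (real ?j - 1)) \<le> (real D / y) powr ((s - 1) * (real ?j - 1))"
        using e D0 Dy y_pos by (intro powr_mono') auto
      then have "bnd (card ?Q) ?u \<le> 1 / real (card X) * (1 / y) powr (real ?j - 1) * (real D / y) powr ((s - 1) * (real ?j - 1))"
        unfolding bnd_def cQ by (intro mult_left_mono) auto
      also have "\<dots> = 1 / real (card X) * ((1 / y) * (real D / y) powr (s - 1)) powr (real ?j - 1)"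
      proof -
        have "((1 / y) * (real D / y) powr (s - 1)) powr (real ?j - 1)
            = (1 / y) powr (real ?j - 1) * ((real D / y) powr (s - 1)) powr (real ?j - 1)"
          by (rule powr_mult)
        then show ?thesis by (simp only: powr_powr mult.assoc)
      qed
      also have "\<dots> \<le> 1 / real (card X) * \<tau> powr (real ?j - 1)"
        using \<tau> y_pos j by (intro mult_left_mono powr_mono2) auto
      also have "\<tau> powr (real ?j - 1) = \<tau> ^ (?j - 1)"
        using \<tau>0 j by (simp add: powr_realpow[symmetric] of_nat_diff)
      finally show ?thesis unfolding b_def .
    qed
    ultimately show ?thesis by simp
  qed
  have "(\<Sum>fs\<in>{fs\<in>walks m. \<sigma> \<subseteq> (!) fs ` SI}. wt fs) \<le> (\<Sum>fs\<in>(\<Union>\<rho>\<in>?P. ?W \<rho>). wt fs)"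
  proof (rule sum_mono2)
    show "{fs\<in>walks m. \<sigma> \<subseteq> (!) fs ` SI} \<subseteq> (\<Union>\<rho>\<in>?P. ?W \<rho>)"
    proof
      fix fs assume fs: "fs \<in> {fs\<in>walks m. \<sigma> \<subseteq> (!) fs ` SI}"
      define \<rho> where "\<rho> = restrict (inv_into SI ((!) fs)) \<sigma>"
      have sub: "\<sigma> \<subseteq> (!) fs ` SI" using fs by simp
      have "\<rho> \<in> ?P" unfolding \<rho>_def using sub inv_into_into[of _ "(!) fs" SI] by auto
      moreover have "fs ! \<rho> a = a" if "a \<in> \<sigma>" for a
        using f_inv_into_f[of a "(!) fs" SI] sub that by (auto simp: \<rho>_def)
      ultimately show "fs \<in> (\<Union>\<rho>\<in>?P. ?W \<rho>)" using fs by blast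
    qed
    show "finite (\<Union>\<rho>\<in>?P. ?W \<rho>)"
      using finite_walks by (intro finite_UN_I finite_PiE) (auto simp: fin\<sigma> finSI)
  qed (simp add: wt_nonneg)
  also have "\<dots> \<le> (\<Sum>\<rho>\<in>?P. \<Sum>fs\<in>?W \<rho>. wt fs)"
    by (rule sum_UN_le) (use finite_walks in \<open>auto simp: fin\<sigma> finSI wt_nonneg intro!: finite_PiE\<close>)
  also have "\<dots> \<le> (\<Sum>\<rho>\<in>?P. b)" by (rule sum_mono) (rule each)
  also have "\<dots> = real (card SI) ^ ?j * b" using fin\<sigma> by (simp add: card_PiE)
  also have "\<dots> \<le> real (card SI) ^ card SI * b"
    using True SI finSI b0 by (intro mult_right_mono power_increasing) (auto simp: Suc_le_eq card_gt_0_iff)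
  finally show ?thesis unfolding sum_copy_weight[OF kr SI(1)] b_def by simp
qed

end

section \<open>Density of expansions\<close>

text \<open>The new vertex of an edge inherits the colour of the one vertex of the parent edge that
  it replaces; earlier edges do not contain it and keep their colours.\<close>

lemma tight_tree_colouring:
  fixes es :: "nat \<Rightarrow> 'a set"
  assumes k: "0 < k" and es: "\<And>i. i < m \<Longrightarrow> finite (es i) \<and> card (es i) = k"
    and tree: "\<And>i. 0 < i \<Longrightarrow> i < m \<Longrightarrow> par i < i \<and> nv i \<in> es i \<and> nv i \<notin> (\<Union>j<i. es j) \<and> es i - {nv i} \<subseteq> es (par i)"
  shows "\<exists>c. \<forall>i<m. bij_betw c (es i) {..<k}"
proof -
  have "\<exists>c. \<forall>i<t. bij_betw c (es i) {..<k}" if "t \<le> m" for t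
    using that
  proof (induction t)
    case (Suc t)
    then obtain c where c: "\<And>i. i < t \<Longrightarrow> bij_betw c (es i) {..<k}" by auto
    show ?case
    proof (cases "t = 0")
      case True
      obtain c where "bij_betw c (es 0) {..<k}"
        using ex_bij_betw_finite_nat[of "es 0"] es[of 0] Suc.prems by (auto simp: atLeast0LessThan)
      then show ?thesis using True by auto
    next
      case False
      then have t: "0 < t" "t < m" using Suc.prems by auto
      define v where "v = nv t"
      define p where "p = par t"
      have p: "p < t" and v: "v \<in> es t" "v \<notin> (\<Union>j<t. es j)" and sub: "es t - {v} \<subseteq> es p"
        using tree[OF t] unfolding v_def p_def by auto
      have pm: "p < m" using p t by simp
      have ct: "card (es t - {v}) = k - 1" using es[OF t(2)] v by simp
      have "card (es p - (es t - {v})) = 1"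
        using es[OF pm] es[OF t(2)] ct sub k by (simp add: card_Diff_subset)
      then obtain u where u: "es p - (es t - {v}) = {u}" by (auto simp: card_1_singleton_iff)
      then have ep: "es p = insert u (es t - {v})" "u \<notin> es t - {v}" using sub by auto
      have cp: "bij_betw c (es p) {..<k}" using c p by simp
      define c' where "c' = c(v := c u)"
      have "bij_betw c' (es i) {..<k}" if i: "i < Suc t" for i
      proof (cases "i = t")
        case False
        then have "i < t" using i by simp
        then have "v \<notin> es i" using v by auto
        then have "bij_betw c' (es i) {..<k} = bij_betw c (es i) {..<k}"
          by (intro bij_betw_cong) (auto simp: c'_def)
        then show ?thesis using c[OF \<open>i < t\<close>] by simp
      next
        case True
        let ?s = "es t - {v}"
        have "bij_betw c ?s (c ` ?s)" using cp ep(1) by (auto simp: bij_betw_def inj_on_def)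
        then have "bij_betw c' ?s (c ` ?s)"
          by (rule bij_betw_cong[THEN iffD1, rotated]) (auto simp: c'_def)
        moreover have "bij_betw c' {v} {c u}" by (simp add: c'_def bij_betw_def)
        moreover have "c u \<notin> c ` ?s" using cp ep by (auto simp: bij_betw_def inj_on_def)
        ultimately have "bij_betw c' ({v} \<union> ?s) ({c u} \<union> c ` ?s)" by (intro bij_betw_combine) auto
        moreover have "{v} \<union> ?s = es t" using v by auto
        moreover have "{c u} \<union> c ` ?s = {..<k}" using cp ep(1) by (auto simp: bij_betw_def)
        ultimately show ?thesis using True by simp
      qed
      then show ?thesis by blast
    qed
  qed simp
  then show ?thesis by blast
qed

definition tree_order :: "nat \<Rightarrow> 'a hgraph \<Rightarrow> nat \<Rightarrow> (nat \<Rightarrow> 'a set) \<Rightarrow> (nat \<Rightarrow> nat) \<Rightarrow> (nat \<Rightarrow> 'a) \<Rightarrow> ('a \<Rightarrow> nat) \<Rightarrow> bool" where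
  "tree_order k T m es par nv c \<longleftrightarrow> inj_on es {..<m} \<and> edges T = es ` {..<m} \<and>
    (\<forall>i<m. finite (es i) \<and> card (es i) = k \<and> bij_betw c (es i) {..<k}) \<and>
    (\<forall>i. 0 < i \<and> i < m \<longrightarrow>
      par i < i \<and> nv i \<in> es i \<and> nv i \<notin> (\<Union>j<i. es j) \<and> es i - {nv i} \<subseteq> es (par i))"

lemma tight_tree_structure:
  assumes "tight_tree k T" "0 < k"
  shows "\<exists>m es par nv c. tree_order k T m es par nv c"
proof -
  obtain xs where xs: "distinct xs" "set xs = edges T"
    and t: "\<And>i. 1 \<le> i \<Longrightarrow> i < length xs \<Longrightarrow>
      \<exists>v\<in>xs ! i. \<exists>s<i. v \<notin> (\<Union>j<i. xs ! j) \<and> xs ! i - {v} \<subseteq> xs ! s"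
    using assms(1) unfolding tight_tree_def by blast
  have "\<forall>i. \<exists>p v. 1 \<le> i \<and> i < length xs \<longrightarrow> p < i \<and> v \<in> xs ! i \<and> v \<notin> (\<Union>j<i. xs ! j) \<and> xs ! i - {v} \<subseteq> xs ! p"
    using t by blast
  then obtain par nv where pn: "\<And>i. 1 \<le> i \<Longrightarrow> i < length xs \<Longrightarrow>
      par i < i \<and> nv i \<in> xs ! i \<and> nv i \<notin> (\<Union>j<i. xs ! j) \<and> xs ! i - {nv i} \<subseteq> xs ! par i"
    by metis
  have fin: "finite (xs ! i) \<and> card (xs ! i) = k" if "i < length xs" for i
  proof -
    have "xs ! i \<in> edges T" using nth_mem[OF that] xs(2) by simp
    then show ?thesis using assms(1) finite_subset[of "xs ! i" "verts T"]
      by (auto simp: tight_tree_def is_rgraph_def)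
  qed
  have tr: "par i < i \<and> nv i \<in> xs ! i \<and> nv i \<notin> (\<Union>j<i. xs ! j) \<and> xs ! i - {nv i} \<subseteq> xs ! par i"
    if "0 < i" "i < length xs" for i using pn[of i] that by simp
  obtain c where c: "\<And>i. i < length xs \<Longrightarrow> bij_betw c (xs ! i) {..<k}"
    using tight_tree_colouring[OF assms(2) fin tr] by blast
  have inj: "inj_on ((!) xs) {..<length xs}" using xs(1) by (intro inj_on_nth) auto
  have im: "edges T = (!) xs ` {..<length xs}"
    using xs(2) by (auto simp: set_conv_nth)
  have "tree_order k T (length xs) ((!) xs) par nv c"
    unfolding tree_order_def using inj im fin tr c by blast
  then show ?thesis by blast
qed

text \<open>Taken in tree order, every edge of \<open>I\<close> after the first contributes a vertex
  lying in no earlier edge of the tree, in particular in none of those already taken.\<close>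

lemma tight_tree_spread:
  fixes es :: "nat \<Rightarrow> 'a set"
  assumes k: "0 < k" and es: "\<And>i. i < m \<Longrightarrow> finite (es i) \<and> card (es i) = k"
    and tree: "\<And>i. 0 < i \<Longrightarrow> i < m \<Longrightarrow> nv i \<in> es i \<and> nv i \<notin> (\<Union>j<i. es j)"
    and I: "I \<subseteq> {..<m}" "I \<noteq> {}"
  shows "k + card I \<le> card (\<Union>i\<in>I. es i) + 1"
proof -
  have "finite I" using I finite_subset by blast
  then have "I \<subseteq> {..<m} \<longrightarrow> I \<noteq> {} \<longrightarrow> k + card I \<le> card (\<Union>i\<in>I. es i) + 1"
  proof (induction I rule: finite_linorder_max_induct)
    case (insert b A)
    show ?case
    proof (intro impI)
      assume sub: "insert b A \<subseteq> {..<m}" "insert b A \<noteq> {}"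
      show "k + card (insert b A) \<le> card (\<Union>i\<in>insert b A. es i) + 1"
      proof (cases "A = {}")
        case True
        then show ?thesis using es[of b] sub by simp
      next
        case False
        then have b: "0 < b" "b < m" using insert sub by fastforce+
        have bA: "b \<notin> A" using insert by auto
        have fin: "finite (\<Union>i\<in>insert b A. es i)" using insert es sub by auto
        have "nv b \<notin> (\<Union>i\<in>A. es i)" using tree[OF b] insert by auto
        then have "(\<Union>i\<in>A. es i) \<subset> (\<Union>i\<in>insert b A. es i)" using tree[OF b] by auto
        then have "card (\<Union>i\<in>A. es i) < card (\<Union>i\<in>insert b A. es i)" by (rule psubset_card_mono[OF fin])
        moreover have "k + card A \<le> card (\<Union>i\<in>A. es i) + 1" using insert False sub by auto
        ultimately show ?thesis using insert bA by simp
      qed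
    qed
  qed simp
  then show ?thesis using I by blast
qed

lemma expand_edge_inject: "expand_edge k r e = expand_edge k r e' \<longleftrightarrow> e = e'"
proof
  assume eq: "expand_edge k r e = expand_edge k r e'"
  have "e = {x. Inl x \<in> expand_edge k r e}" "e' = {x. Inl x \<in> expand_edge k r e'}"
    by (auto simp: expand_edge_def)
  then show "e = e'" using eq by simp
qed simp

lemma card_expand_edges:
  assumes "finite Q" "\<And>e. e \<in> Q \<Longrightarrow> finite e"
  shows "finite (\<Union>(expand_edge k r ` Q))" "card (\<Union>(expand_edge k r ` Q)) = card (\<Union>Q) + card Q * (r - k)"
proof -
  have eq: "\<Union>(expand_edge k r ` Q) = Inl ` (\<Union>Q) \<union> Inr ` (Q \<times> {..<r - k})"
    by (auto simp: expand_edge_def)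
  have fin: "finite (\<Union>Q)" using assms by auto
  show "finite (\<Union>(expand_edge k r ` Q))" unfolding eq using assms fin by auto
  have "card (\<Union>(expand_edge k r ` Q)) = card (\<Union>Q) + card (Q \<times> {..<r - k})"
    unfolding eq using assms(1) fin by (subst card_Un_disjoint) (auto simp: card_image)
  then show "card (\<Union>(expand_edge k r ` Q)) = card (\<Union>Q) + card Q * (r - k)"
    by (simp add: card_cartesian_product)
qed

lemma finite_density_set:
  assumes "finite (verts H)" "finite (edges H)"
  shows "finite {(real (card (verts G)) - real r) / (real (card (edges G)) - 1) | G.
            subhgraph G H \<and> card (edges G) \<ge> 2}"
proof (rule finite_subset)
  let ?f = "\<lambda>(V, E). (real (card V) - real r) / (real (card E) - 1)"
  show "{(real (card (verts G)) - real r) / (real (card (edges G)) - 1) | G.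
            subhgraph G H \<and> card (edges G) \<ge> 2} \<subseteq> ?f ` (Pow (verts H) \<times> Pow (edges H))"
  proof
    fix z assume "z \<in> {(real (card (verts G)) - real r) / (real (card (edges G)) - 1) | G.
            subhgraph G H \<and> card (edges G) \<ge> 2}"
    then obtain G where "subhgraph G H" "z = ?f (verts G, edges G)" by auto
    then show "z \<in> ?f ` (Pow (verts H) \<times> Pow (edges H))" unfolding subhgraph_def by blast
  qed
  show "finite (?f ` (Pow (verts H) \<times> Pow (edges H)))" using assms by simp
qed

locale expanded_subtree =
  fixes r k :: nat and T S :: "'a hgraph"
  assumes k2: "2 \<le> k" and kr: "k \<le> r" and T: "tight_tree k T" and ST: "spanning_subhgraph S T"
    and S2: "2 \<le> card (edges S)"
begin

abbreviation "F \<equiv> expansion k r S"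
abbreviation "s \<equiv> s_param r F"

lemma edges_sub: "edges S \<subseteq> edges T"
  using ST by (simp add: spanning_subhgraph_def subhgraph_def)

lemma fin_T: "finite (verts T)" "finite (edges T)" "e \<in> edges T \<Longrightarrow> finite e \<and> card e = k \<and> e \<subseteq> verts T"
proof -
  show v: "finite (verts T)" using T by (simp add: tight_tree_def is_rgraph_def)
  have e: "e \<subseteq> verts T \<and> card e = k" if "e \<in> edges T" for e
    using T that by (auto simp: tight_tree_def is_rgraph_def)
  show "finite (edges T)" by (rule finite_subset[of _ "Pow (verts T)"]) (use e v in auto)
  show "e \<in> edges T \<Longrightarrow> finite e \<and> card e = k \<and> e \<subseteq> verts T" using e v finite_subset by blast
qed

lemma fin_S: "finite (verts S)" "finite (edges S)" "e \<in> edges S \<Longrightarrow> finite e \<and> card e = k \<and> e \<subseteq> verts S"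
proof -
  show "finite (verts S)" using fin_T(1) ST by (simp add: spanning_subhgraph_def)
  show "finite (edges S)" by (rule finite_subset[OF edges_sub fin_T(2)])
  show "e \<in> edges S \<Longrightarrow> finite e \<and> card e = k \<and> e \<subseteq> verts S"
    using fin_T(3)[of e] edges_sub ST unfolding spanning_subhgraph_def by auto
qed

lemma expand_edge_sub:
  assumes "e \<in> edges S"
  shows "expand_edge k r e \<subseteq> verts F"
proof -
  have "e \<subseteq> verts S" using fin_S(3)[OF assms] by blast
  then have "Inl ` e \<subseteq> Inl ` verts S" by (rule image_mono)
  moreover have "Inr ` ({e} \<times> {..<r - k}) \<subseteq> Inr ` (edges S \<times> {..<r - k})"
    using assms by (intro image_mono) auto
  ultimately show ?thesis unfolding expand_edge_def expansion_def by (simp only: hgraph.sel) (rule Un_mono)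
qed

lemma fin_F: "finite (verts F)" "finite (edges F)" "e \<in> edges F \<Longrightarrow> e \<subseteq> verts F"
proof -
  show "finite (verts F)" "finite (edges F)" using fin_S(1,2) by (simp_all add: expansion_def)
  assume "e \<in> edges F"
  then obtain e' where "e' \<in> edges S" "e = expand_edge k r e'" by (auto simp: expansion_def)
  then show "e \<subseteq> verts F" using expand_edge_sub by simp
qed

lemma edges_F_of:
  assumes "Q \<subseteq> edges S"
  shows "subhgraph (HGraph (\<Union>(expand_edge k r ` Q)) (expand_edge k r ` Q)) F"
    and "card (expand_edge k r ` Q) = card Q"
proof -
  have "\<Union>(expand_edge k r ` Q) \<subseteq> verts F" using assms expand_edge_sub by blast
  moreover have "expand_edge k r ` Q \<subseteq> edges F" using assms by (auto simp: expansion_def)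
  ultimately show "subhgraph (HGraph (\<Union>(expand_edge k r ` Q)) (expand_edge k r ` Q)) F"
    unfolding subhgraph_def by (auto simp only: hgraph.sel)
  show "card (expand_edge k r ` Q) = card Q"
    by (rule card_image) (auto simp: inj_on_def expand_edge_inject)
qed

text \<open>Each expanded edge brings \<Delta> private vertices and \<open>r = k + \<Delta>\<close>,
  so going back from the expansion to \<open>S\<close> lowers the density by exactly \<Delta>. A
  single edge gives equality and is included because walks may fix just one edge.\<close>

lemma density_le:
  assumes Q: "Q \<subseteq> edges S" "Q \<noteq> {}"
  shows "(s - real (r - k)) * (real (card Q) - 1) \<le> real (card (\<Union>Q)) - real k"
proof -
  have finQ: "finite Q" using Q fin_S finite_subset by blast
  show ?thesis
  proof (cases "card Q \<ge> 2")
    case False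
    moreover have "card Q > 0" using Q finQ by (simp add: card_gt_0_iff)
    ultimately have "card Q = 1" by linarith
    then obtain e where "Q = {e}" by (auto simp: card_1_singleton_iff)
    then show ?thesis using fin_S(3)[of e] Q by simp
  next
    case True
    let ?G = "HGraph (\<Union>(expand_edge k r ` Q)) (expand_edge k r ` Q)"
    have cv: "card (verts ?G) = card (\<Union>Q) + card Q * (r - k)"
      using card_expand_edges(2)[OF finQ] fin_S(3) Q by auto
    have ce: "card (edges ?G) = card Q" using edges_F_of(2)[OF Q(1)] by simp
    have "s \<le> (real (card (verts ?G)) - real r) / (real (card (edges ?G)) - 1)"
      unfolding s_param_def
    proof (rule Min_le[OF finite_density_set[OF fin_F(1,2)]], unfold mem_Collect_eq, rule exI[of _ ?G])
    qed (use edges_F_of(1)[OF Q(1)] ce True in auto)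
    then have "s * (real (card Q) - 1) \<le> real (card (\<Union>Q)) + real (card Q) * real (r - k) - real r"
      using True unfolding cv ce by (simp add: field_simps)
    then show ?thesis using kr by (simp add: algebra_simps of_nat_diff)
  qed
qed

text \<open>By \<open>tight_tree_spread\<close>, j edges of the tree span at least k + j - 1
  vertices, and expanding adds j \<Delta> more. The bound decides the sign of the later exponents:
  \<open>rate\<close> decays at least like \<open>1 / z\<close>.\<close>

lemma s_ge: "real (r - k) + 1 \<le> s"
proof -
  let ?P = "{(real (card (verts G)) - real r) / (real (card (edges G)) - 1) | G.
            subhgraph G F \<and> card (edges G) \<ge> 2}"
  have "?P \<noteq> {}"
    using edges_F_of[of "edges S"] S2 by fastforce
  then have "s \<in> ?P" unfolding s_param_def by (intro Min_in finite_density_set fin_F) auto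
  then obtain G where G: "subhgraph G F" "2 \<le> card (edges G)"
    and sG: "s = (real (card (verts G)) - real r) / (real (card (edges G)) - 1)" by auto
  have k0: "0 < k" using k2 by simp
  obtain m es par nv c where "tree_order k T m es par nv c"
    using tight_tree_structure[OF T k0] by blast
  then have tr: "inj_on es {..<m}" "edges T = es ` {..<m}"
    "\<And>i. i < m \<Longrightarrow> finite (es i) \<and> card (es i) = k"
    "\<And>i. 0 < i \<Longrightarrow> i < m \<Longrightarrow> nv i \<in> es i \<and> nv i \<notin> (\<Union>j<i. es j)"
    unfolding tree_order_def by blast+
  have "edges G \<subseteq> expand_edge k r ` edges S" using G(1) by (simp add: subhgraph_def expansion_def)
  then obtain Q where Q: "Q \<subseteq> edges S" "edges G = expand_edge k r ` Q" by (meson subset_image_iff)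
  have finQ: "finite Q" using Q fin_S finite_subset by blast
  have cQ: "card (edges G) = card Q" using Q edges_F_of(2) by simp
  then have Qne: "Q \<noteq> {}" using G(2) by auto
  have "Q \<subseteq> es ` {..<m}" using Q edges_sub tr(2) by blast
  then obtain I where I: "I \<subseteq> {..<m}" "Q = es ` I" by (meson subset_image_iff)
  have "card I = card Q" unfolding I(2) using inj_on_subset[OF tr(1) I(1)] by (simp add: card_image)
  moreover have "k + card I \<le> card (\<Union>i\<in>I. es i) + 1"
    by (rule tight_tree_spread[OF k0 tr(3,4) I(1)]) (use I Qne in auto)
  ultimately have spread: "k + card Q \<le> card (\<Union>Q) + 1" using I(2) by simp
  have "\<Union>(expand_edge k r ` Q) \<subseteq> verts G" using G(1) Q(2) by (auto simp: subhgraph_def)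
  moreover have "finite (verts G)" using G(1) finite_subset[OF _ fin_F(1)] by (simp add: subhgraph_def)
  ultimately have "card (\<Union>(expand_edge k r ` Q)) \<le> card (verts G)" by (intro card_mono)
  moreover have "card (\<Union>(expand_edge k r ` Q)) = card (\<Union>Q) + card Q * (r - k)"
    using fin_S(3) Q(1) by (intro card_expand_edges(2)[OF finQ]) blast
  ultimately have "card (\<Union>Q) + card Q * (r - k) \<le> card (verts G)" by simp
  then have "k + card Q + card Q * (r - k) \<le> card (verts G) + 1" using spread by linarith
  then have "real (k + card Q + card Q * (r - k)) \<le> real (card (verts G) + 1)" by (rule of_nat_mono)
  then have "real k + real (card Q) + real (card Q) * real (r - k) \<le> real (card (verts G)) + 1" by simp
  then have "(real (r - k) + 1) * (real (card Q) - 1) \<le> real (card (verts G)) - real r"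
    using kr by (simp add: algebra_simps of_nat_diff)
  then show ?thesis using G(2) unfolding sG cQ by (simp add: pos_le_divide_eq)
qed

text \<open>Two edges of \<open>S\<close> span at most \<open>2 * k\<close> tree vertices. Later
  this bound makes the expected number of edges in a container of maximal size tend to
  infinity.\<close>

lemma s_le: "s \<le> real r"
proof -
  obtain Q where Q: "Q \<subseteq> edges S" "card Q = 2"
    using obtain_subset_with_card_n[OF S2] by metis
  then obtain e e' where e: "Q = {e, e'}" "e \<noteq> e'" by (auto simp: card_2_iff)
  have "card (\<Union>Q) \<le> card e + card e'" unfolding e by (simp add: card_Un_le)
  also have "\<dots> = 2 * k" using fin_S(3) Q e by auto
  finally have "card (\<Union>Q) \<le> 2 * k" .
  moreover have "(s - real (r - k)) * (real (card Q) - 1) \<le> real (card (\<Union>Q)) - real k"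
    by (rule density_le) (use Q e in auto)
  ultimately show ?thesis using Q(2) kr by (simp add: of_nat_diff)
qed

end

section \<open>Containers for graphs without the expansion\<close>

lemma card_r_sets_le: "card (r_sets r n) \<le> n ^ r" and finite_r_sets: "finite (r_sets r n)"
proof -
  have eq: "r_sets r n = {e. e \<subseteq> {..<n} \<and> card e = r}" by (simp add: r_sets_def)
  show "finite (r_sets r n)" by (rule finite_subset[of _ "Pow {..<n}"]) (auto simp: eq)
  have "card (r_sets r n) = n choose r" unfolding eq by (simp add: n_subsets)
  also have "\<dots> \<le> n ^ r" by (cases "r \<le> n") (auto simp: binomial_le_pow binomial_eq_0)
  finally show "card (r_sets r n) \<le> n ^ r" .
qed

lemma card_supersets_le:
  assumes X: "X \<subseteq> r_sets r n" and e: "card e = k" "0 < k"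
  shows "card {f\<in>X. e \<subseteq> f} \<le> n ^ (r - k)"
proof -
  have fine: "finite e" using e card_ge_0_finite by metis
  have f: "f \<subseteq> {..<n} \<and> card f = r" if "f \<in> X" for f using X that by (auto simp: r_sets_def)
  have "card {f\<in>X. e \<subseteq> f} = card ((\<lambda>f. f - e) ` {f\<in>X. e \<subseteq> f})"
    by (rule card_image[symmetric]) (auto simp: inj_on_def)
  also have "\<dots> \<le> card (r_sets (r - k) n)"
  proof (rule card_mono[OF finite_r_sets])
    show "(\<lambda>f. f - e) ` {f\<in>X. e \<subseteq> f} \<subseteq> r_sets (r - k) n"
    proof
      fix g assume "g \<in> (\<lambda>f. f - e) ` {f\<in>X. e \<subseteq> f}"
      then obtain h where h: "h \<in> X" "e \<subseteq> h" "g = h - e" by blast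
      then show "g \<in> r_sets (r - k) n" using f[OF h(1)] e fine by (auto simp: r_sets_def card_Diff_subset)
    qed
  qed
  also have "\<dots> \<le> n ^ (r - k)" by (rule card_r_sets_le)
  finally show ?thesis .
qed

context expanded_subtree
begin

text \<open>Up to constants, the parameter \<open>\<tau>\<close> of the containers for a graph with
  \<open>z * n ^ (k - 1)\<close> edges.\<close>

definition rate :: "real \<Rightarrow> real" where
  "rate z = z powr (- s / (real (r - k) + 1))"

text \<open>Inserting the bound on \<open>D\<close> gives \<open>D / y\<close> at most of order
  y^(-1/q) with q = \<Delta> + 1, and -1 - (s - \<Delta> - 1)/q = -s/q.\<close>

lemma threshold_le:
  fixes y y0 c0 C0 :: real
  defines "q \<equiv> real (r - k) + 1"
  assumes y: "c0 * y0 \<le> y" "0 < c0" "0 < y0" and D: "0 < D" "D \<le> C0 * y powr (real (r - k) / q)" "0 < C0"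
  shows "(1 / y) * (D / y) powr (s - real (r - k) - 1)
    \<le> C0 powr (s - real (r - k) - 1) * c0 powr (- s / q) * rate y0"
proof -
  have q: "q \<ge> 1" unfolding q_def by simp
  have cy: "0 < c0 * y0" using y by simp
  have ypos: "0 < y" using y cy by linarith
  have s1: "0 \<le> s - real (r - k) - 1" using s_ge by simp
  have "D / y \<le> C0 * y powr (real (r - k) / q) / y" using D ypos by (simp add: divide_right_mono)
  also have "\<dots> = C0 * y powr (real (r - k) / q - 1)" using ypos by (simp add: powr_diff)
  also have "real (r - k) / q - 1 = - 1 / q" using q unfolding q_def by (simp add: field_simps)
  finally have "(D / y) powr (s - real (r - k) - 1) \<le> (C0 * y powr (- 1 / q)) powr (s - real (r - k) - 1)"
    using D ypos s1 by (intro powr_mono2) auto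
  also have "\<dots> = C0 powr (s - real (r - k) - 1) * (y powr (- 1 / q)) powr (s - real (r - k) - 1)"
    by (rule powr_mult)
  also have "(y powr (- 1 / q)) powr (s - real (r - k) - 1) = y powr ((- 1 / q) * (s - real (r - k) - 1))"
    by (rule powr_powr)
  finally have "(1 / y) * (D / y) powr (s - real (r - k) - 1)
      \<le> (1 / y) * (C0 powr (s - real (r - k) - 1) * y powr ((- 1 / q) * (s - real (r - k) - 1)))"
    using ypos by (intro mult_left_mono) auto
  also have "\<dots> = C0 powr (s - real (r - k) - 1) * (y powr (- 1) * y powr ((- 1 / q) * (s - real (r - k) - 1)))"
    using ypos by (simp add: powr_minus divide_inverse)
  also have "y powr (- 1) * y powr ((- 1 / q) * (s - real (r - k) - 1)) = y powr (- s / q)"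
  proof -
    have "- 1 + (- 1 / q) * (s - real (r - k) - 1) = - s / q"
      using q unfolding q_def by (simp add: field_simps)
    then show ?thesis by (simp only: powr_add[symmetric])
  qed
  also have "y powr (- s / q) \<le> (c0 * y0) powr (- s / q)"
    using cy y s_ge q by (intro powr_mono2') auto
  also have "(c0 * y0) powr (- s / q) = c0 powr (- s / q) * y0 powr (- s / q)" by (rule powr_mult)
  finally show ?thesis unfolding rate_def q_def by (simp add: mult.assoc mult_left_mono)
qed

text \<open>Containers are built only for the subfamily \<open>X\<close> of
  \<open>good_family\<close>, and \<open>E - X\<close> is added to each of them. Hence both the loss
  \<open>c * x\<close> and the exponent in the number of containers scale with x =
  \<open>card X\<close>, however small \<open>X\<close> is compared with \<open>E\<close>.\<close>

lemma container_step:
  "\<exists>c B C. 0 < c \<and> c \<le> 1 \<and> 1 \<le> B \<and> 0 < C \<and>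
    (\<forall>n E. 0 < n \<longrightarrow> E \<subseteq> r_sets r n \<longrightarrow> B * real n ^ (r - 1) \<le> real (card E) \<longrightarrow>
      (\<exists>x \<C>. 0 < x \<and> x \<le> real (card E) \<and> finite \<C> \<and>
        real (card \<C>) \<le> exp (C * rate (real (card E) / real n ^ (k - 1)) * x * ln (real n + 1)) \<and>
        (\<forall>D\<in>\<C>. D \<subseteq> E \<and> real (card D) \<le> real (card E) - c * x) \<and>
        (\<forall>I\<subseteq>E. \<not> contains_copy (HGraph {..<n} I) F \<longrightarrow> (\<exists>D\<in>\<C>. I \<subseteq> D))))"
proof -
  have k0: "0 < k" using k2 by simp
  obtain m es par nv col where "tree_order k T m es par nv col"
    using tight_tree_structure[OF T k0] by blast
  then have inj: "inj_on es {..<m}" and eT: "edges T = es ` {..<m}"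
    and col: "\<And>i. i < m \<Longrightarrow> bij_betw col (es i) {..<k}"
    and tr: "\<And>i. 0 < i \<Longrightarrow> i < m \<Longrightarrow>
      par i < i \<and> nv i \<in> es i \<and> nv i \<notin> (\<Union>j<i. es j) \<and> es i - {nv i} \<subseteq> es (par i)"
    unfolding tree_order_def by blast+
  define SI where "SI = {i. i < m \<and> es i \<in> edges S}"
  have SI: "SI \<subseteq> {..<m}" "edges S = es ` SI" using edges_sub eT by (auto simp: SI_def)
  have finSI: "finite SI" using SI(1) finite_subset by blast
  define l where "l = card SI"
  have "card (edges S) = l" unfolding SI(2) l_def using inj_on_subset[OF inj SI(1)] by (rule card_image)
  then have l2: "2 \<le> l" using S2 by simp
  have SIne: "SI \<noteq> {}" using l2 by (auto simp: l_def)
  define q where "q = real (r - k) + 1"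
  have q1: "q \<ge> 1" and qr: "real (r - k + 1) = q" unfolding q_def by auto
  define c0 where "c0 = 1 / (2 * real k * 2 ^ r * q ^ 2)"
  define C0 where "C0 = q * (2 * real k * 2 ^ r)"
  have c0: "c0 > 0" unfolding c0_def using k0 q1 by simp
  have C0: "C0 > 0" unfolding C0_def using k0 q1 by simp
  define C2 where "C2 = C0 powr (s - real (r - k) - 1) * c0 powr (- s / q)"
  have C2: "C2 > 0" unfolding C2_def using c0 C0 by simp
  show ?thesis
  proof (rule container_family[of l "real l ^ l" "(1 / 2) ^ m", where ?'v = "nat set"])
    show "1 \<le> l" "0 < real l ^ l" "0 < (1 / 2 :: real) ^ m" using l2 by auto
    fix cc CC :: real
    assume cc: "0 < cc" "cc \<le> 1" "0 < CC"
      and fam: "\<And>(V :: nat set set) H \<tau>. \<lbrakk>finite V; V \<noteq> {}; 0 < \<tau>; \<tau> \<le> cc; \<And>f. 0 \<le> H f;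
      \<And>f. H f \<noteq> 0 \<Longrightarrow> f \<subseteq> V \<and> card f = l;
      \<And>\<sigma>. \<sigma> \<noteq> {} \<Longrightarrow> \<sigma> \<subseteq> V \<Longrightarrow> (\<Sum>f\<in>{f\<in>Pow V. \<sigma> \<subseteq> f}. H f) \<le> real l ^ l / real (card V) * \<tau> ^ (card \<sigma> - 1);
      (1 / 2) ^ m \<le> (\<Sum>f\<in>Pow V. H f)\<rbrakk> \<Longrightarrow>
      \<exists>\<C>. finite \<C> \<and> real (card \<C>) \<le> real (card V + 1) powr (CC * \<tau> * real (card V)) \<and>
        (\<forall>D\<in>\<C>. D \<subseteq> V \<and> real (card D) \<le> (1 - cc) * real (card V)) \<and>
        (\<forall>I\<subseteq>V. (\<forall>A\<subseteq>I. H A = 0) \<longrightarrow> (\<exists>D\<in>\<C>. I \<subseteq> D))"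
    \<comment> \<open>The summands ensure in turn that \<open>y0\<close> is at least 1, that
      \<open>F\<close> fits on \<open>n\<close> vertices, that \<open>\<tau>\<close> is small enough
      for \<open>container_family\<close>, that most moves of the walk avoid old vertices, and that
      \<open>D \<le> y\<close>.\<close>
    define B where "B = 1 + real (card (verts F)) + C2 / cc + 2 * real r * real m / c0 + C0 powr q / c0"
    have B: "1 \<le> B" "real (card (verts F)) \<le> B" "C2 / cc \<le> B" "2 * real r * real m / c0 \<le> B" "C0 powr q / c0 \<le> B"
    proof -
      have "0 \<le> C2 / cc" "0 \<le> 2 * real r * real m / c0" "0 \<le> C0 powr q / c0" using C2 cc c0 by auto
      then show "1 \<le> B" "real (card (verts F)) \<le> B" "C2 / cc \<le> B" "2 * real r * real m / c0 \<le> B" "C0 powr q / c0 \<le> B"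
        unfolding B_def by linarith+
    qed
    define C where "C = CC * C2 * real r"
    have r0: "0 < r" using k0 kr by simp
    have Cpos: "0 < C" unfolding C_def using cc C2 r0 by simp
    have main: "\<exists>x \<C>. 0 < x \<and> x \<le> real (card E) \<and> finite \<C> \<and>
        real (card \<C>) \<le> exp (C * rate (real (card E) / real n ^ (k - 1)) * x * ln (real n + 1)) \<and>
        (\<forall>D\<in>\<C>. D \<subseteq> E \<and> real (card D) \<le> real (card E) - cc * x) \<and>
        (\<forall>I\<subseteq>E. \<not> contains_copy (HGraph {..<n} I) F \<longrightarrow> (\<exists>D\<in>\<C>. I \<subseteq> D))"
      if n: "0 < n" and E: "E \<subseteq> r_sets r n" and EB: "B * real n ^ (r - 1) \<le> real (card E)" for n E
    proof -
      have finE: "finite E" using E finite_r_sets finite_subset by blast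
      define y0 where "y0 = real (card E) / real n ^ (k - 1)"
      have rk: "r - 1 = (k - 1) + (r - k)" using kr k0 by simp
      have y0B: "B * real n ^ (r - k) \<le> y0"
        using EB n unfolding y0_def rk power_add by (simp add: field_simps)
      have n1: "1 \<le> real n ^ (r - k)" using n by (simp add: one_le_power)
      have "B * 1 \<le> B * real n ^ (r - k)" using n1 B by (intro mult_left_mono) auto
      then have y0B': "B \<le> y0" using y0B by simp
      then have y01: "1 \<le> y0" using B by simp
      \<comment> \<open>There are at most \<open>n ^ r\<close> edges in all, so the density
        hypothesis on \<open>E\<close> forces \<open>B \<le> n\<close>.\<close>
      have nF: "card (verts F) \<le> n"
      proof -
        have "real (card E) \<le> real n ^ r"
          using card_mono[OF finite_r_sets E] card_r_sets_le[of r n] by (metis le_trans of_nat_le_iff of_nat_power)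
        then have "B * real n ^ (r - 1) \<le> real n * real n ^ (r - 1)"
          using EB r0 by (simp add: power_eq_if)
        then have "B \<le> real n" by (rule mult_right_le_imp_le) (use n in simp)
        then show ?thesis using B(2) by simp
      qed
      show ?thesis
      proof (rule good_family[OF _ kr E, of])
        show "1 \<le> k" using k0 by simp
        show "1 \<le> real (card E) / real n ^ (k - 1)" using y01 by (simp add: y0_def)
        fix X \<kappa> D y
        assume XS: "X \<subseteq> E" "X \<noteq> {}" and \<kappa>: "\<And>f. f \<in> X \<Longrightarrow> \<kappa> f \<subseteq> f \<and> card (\<kappa> f) = k"
          and DS: "\<And>e. card {f\<in>X. \<kappa> f = e} \<le> D" "1 \<le> D"
          and y: "\<And>f i. f \<in> X \<Longrightarrow> i < k \<Longrightarrow> y \<le> real (card {f'\<in>X. drop_nth \<kappa> i f' = drop_nth \<kappa> i f})"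
          and yy0: "real (card E) / real n ^ (k - 1) / (2 * real k * 2 ^ r * real (r - k + 1) ^ 2) \<le> y"
          and Dy: "real D \<le> (real (r - k + 1) * (2 * real k * 2 ^ r)) * y powr (real (r - k) / real (r - k + 1))"
        have cy: "c0 * y0 \<le> y" using yy0 unfolding qr c0_def y0_def by (simp add: mult_ac)
        have Dy': "real D \<le> C0 * y powr (real (r - k) / q)" using Dy unfolding qr C0_def .
        have cB: "c0 * B \<le> y" using cy mult_left_mono[OF y0B', of c0] c0 by linarith
        have ypos: "0 < y"
        proof -
          have "0 < c0 * B" using c0 B by simp
          then show ?thesis using cB by linarith
        qed
        have finX: "finite X" using XS finE finite_subset by blast
        have XE: "X \<subseteq> r_sets r n" using XS E by blast
        have yM: "2 * real r * real m * real (n ^ (r - k)) \<le> y"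
        proof -
          have "2 * real r * real m \<le> c0 * B" using B(4) c0 by (simp add: field_simps)
          then have "2 * real r * real m * real n ^ (r - k) \<le> c0 * B * real n ^ (r - k)"
            by (rule mult_right_mono) simp
          also have "\<dots> \<le> c0 * y0" using y0B c0 by (simp add: mult.assoc)
          finally show ?thesis using cy by simp
        qed
        interpret tree_walk X \<kappa> k r D "n ^ (r - k)" y es par nv col m
        proof
          show "finite f \<and> card f = r \<and> \<kappa> f \<subseteq> f \<and> card (\<kappa> f) = k" if "f \<in> X" for f
            using XE that \<kappa>[OF that] finite_subset[of f "{..<n}"] by (auto simp: r_sets_def)
          show "card {f\<in>X. e \<subseteq> f} \<le> n ^ (r - k)" if "card e = k" for e
            using card_supersets_le[OF XE that k0] .
        qed (use finX XS DS y ypos yM k0 tr col in blast)+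
        have DyR: "real D \<le> y"
        proof -
          have "C0 powr q \<le> c0 * B" using B(5) c0 by (simp add: field_simps)
          then have "C0 powr q \<le> y" using cB by linarith
          then have "(C0 powr q) powr (1 / q) \<le> y powr (1 / q)" using q1 by (intro powr_mono2) auto
          then have "C0 \<le> y powr (1 / q)" using q1 C0 by (simp add: powr_powr)
          then have "C0 * y powr (real (r - k) / q) \<le> y powr (1 / q) * y powr (real (r - k) / q)"
            by (rule mult_right_mono) simp
          also have "\<dots> = y"
          proof -
            have "1 / q + real (r - k) / q = 1" using q1 unfolding q_def by (simp add: field_simps)
            then show ?thesis using ypos by (simp add: powr_add[symmetric])
          qed
          finally show ?thesis using Dy' by linarith
        qed
        define \<tau> where "\<tau> = C2 * rate y0"
        have rate0: "0 < rate y0" unfolding rate_def using y01 by simp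
        have \<tau>0: "0 < \<tau>" unfolding \<tau>_def using C2 rate0 by simp
        have \<tau>c: "\<tau> \<le> cc"
        proof -
          have "- s / q \<le> - 1" using s_ge q1 unfolding q_def by (simp add: field_simps)
          then have "rate y0 \<le> y0 powr (- 1)" unfolding rate_def q_def[symmetric] using y01 by (rule powr_mono)
          also have "\<dots> = 1 / y0" using y01 by (simp add: powr_minus divide_inverse)
          also have "\<dots> \<le> 1 / B" using y0B' B(1) by (intro divide_left_mono) auto
          finally have "\<tau> \<le> C2 * (1 / B)" unfolding \<tau>_def using C2 by (intro mult_left_mono) auto
          also have "\<dots> \<le> cc" using B(1,3) cc by (simp add: field_simps)
          finally show ?thesis .
        qed
        have \<tau>y: "(1 / y) * (real D / y) powr ((s - real (r - k)) - 1) \<le> \<tau>"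
          unfolding \<tau>_def C2_def using threshold_le[OF cy c0, of "real D" C0] y01 DS(2) Dy' C0
          by (simp add: q_def)
        have dens: "(s - real (r - k)) * (real (card Q) - 1) \<le> real (card (\<Union>q\<in>Q. es q)) - real k"
          if "Q \<subseteq> SI" "Q \<noteq> {}" for Q
        proof -
          have "es ` Q \<subseteq> edges S" "es ` Q \<noteq> {}" using that SI(2) by auto
          moreover have "card (es ` Q) = card Q"
            using inj_on_subset[OF inj] that(1) SI(1) by (meson card_image subset_trans)
          ultimately show ?thesis using density_le[of "es ` Q"] by simp
        qed
        have "\<exists>\<C>. finite \<C> \<and> real (card \<C>) \<le> real (card X + 1) powr (CC * \<tau> * real (card X)) \<and>
          (\<forall>D\<in>\<C>. D \<subseteq> X \<and> real (card D) \<le> (1 - cc) * real (card X)) \<and>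
          (\<forall>I\<subseteq>X. (\<forall>A\<subseteq>I. copy_weight SI A = 0) \<longrightarrow> (\<exists>D\<in>\<C>. I \<subseteq> D))"
        proof (rule fam[OF finX XS(2) \<tau>0 \<tau>c copy_weight_nonneg])
          show "f \<subseteq> X \<and> card f = l" if "copy_weight SI f \<noteq> 0" for f
            using copy_weight_nonzero[OF that] walk_image[OF kr SI(1)] unfolding l_def by blast
          show "(\<Sum>f\<in>{f\<in>Pow X. \<sigma> \<subseteq> f}. copy_weight SI f) \<le> real l ^ l / real (card X) * \<tau> ^ (card \<sigma> - 1)"
            if "\<sigma> \<noteq> {}" "\<sigma> \<subseteq> X" for \<sigma>
            unfolding l_def by (rule copy_weight_degree_le[OF kr SI(1) SIne dens DyR \<tau>y that])
          show "(1 / 2) ^ m \<le> (\<Sum>f\<in>Pow X. copy_weight SI f)"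
            using walks_total_ge[OF order_refl] sum_copy_weight[OF kr SI(1), of "{}"] by (simp add: Pow_def)
        qed
        then obtain \<C> where C0: "finite \<C> \<and> real (card \<C>) \<le> real (card X + 1) powr (CC * \<tau> * real (card X)) \<and>
          (\<forall>D\<in>\<C>. D \<subseteq> X \<and> real (card D) \<le> (1 - cc) * real (card X)) \<and>
          (\<forall>I\<subseteq>X. (\<forall>A\<subseteq>I. copy_weight SI A = 0) \<longrightarrow> (\<exists>D\<in>\<C>. I \<subseteq> D))"
          by (rule exE)
        then have \<C>: "finite \<C>" "real (card \<C>) \<le> real (card X + 1) powr (CC * \<tau> * real (card X))"
          by blast+
        have \<C>3: "D \<subseteq> X \<and> real (card D) \<le> (1 - cc) * real (card X)" if "D \<in> \<C>" for D
          using C0 that by blast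
        have \<C>4: "\<exists>D\<in>\<C>. I \<subseteq> D" if "I \<subseteq> X" "\<forall>A\<subseteq>I. copy_weight SI A = 0" for I
          using C0 that by blast
        let ?x = "real (card X)"
        let ?\<C> = "(\<lambda>D. (E - X) \<union> D) ` \<C>"
        have x: "0 < ?x" "?x \<le> real (card E)"
          using XS finX finE by (auto simp: card_gt_0_iff card_mono)
        have "card ?\<C> \<le> card \<C>" by (rule card_image_le[OF \<C>(1)])
        then have "real (card ?\<C>) \<le> real (card X + 1) powr (CC * \<tau> * ?x)" using \<C>(2) by linarith
        also have "\<dots> \<le> (real (n + 1) ^ r) powr (CC * \<tau> * ?x)"
        proof (rule powr_mono2)
          have "card X \<le> n ^ r" using card_mono[OF finite_r_sets XE] card_r_sets_le[of r n] by linarith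
          also have "n ^ r < (n + 1) ^ r" using r0 by (intro power_strict_mono) auto
          finally have "card X + 1 \<le> (n + 1) ^ r" by simp
          then show "real (card X + 1) \<le> real (n + 1) ^ r" by (metis of_nat_le_iff of_nat_power)
        qed (use cc \<tau>0 in auto)
        also have "\<dots> = exp (C * rate y0 * ?x * ln (real n + 1))"
          by (simp add: powr_def ln_realpow C_def \<tau>_def mult_ac add.commute)
        finally have c1: "real (card ?\<C>) \<le> exp (C * rate y0 * ?x * ln (real n + 1))" .
        have c2: "D' \<subseteq> E \<and> real (card D') \<le> real (card E) - cc * ?x" if "D' \<in> ?\<C>" for D'
        proof -
          obtain D where D: "D \<in> \<C>" "D' = (E - X) \<union> D" using \<open>D' \<in> ?\<C>\<close> by blast
          have "card D' \<le> card (E - X) + card D" unfolding D(2) by (rule card_Un_le)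
          also have "card (E - X) = card E - card X" using XS finX by (simp add: card_Diff_subset)
          finally have "real (card D') \<le> real (card E) - ?x + real (card D)"
            using x by (simp add: of_nat_diff)
          then show ?thesis using \<C>3[OF D(1)] D(2) XS by (auto simp: algebra_simps)
        qed
        have c3: "\<exists>D'\<in>?\<C>. I \<subseteq> D'" if I: "I \<subseteq> E" "\<not> contains_copy (HGraph {..<n} I) F" for I
        proof -
          have "copy_weight SI A = 0" if A: "A \<subseteq> I \<inter> X" for A
          proof (rule ccontr)
            assume "copy_weight SI A \<noteq> 0"
            then obtain fs where fs: "fs \<in> walks m" "(!) fs ` SI = A" using copy_weight_nonzero by blast
            have fsI: "fs ! i \<in> I \<and> fs ! i \<subseteq> {..<n}" if "i \<in> SI" for i
            proof -
              have "fs ! i \<in> A" using fs(2) that by blast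
              then have "fs ! i \<in> I" "fs ! i \<in> r_sets r n" using A I E by auto
              then show ?thesis by (simp add: r_sets_def)
            qed
            have "contains_copy (HGraph {..<n} I) F"
              by (rule walk_contains_copy[OF fs(1) inj fin_S(1) SI(2,1)])
                (use fin_S(3) fsI nF in auto)
            then show False using I(2) by simp
          qed
          then have "\<exists>D\<in>\<C>. I \<inter> X \<subseteq> D" by (intro \<C>4) auto
          then obtain D where D: "D \<in> \<C>" "I \<inter> X \<subseteq> D" by (rule bexE)
          have "I \<subseteq> (E - X) \<union> D" using D(2) I(1) by blast
          then show ?thesis using D(1) by (intro bexI[of _ "(E - X) \<union> D"]) auto
        qed
        show ?thesis
          unfolding y0_def[symmetric]
        proof (rule exI[of _ ?x], rule exI[of _ ?\<C>], intro conjI ballI allI impI)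
          show "finite ?\<C>" using \<C>(1) by simp
          show "D' \<subseteq> E" "real (card D') \<le> real (card E) - cc * ?x" if "D' \<in> ?\<C>" for D'
            using c2[OF that] by auto
        qed (rule x c1 c3; assumption)+
      qed
    qed
    show ?thesis
      by (rule exI[of _ cc], rule exI[of _ B], rule exI[of _ C]) (use cc B(1) Cpos main in simp)
  qed
qed

section \<open>Iterating the container step\<close>

lemma rate_pos: "0 < z \<Longrightarrow> 0 < rate z"
  by (simp add: rate_def)

text \<open>The product is a power of \<open>z\<close> with exponent 1 - s/(\<Delta> + 1),
  nonpositive by \<open>s_ge\<close>. So removing a given proportion of the edges is most expensive
  when only about \<open>M\<close> are left, and that price can be charged throughout.\<close>

lemma rate_times_antimono:
  assumes "0 < a" "a \<le> b"
  shows "rate b * b \<le> rate a * a"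
proof -
  have *: "rate z * z = z powr (1 - s / (real (r - k) + 1))" if "0 < z" for z
  proof -
    have e: "1 - s / (real (r - k) + 1) = - s / (real (r - k) + 1) + 1" by simp
    show ?thesis unfolding e powr_add rate_def using that by simp
  qed
  have "b powr (1 - s / (real (r - k) + 1)) \<le> a powr (1 - s / (real (r - k) + 1))"
    using assms s_ge by (intro powr_mono2') (auto simp: field_simps)
  then show ?thesis using * assms by simp
qed

text \<open>Each step costs at most \<open>R * ln (old size / new size)\<close>, so the total cost telescopes.\<close>

lemma iterate_containers:
  fixes c B C M R :: real
  assumes c: "0 < c" "c \<le> 1" and C: "0 < C" and n: "0 < n" and M: "0 < M" "B * real n ^ (r - 1) \<le> M"
    and step: "\<And>E. E \<subseteq> r_sets r n \<Longrightarrow> B * real n ^ (r - 1) \<le> real (card E) \<Longrightarrow>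
      \<exists>x \<C>. 0 < x \<and> x \<le> real (card E) \<and> finite \<C> \<and>
        real (card \<C>) \<le> exp (C * rate (real (card E) / real n ^ (k - 1)) * x * ln (real n + 1)) \<and>
        (\<forall>D\<in>\<C>. D \<subseteq> E \<and> real (card D) \<le> real (card E) - c * x) \<and>
        (\<forall>I\<subseteq>E. P I \<longrightarrow> (\<exists>D\<in>\<C>. I \<subseteq> D))"
  defines "R \<equiv> C / c * (rate (M / real n ^ (k - 1)) * M) * ln (real n + 1)"
  assumes E: "E \<subseteq> r_sets r n"
  shows "\<exists>\<C>. finite \<C> \<and> (\<forall>D\<in>\<C>. D \<subseteq> E \<and> real (card D) \<le> M) \<and>
    real (card \<C>) \<le> (if real (card E) \<le> M then 1 else exp (R * (1 + ln (real (card E) / M)))) \<and>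
    (\<forall>I\<subseteq>E. P I \<longrightarrow> (\<exists>D\<in>\<C>. I \<subseteq> D))"
  using E
proof (induction "card E" arbitrary: E rule: less_induct)
  case less
  have np: "0 < real n ^ (k - 1)" using n by simp
  have ln0: "0 \<le> ln (real n + 1)" by simp
  have R0: "0 \<le> R" unfolding R_def using c C M np rate_pos[of "M / real n ^ (k - 1)"] ln0 by simp
  show ?case
  proof (cases "real (card E) \<le> M")
    case True
    then show ?thesis by (intro exI[of _ "{E}"]) auto
  next
    case False
    let ?m = "real (card E)"
    have mM: "M < ?m" using False by simp
    then have m0: "0 < ?m" using M by linarith
    have bm: "B * real n ^ (r - 1) \<le> ?m" using mM M by linarith
    obtain x where "\<exists>\<C>0. 0 < x \<and> x \<le> ?m \<and> finite \<C>0 \<and>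
        real (card \<C>0) \<le> exp (C * rate (?m / real n ^ (k - 1)) * x * ln (real n + 1)) \<and>
        (\<forall>D\<in>\<C>0. D \<subseteq> E \<and> real (card D) \<le> ?m - c * x) \<and>
        (\<forall>I\<subseteq>E. P I \<longrightarrow> (\<exists>D\<in>\<C>0. I \<subseteq> D))"
      using step[OF less.prems bm] by (rule exE)
    then obtain \<C>0 where "0 < x \<and> x \<le> ?m \<and> finite \<C>0 \<and>
        real (card \<C>0) \<le> exp (C * rate (?m / real n ^ (k - 1)) * x * ln (real n + 1)) \<and>
        (\<forall>D\<in>\<C>0. D \<subseteq> E \<and> real (card D) \<le> ?m - c * x) \<and>
        (\<forall>I\<subseteq>E. P I \<longrightarrow> (\<exists>D\<in>\<C>0. I \<subseteq> D))"
      by (rule exE)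
    then have x: "0 < x" "x \<le> ?m" and \<C>0: "finite \<C>0"
        "real (card \<C>0) \<le> exp (C * rate (?m / real n ^ (k - 1)) * x * ln (real n + 1))"
        "\<forall>D\<in>\<C>0. D \<subseteq> E \<and> real (card D) \<le> ?m - c * x" "\<forall>I\<subseteq>E. P I \<longrightarrow> (\<exists>D\<in>\<C>0. I \<subseteq> D)"
      by simp_all
    have cost: "C * rate (?m / real n ^ (k - 1)) * x * ln (real n + 1) \<le> R * (c * x / ?m)"
    proof -
      have "rate (?m / real n ^ (k - 1)) * (?m / real n ^ (k - 1)) \<le> rate (M / real n ^ (k - 1)) * (M / real n ^ (k - 1))"
        using mM M np by (intro rate_times_antimono) (auto simp: divide_right_mono)
      then have "rate (?m / real n ^ (k - 1)) * ?m \<le> rate (M / real n ^ (k - 1)) * M"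
        using np unfolding times_divide_eq_right divide_le_cancel by blast
      then have "C * (rate (?m / real n ^ (k - 1)) * ?m) * ln (real n + 1) * (x / ?m)
          \<le> C * (rate (M / real n ^ (k - 1)) * M) * ln (real n + 1) * (x / ?m)"
        using C ln0 x m0 by (intro mult_right_mono mult_left_mono) auto
      moreover have "C * (rate (?m / real n ^ (k - 1)) * ?m) * ln (real n + 1) * (x / ?m)
          = C * rate (?m / real n ^ (k - 1)) * x * ln (real n + 1)" using m0 by simp
      moreover have "C * (rate (M / real n ^ (k - 1)) * M) * ln (real n + 1) * (x / ?m) = R * (c * x / ?m)"
        unfolding R_def using c by simp
      ultimately show ?thesis by linarith
    qed
    \<comment> \<open>What remains of the budget for \<open>E\<close> after the present step; it
      must suffice below every container \<open>D\<close> of this step.\<close>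
    define b where "b = exp (R * (1 + ln (?m / M)) - R * (c * x / ?m))"
    define Q where "Q D \<C> \<longleftrightarrow> finite \<C> \<and> (\<forall>D'\<in>\<C>. D' \<subseteq> D \<and> real (card D') \<le> M) \<and> real (card \<C>) \<le> b \<and>
      (\<forall>I\<subseteq>D. P I \<longrightarrow> (\<exists>D'\<in>\<C>. I \<subseteq> D'))" for D \<C>
    have "\<exists>\<C>. Q D \<C>" if D: "D \<in> \<C>0" for D
    proof -
      have DE: "D \<subseteq> E" and dx: "real (card D) \<le> ?m - c * x" using \<C>0(3) D by auto
      have "real (card D) < ?m" using dx mult_pos_pos[OF c(1) x(1)] by linarith
      then have cD: "card D < card E" by simp
      obtain \<C> where \<C>: "finite \<C> \<and> (\<forall>D'\<in>\<C>. D' \<subseteq> D \<and> real (card D') \<le> M) \<and>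
          real (card \<C>) \<le> (if real (card D) \<le> M then 1 else exp (R * (1 + ln (real (card D) / M)))) \<and>
          (\<forall>I\<subseteq>D. P I \<longrightarrow> (\<exists>D'\<in>\<C>. I \<subseteq> D'))"
        using less.hyps[OF cD order_trans[OF DE less.prems]] by (rule exE)
      have "(if real (card D) \<le> M then 1 else exp (R * (1 + ln (real (card D) / M)))) \<le> b"
      proof (cases "real (card D) \<le> M")
        case True
        \<comment> \<open>The last step may jump far below \<open>M\<close>, where the logarithm
          pays nothing. Its cost is at most \<open>R\<close>, which is the purpose of the summand 1
          in the budget.\<close>
        have "c * x / ?m \<le> 1" using c x m0 mult_mono[of c 1 x ?m] by simp
        moreover have "0 \<le> ln (?m / M)" using mM M by simp
        ultimately have "0 \<le> R * (1 + ln (?m / M) - c * x / ?m)" using R0 by (intro mult_nonneg_nonneg) auto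
        then show ?thesis using True unfolding b_def by (simp add: algebra_simps)
      next
        case False
        let ?d = "real (card D)"
        have d: "0 < ?d" using False M by linarith
        have "0 < ?m - c * x" using d dx by linarith
        then have u: "0 < 1 - c * x / ?m" using m0 by (simp add: field_simps)
        have "ln (?d / M) \<le> ln ((?m - c * x) / M)"
          using d dx M by (intro ln_mono) (auto simp: divide_right_mono)
        also have "(?m - c * x) / M = ?m / M * (1 - c * x / ?m)"
          using m0 M by (simp add: right_diff_distrib diff_divide_distrib)
        also have "ln (?m / M * (1 - c * x / ?m)) = ln (?m / M) + ln (1 - c * x / ?m)"
          using m0 M u by (intro ln_mult_pos) auto
        also have "ln (1 - c * x / ?m) \<le> - (c * x / ?m)" using ln_le_minus_one[OF u] by simp
        finally have "R * (1 + ln (?d / M)) \<le> R * (1 + ln (?m / M) - c * x / ?m)"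
          using R0 by (intro mult_left_mono) auto
        then show ?thesis using False unfolding b_def by (simp add: algebra_simps)
      qed
      then have "real (card \<C>) \<le> b"
        by (rule order_trans[OF \<C>[THEN conjunct2, THEN conjunct2, THEN conjunct1]])
      then have "Q D \<C>"
        unfolding Q_def using \<C>[THEN conjunct1] \<C>[THEN conjunct2, THEN conjunct1]
          \<C>[THEN conjunct2, THEN conjunct2, THEN conjunct2] by (intro conjI)
      then show ?thesis by (rule exI)
    qed
    then have "\<forall>D\<in>\<C>0. \<exists>\<C>. Q D \<C>" by blast
    from bchoice[OF this] obtain f where f: "\<And>D. D \<in> \<C>0 \<Longrightarrow> Q D (f D)" by blast
    let ?\<C> = "\<Union>D\<in>\<C>0. f D"
    have "finite ?\<C>" using \<C>0(1) f by (auto simp: Q_def)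
    moreover have "\<forall>D'\<in>?\<C>. D' \<subseteq> E \<and> real (card D') \<le> M"
    proof
      fix D' assume "D' \<in> ?\<C>"
      then obtain D where D: "D \<in> \<C>0" "D' \<in> f D" by (rule UN_E)
      then have "D' \<subseteq> D" "real (card D') \<le> M" using f[OF D(1)] by (simp_all add: Q_def)
      moreover have "D \<subseteq> E" using \<C>0(3) D(1) by simp
      ultimately show "D' \<subseteq> E \<and> real (card D') \<le> M" by simp
    qed
    moreover have "real (card ?\<C>) \<le> exp (R * (1 + ln (?m / M)))"
    proof -
      have "real (card ?\<C>) \<le> (\<Sum>D\<in>\<C>0. real (card (f D)))"
        using card_UN_le[OF \<C>0(1), of f] by (simp flip: of_nat_sum)
      also have "\<dots> \<le> (\<Sum>D\<in>\<C>0. b)" using f by (intro sum_mono) (simp add: Q_def)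
      also have "\<dots> = real (card \<C>0) * b" by simp
      also have "\<dots> \<le> exp (R * (c * x / ?m)) * b"
        using \<C>0(2) cost by (intro mult_right_mono) (auto simp: b_def intro: order_trans)
      also have "\<dots> = exp (R * (1 + ln (?m / M)))" unfolding b_def by (simp flip: exp_add)
      finally show ?thesis .
    qed
    moreover have "\<exists>D'\<in>?\<C>. I \<subseteq> D'" if I: "I \<subseteq> E" "P I" for I
    proof -
      have "\<exists>D\<in>\<C>0. I \<subseteq> D" using \<C>0(4)[rule_format, OF I] .
      then obtain D where D: "D \<in> \<C>0" "I \<subseteq> D" by (rule bexE)
      have "\<exists>D'\<in>f D. I \<subseteq> D'"
        using f[OF D(1), unfolded Q_def, THEN conjunct2, THEN conjunct2, THEN conjunct2, rule_format, OF D(2) I(2)] .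
      then obtain D' where "D' \<in> f D" "I \<subseteq> D'" by (rule bexE)
      then show ?thesis using D(1) by blast
    qed
    ultimately show ?thesis using False by (intro exI[of _ ?\<C>]) auto
  qed
qed

text \<open>One of the two logarithms counts the fingerprints among at most n^r edges, the other is
  the telescoped ratio between n^r and \<open>M\<close>. For \<open>n \<ge> 3\<close> the logarithm
  is at least 1 and absorbs the additive constants.\<close>

lemma containers:
  "\<exists>B K. 1 \<le> B \<and> 1 \<le> K \<and> (\<forall>n M. 3 \<le> n \<longrightarrow> B * real n ^ (r - 1) \<le> M \<longrightarrow>
    (\<exists>\<C>. finite \<C> \<and> (\<forall>D\<in>\<C>. D \<subseteq> r_sets r n \<and> real (card D) \<le> M) \<and>
      real (card \<C>) \<le> exp (K * rate (M / real n ^ (k - 1)) * ln (real n) ^ 2 * M) \<and>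
      (\<forall>I\<subseteq>r_sets r n. \<not> contains_copy (HGraph {..<n} I) F \<longrightarrow> (\<exists>D\<in>\<C>. I \<subseteq> D))))"
proof -
  obtain c B C where c: "0 < c" "c \<le> 1" and B: "1 \<le> B" and C: "0 < C" and
    step: "\<And>n E. 0 < n \<Longrightarrow> E \<subseteq> r_sets r n \<Longrightarrow> B * real n ^ (r - 1) \<le> real (card E) \<Longrightarrow>
      (\<exists>x \<C>. 0 < x \<and> x \<le> real (card E) \<and> finite \<C> \<and>
        real (card \<C>) \<le> exp (C * rate (real (card E) / real n ^ (k - 1)) * x * ln (real n + 1)) \<and>
        (\<forall>D\<in>\<C>. D \<subseteq> E \<and> real (card D) \<le> real (card E) - c * x) \<and>
        (\<forall>I\<subseteq>E. \<not> contains_copy (HGraph {..<n} I) F \<longrightarrow> (\<exists>D\<in>\<C>. I \<subseteq> D)))"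
    using container_step by metis
  define K where "K = 1 + C / c * 2 * (real r + 1)"
  have K1: "1 \<le> K" unfolding K_def using c C by simp
  have "\<exists>\<C>. finite \<C> \<and> (\<forall>D\<in>\<C>. D \<subseteq> r_sets r n \<and> real (card D) \<le> M) \<and>
      real (card \<C>) \<le> exp (K * rate (M / real n ^ (k - 1)) * ln (real n) ^ 2 * M) \<and>
      (\<forall>I\<subseteq>r_sets r n. \<not> contains_copy (HGraph {..<n} I) F \<longrightarrow> (\<exists>D\<in>\<C>. I \<subseteq> D))"
    if n: "3 \<le> n" and M: "B * real n ^ (r - 1) \<le> M" for n M
  proof -
    have n0: "0 < n" using n by simp
    have "1 \<le> real n ^ (r - 1)" using n0 by (simp add: one_le_power)
    then have "1 * 1 \<le> B * real n ^ (r - 1)" using B by (intro mult_mono) auto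
    then have M1: "1 \<le> M" using M by simp
    define R where "R = C / c * (rate (M / real n ^ (k - 1)) * M) * ln (real n + 1)"
    have L1: "1 \<le> ln (real n)"
    proof -
      have "exp 1 \<le> (3::real)" using e_less_272 by simp
      then have "exp 1 \<le> real n" using n by linarith
      then show ?thesis using n0 by (simp add: ln_ge_iff)
    qed
    have rt: "0 < rate (M / real n ^ (k - 1))" using M1 n0 by (intro rate_pos) simp
    have "real n + 1 \<le> real n ^ 2"
    proof -
      have "3 * real n \<le> real n * real n" using n by (intro mult_right_mono) auto
      moreover have "3 \<le> real n" using n by simp
      ultimately show ?thesis unfolding power2_eq_square by linarith
    qed
    then have "ln (real n + 1) \<le> ln (real n ^ 2)" by (intro ln_mono) auto
    then have ln2: "ln (real n + 1) \<le> 2 * ln (real n)" using n0 by (simp add: ln_realpow)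
    have R0: "0 \<le> R" unfolding R_def using c C M1 rt by simp
    obtain \<C> where \<C>: "finite \<C> \<and> (\<forall>D\<in>\<C>. D \<subseteq> r_sets r n \<and> real (card D) \<le> M) \<and>
      real (card \<C>) \<le> (if real (card (r_sets r n)) \<le> M then 1 else exp (R * (1 + ln (real (card (r_sets r n)) / M)))) \<and>
      (\<forall>I\<subseteq>r_sets r n. \<not> contains_copy (HGraph {..<n} I) F \<longrightarrow> (\<exists>D\<in>\<C>. I \<subseteq> D))"
      using iterate_containers[OF c C n0 _ M step[OF n0] order_refl, folded R_def] M1 by auto
    have "(if real (card (r_sets r n)) \<le> M then 1 else exp (R * (1 + ln (real (card (r_sets r n)) / M))))
      \<le> exp (R * (1 + real r * ln (real n)))"
    proof (cases "real (card (r_sets r n)) \<le> M")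
      case True
      then show ?thesis using R0 L1 by simp
    next
      case False
      let ?N = "real (card (r_sets r n))"
      have "?N / M \<le> ?N / 1" using M1 by (intro divide_left_mono) auto
      also have "\<dots> \<le> real n ^ r" using card_r_sets_le[of r n] by (metis div_by_1 of_nat_le_iff of_nat_power)
      finally have "ln (?N / M) \<le> ln (real n ^ r)" using False M1 by (intro ln_mono) auto
      also have "\<dots> = real r * ln (real n)" using n0 by (simp add: ln_realpow)
      finally show ?thesis using False R0 by (simp add: mult_left_mono)
    qed
    also have "R * (1 + real r * ln (real n)) \<le> K * rate (M / real n ^ (k - 1)) * ln (real n) ^ 2 * M"
    proof -
      have "R \<le> C / c * (rate (M / real n ^ (k - 1)) * M) * (2 * ln (real n))"
        unfolding R_def using ln2 c C M1 rt by (intro mult_left_mono) auto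
      moreover have "1 + real r * ln (real n) \<le> (real r + 1) * ln (real n)" using L1 by (simp add: algebra_simps)
      ultimately have "R * (1 + real r * ln (real n))
        \<le> C / c * (rate (M / real n ^ (k - 1)) * M) * (2 * ln (real n)) * ((real r + 1) * ln (real n))"
        using R0 L1 c C M1 rt by (intro mult_mono) auto
      also have "\<dots> = (C / c * 2 * (real r + 1)) * (rate (M / real n ^ (k - 1)) * ln (real n) ^ 2 * M)"
        by (simp add: power2_eq_square)
      also have "\<dots> \<le> K * (rate (M / real n ^ (k - 1)) * ln (real n) ^ 2 * M)"
        unfolding K_def using rt M1 by (intro mult_right_mono) auto
      finally show ?thesis by (simp add: mult.assoc)
    qed
    finally have "(if real (card (r_sets r n)) \<le> M then 1 else exp (R * (1 + ln (real (card (r_sets r n)) / M))))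
      \<le> exp (K * rate (M / real n ^ (k - 1)) * ln (real n) ^ 2 * M)" by simp
    then show ?thesis using \<C> by (intro exI[of _ \<C>]) auto
  qed
  then show ?thesis using B K1 by blast
qed

end

section \<open>The random hypergraph\<close>

lemma prob_conj_ge:
  assumes "measure_pmf.prob M {x. \<not> P x} \<le> e" "measure_pmf.prob M {x. \<not> Q x} \<le> e"
  shows "1 - 2 * e \<le> measure_pmf.prob M {x. P x \<and> Q x}"
proof -
  let ?A = "{x. \<not> P x} \<union> {x. \<not> Q x}"
  have "{x. P x \<and> Q x} = space (measure_pmf M) - ?A" by auto
  then have "measure_pmf.prob M {x. P x \<and> Q x} = 1 - measure_pmf.prob M ?A"
    using measure_pmf.prob_compl[of ?A M] by simp
  moreover have "measure_pmf.prob M ?A \<le> measure_pmf.prob M {x. \<not> P x} + measure_pmf.prob M {x. \<not> Q x}"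
    by (rule measure_Un_le) auto
  ultimately show ?thesis using assms by linarith
qed

lemma power_self_le_exp_fact: "real j ^ j \<le> exp (real j) * fact j"
proof -
  have "(\<Sum>i\<in>{j}. real j ^ i /\<^sub>R fact i) \<le> (\<Sum>i. real j ^ i /\<^sub>R fact i)"
    by (rule sum_le_suminf[OF summable_exp_generic]) auto
  then have "real j ^ j / fact j \<le> exp (real j)" by (simp add: exp_def field_simps)
  then show ?thesis by (simp add: field_simps)
qed

lemma prob_all_present:
  assumes "finite R" "B \<subseteq> R" "0 \<le> p" "p \<le> 1"
  shows "measure_pmf.prob (Pi_pmf R False (\<lambda>_. bernoulli_pmf p)) {f. \<forall>e\<in>B. f e} = p ^ card B"
proof -
  have "{f. \<forall>e\<in>B. f e} = Pi R (\<lambda>e. if e \<in> B then {True} else UNIV)"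
    using assms(2) by (auto simp: Pi_def)
  then have "measure_pmf.prob (Pi_pmf R False (\<lambda>_. bernoulli_pmf p)) {f. \<forall>e\<in>B. f e}
      = (\<Prod>e\<in>R. measure_pmf.prob (bernoulli_pmf p) (if e \<in> B then {True} else UNIV))"
    by (simp add: measure_Pi_pmf_Pi[OF assms(1)])
  also have "\<dots> = (\<Prod>e\<in>R. if e \<in> B then p else 1)"
    using assms(3,4) by (intro prod.cong) (auto simp: measure_pmf_single)
  also have "\<dots> = p ^ card B"
    using assms(1,2) by (simp add: prod.If_cases Int_absorb1)
  finally show ?thesis .
qed

text \<open>A union bound over the \<open>j\<close>-subsets of \<open>C\<close>, with their number
  estimated by (e M / j)^j.\<close>

lemma prob_dense_le:
  assumes R: "finite R" "C \<subseteq> R" and p: "0 \<le> p" "p \<le> 1" and M: "real (card C) \<le> M" and j: "1 \<le> j"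
  shows "measure_pmf.prob (Pi_pmf R False (\<lambda>_. bernoulli_pmf p)) {f. j \<le> card {e\<in>C. f e}}
    \<le> (exp 1 * (p * M) / real j) ^ j"
proof -
  let ?P = "measure_pmf.prob (Pi_pmf R False (\<lambda>_. bernoulli_pmf p))"
  let ?Bs = "{B. B \<subseteq> C \<and> card B = j}"
  have finC: "finite C" using R finite_subset by blast
  have finB: "finite ?Bs" by (rule finite_subset[of _ "Pow C"]) (use finC in auto)
  have M0: "0 \<le> M" using M by linarith
  have "?P {f. j \<le> card {e\<in>C. f e}} \<le> ?P (\<Union>B\<in>?Bs. {f. \<forall>e\<in>B. f e})"
  proof (rule measure_pmf.finite_measure_mono)
    show "{f. j \<le> card {e\<in>C. f e}} \<subseteq> (\<Union>B\<in>?Bs. {f. \<forall>e\<in>B. f e})"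
    proof
      fix f assume "f \<in> {f. j \<le> card {e\<in>C. f e}}"
      then have "j \<le> card {e\<in>C. f e}" by simp
      then obtain B where "B \<subseteq> {e\<in>C. f e}" "card B = j" "finite B" by (rule obtain_subset_with_card_n)
      then show "f \<in> (\<Union>B\<in>?Bs. {f. \<forall>e\<in>B. f e})" by blast
    qed
  qed simp
  also have "\<dots> \<le> (\<Sum>B\<in>?Bs. ?P {f. \<forall>e\<in>B. f e})"
    by (rule measure_pmf.finite_measure_subadditive_finite[OF finB]) simp
  also have "\<dots> = (\<Sum>B\<in>?Bs. p ^ j)"
    by (intro sum.cong refl) (use prob_all_present[OF R(1) _ p] R(2) in auto)
  also have "\<dots> = real (card C choose j) * p ^ j" using n_subsets[OF finC, of j] by simp
  also have "\<dots> \<le> (exp 1 * M / real j) ^ j * p ^ j"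
  proof (rule mult_right_mono)
    have "real ((card C choose j) * fact j) \<le> real (card C ^ j)"
      using binomial_fact_pow by (simp only: of_nat_le_iff)
    also have "\<dots> \<le> M ^ j" using M by (simp add: power_mono)
    finally have "real (card C choose j) \<le> M ^ j / fact j" by (simp add: field_simps)
    also have "\<dots> \<le> M ^ j * (exp (real j) / real j ^ j)"
    proof -
      have "1 / fact j \<le> exp (real j) / real j ^ j"
        using power_self_le_exp_fact[of j] j by (simp add: field_simps)
      then show ?thesis using mult_left_mono[of "1 / fact j" "exp (real j) / real j ^ j" "M ^ j"] M0 by simp
    qed
    also have "exp (real j) = exp 1 ^ j" using exp_of_nat_mult[of j "1::real"] by simp
    also have "M ^ j * (exp 1 ^ j / real j ^ j) = (exp 1 * M / real j) ^ j"
      by (simp add: power_mult_distrib power_divide)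
    finally show "real (card C choose j) \<le> (exp 1 * M / real j) ^ j" .
  qed (use p in simp)
  also have "\<dots> = (exp 1 * (p * M) / real j) ^ j"
    by (simp add: power_mult_distrib[symmetric] mult_ac)
  finally show ?thesis .
qed

lemma prob_some_dense_le:
  assumes R: "finite R" and p: "0 \<le> p" "p \<le> 1" and pM: "0 < p * M"
    and \<C>: "finite \<C>" "\<And>D. D \<in> \<C> \<Longrightarrow> D \<subseteq> R \<and> real (card D) \<le> M" "real (card \<C>) \<le> exp (p * M)"
  shows "measure_pmf.prob (Pi_pmf R False (\<lambda>_. bernoulli_pmf p))
      {f. \<exists>D\<in>\<C>. exp 3 * (p * M) < real (card {e\<in>D. f e})} \<le> exp (- (p * M))"
proof -
  let ?P = "measure_pmf.prob (Pi_pmf R False (\<lambda>_. bernoulli_pmf p))"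
  \<comment> \<open>With this \<open>j\<close> the base e p M / j is at most e^-2, so a single
    container fails with probability at most e^(-2pM), which outweighs the number e^(pM) of
    containers.\<close>
  define j where "j = nat \<lceil>exp 3 * (p * M)\<rceil>"
  have a0: "0 < exp 3 * (p * M)" using pM by simp
  have j: "exp 3 * (p * M) \<le> real j" unfolding j_def by linarith
  have j1: "1 \<le> j" using j a0 by (cases j) auto
  have "?P {f. \<exists>D\<in>\<C>. exp 3 * (p * M) < real (card {e\<in>D. f e})} \<le> ?P (\<Union>D\<in>\<C>. {f. j \<le> card {e\<in>D. f e}})"
  proof (rule measure_pmf.finite_measure_mono)
    have "j \<le> x" if "exp 3 * (p * M) < real x" for x
      using that unfolding j_def by linarith
    then show "{f. \<exists>D\<in>\<C>. exp 3 * (p * M) < real (card {e\<in>D. f e})} \<subseteq> (\<Union>D\<in>\<C>. {f. j \<le> card {e\<in>D. f e}})"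
      by blast
  qed simp
  also have "\<dots> \<le> (\<Sum>D\<in>\<C>. ?P {f. j \<le> card {e\<in>D. f e}})"
    by (rule measure_pmf.finite_measure_subadditive_finite[OF \<C>(1)]) simp
  also have "\<dots> \<le> (\<Sum>D\<in>\<C>. exp (- 2 * (p * M)))"
  proof (rule sum_mono)
    fix D assume D: "D \<in> \<C>"
    have "?P {f. j \<le> card {e\<in>D. f e}} \<le> (exp 1 * (p * M) / real j) ^ j"
      using \<C>(2)[OF D] by (intro prob_dense_le[OF R _ p _ j1]) auto
    also have "\<dots> \<le> (exp (- 2)) ^ j"
    proof (rule power_mono)
      have "exp 1 * (p * M) / real j \<le> exp 1 * (p * M) / (exp 3 * (p * M))"
        using j a0 pM j1 by (intro divide_left_mono) auto
      also have "\<dots> = exp 1 / exp 3" using pM by (auto simp: zero_less_mult_iff)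
      also have "\<dots> = exp (- 2)" by (simp flip: exp_diff)
      finally show "exp 1 * (p * M) / real j \<le> exp (- 2)" .
    qed (use pM in simp)
    also have "\<dots> = exp (real j * - 2)" by (rule exp_of_nat_mult[symmetric])
    also have "\<dots> \<le> exp (- 2 * (p * M))"
    proof -
      have "1 \<le> exp (3::real)" by simp
      then have "1 * (p * M) \<le> exp 3 * (p * M)" using pM by (intro mult_right_mono) auto
      then show ?thesis using j by simp
    qed
    finally show "?P {f. j \<le> card {e\<in>D. f e}} \<le> exp (- 2 * (p * M))" .
  qed
  also have "\<dots> = real (card \<C>) * exp (- 2 * (p * M))" by simp
  also have "\<dots> \<le> exp (p * M) * exp (- 2 * (p * M))" using \<C>(3) by (intro mult_right_mono) auto
  also have "\<dots> = exp (- (p * M))" by (simp flip: exp_add)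
  finally show ?thesis .
qed

lemma ex_number_le:
  assumes "finite (edges G)" "edges H \<noteq> {}"
    and le: "\<And>G'. subhgraph G' G \<Longrightarrow> \<not> contains_copy G' H \<Longrightarrow> real (card (edges G')) \<le> z"
  shows "real (ex_number G H) \<le> z"
proof -
  let ?A = "{card (edges G') | G'. subhgraph G' G \<and> \<not> contains_copy G' H}"
  have "?A \<subseteq> {..card (edges G)}" using assms(1) by (auto simp: subhgraph_def intro!: card_mono)
  then have fin: "finite ?A" using finite_subset by blast
  have "subhgraph (HGraph {} {}) G \<and> \<not> contains_copy (HGraph {} {}) H"
    using assms(2) by (auto simp: subhgraph_def contains_copy_def)
  then have "?A \<noteq> {}" by blast
  then have "ex_number G H \<in> ?A" unfolding ex_number_def by (rule Max_in[OF fin])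
  then show ?thesis using le by auto
qed

text \<open>The containers concern graphs on all of \<open>{..<n}\<close>, while a subgraph may have
  fewer vertices. The edges of a copy already lie inside, and only isolated vertices of
  \<open>H\<close> may have to be moved.\<close>

lemma contains_copy_verts:
  assumes copy: "contains_copy (HGraph V I) H" and H: "finite (verts H)" "\<And>e. e \<in> edges H \<Longrightarrow> e \<subseteq> verts H"
    and V': "finite V'" "\<And>f. f \<in> I \<Longrightarrow> f \<subseteq> V'" "card (verts H) \<le> card V'"
  shows "contains_copy (HGraph V' I) H"
proof -
  obtain \<phi> where \<phi>: "inj_on \<phi> (verts H)" "\<And>e. e \<in> edges H \<Longrightarrow> \<phi> ` e \<in> I"
    using copy by (auto simp: contains_copy_def)
  let ?A = "\<Union>(edges H)"
  have A: "?A \<subseteq> verts H" using H by blast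
  have inj: "inj_on \<phi> ?A" by (rule inj_on_subset[OF \<phi>(1) A])
  have im: "\<phi> ` ?A \<subseteq> V'" using \<phi>(2) V'(2) by blast
  obtain \<psi> where \<psi>: "inj_on \<psi> (verts H)" "\<psi> ` verts H \<subseteq> V'" "\<And>a. a \<in> ?A \<Longrightarrow> \<psi> a = \<phi> a"
    using inj_on_extend[OF inj A H(1) V'(1,3) im] by metis
  have "\<psi> ` e \<in> I" if "e \<in> edges H" for e
  proof -
    have "\<psi> ` e = \<phi> ` e" using \<psi>(3) that by (intro image_cong) auto
    then show ?thesis using \<phi>(2)[OF that] by simp
  qed
  then show ?thesis unfolding contains_copy_def using \<psi>(1,2) by auto
qed

context expanded_subtree
begin

text \<open>A subgraph with fewer vertices than \<open>F\<close> is free of \<open>F\<close>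
  although its edge set may contain a copy on the larger vertex set, so no container need cover it.
  It has at most \<open>card (verts F) ^ r\<close> edges, which the hypothesis on
  \<open>p * M\<close> absorbs.\<close>

lemma ex_number_prob:
  "\<exists>B K. 1 \<le> B \<and> 1 \<le> K \<and> (\<forall>n p M. 3 \<le> n \<longrightarrow> 0 \<le> p \<longrightarrow> p \<le> 1 \<longrightarrow> B * real n ^ (r - 1) \<le> M \<longrightarrow>
     K * rate (M / real n ^ (k - 1)) * ln (real n) ^ 2 \<le> p \<longrightarrow> real (card (verts F)) ^ r \<le> p * M \<longrightarrow> 0 < p * M \<longrightarrow>
     measure_pmf.prob (random_rgraph r n p) {G. \<not> real (ex_number G F) \<le> exp 3 * (p * M)} \<le> exp (- (p * M)))"
proof -
  obtain B K where BK0: "1 \<le> B \<and> 1 \<le> K \<and> (\<forall>n M. 3 \<le> n \<longrightarrow> B * real n ^ (r - 1) \<le> M \<longrightarrow>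
    (\<exists>\<C>. finite \<C> \<and> (\<forall>D\<in>\<C>. D \<subseteq> r_sets r n \<and> real (card D) \<le> M) \<and>
      real (card \<C>) \<le> exp (K * rate (M / real n ^ (k - 1)) * ln (real n) ^ 2 * M) \<and>
      (\<forall>I\<subseteq>r_sets r n. \<not> contains_copy (HGraph {..<n} I) F \<longrightarrow> (\<exists>D\<in>\<C>. I \<subseteq> D))))"
    using containers by (elim exE) (rule that)
  note BK = BK0[THEN conjunct1] BK0[THEN conjunct2, THEN conjunct1]
    and cont = BK0[THEN conjunct2, THEN conjunct2]
  have "measure_pmf.prob (random_rgraph r n p) {G. \<not> real (ex_number G F) \<le> exp 3 * (p * M)} \<le> exp (- (p * M))"
    if n: "3 \<le> n" and p: "0 \<le> p" "p \<le> 1" and M: "B * real n ^ (r - 1) \<le> M"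
      and Kp: "K * rate (M / real n ^ (k - 1)) * ln (real n) ^ 2 \<le> p"
      and vF: "real (card (verts F)) ^ r \<le> p * M" and pM: "0 < p * M" for n p M
  proof -
    have M0: "0 < M" using pM p by (simp add: zero_less_mult_iff)
    obtain \<C> where C: "finite \<C> \<and> (\<forall>D\<in>\<C>. D \<subseteq> r_sets r n \<and> real (card D) \<le> M) \<and>
      real (card \<C>) \<le> exp (K * rate (M / real n ^ (k - 1)) * ln (real n) ^ 2 * M) \<and>
      (\<forall>I\<subseteq>r_sets r n. \<not> contains_copy (HGraph {..<n} I) F \<longrightarrow> (\<exists>D\<in>\<C>. I \<subseteq> D))"
      using cont[rule_format, OF n M] by (rule exE)
    have finC: "finite \<C>" using C by (rule conjunct1)
    have memC: "\<And>D. D \<in> \<C> \<Longrightarrow> D \<subseteq> r_sets r n \<and> real (card D) \<le> M" using C by simp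
    have cC: "real (card \<C>) \<le> exp (K * rate (M / real n ^ (k - 1)) * ln (real n) ^ 2 * M)"
      using C by (elim conjE)
    have covC: "\<And>I. I \<subseteq> r_sets r n \<Longrightarrow> \<not> contains_copy (HGraph {..<n} I) F \<Longrightarrow> \<exists>D\<in>\<C>. I \<subseteq> D"
      using C by simp
    have "K * rate (M / real n ^ (k - 1)) * ln (real n) ^ 2 * M \<le> p * M"
      using Kp M0 by (intro mult_right_mono) auto
    then have cC': "real (card \<C>) \<le> exp (p * M)" using cC by (meson exp_le_cancel_iff order_trans)
    let ?P = "Pi_pmf (r_sets r n) False (\<lambda>_. bernoulli_pmf p)"
    let ?G = "\<lambda>f. HGraph {..<n} {e \<in> r_sets r n. f e}"
    have good: "real (ex_number (?G f) F) \<le> exp 3 * (p * M)"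
      if f: "\<not> (\<exists>D\<in>\<C>. exp 3 * (p * M) < real (card {e\<in>D. f e}))" for f
    proof (rule ex_number_le)
      show "finite (edges (?G f))" using finite_r_sets by simp
      show "edges F \<noteq> {}" using S2 by (auto simp: expansion_def)
      fix G' assume G': "subhgraph G' (?G f)" "\<not> contains_copy G' F"
      have V: "verts G' \<subseteq> {..<n}" "edges G' \<subseteq> r_sets r n" "\<And>e. e \<in> edges G' \<Longrightarrow> f e \<and> e \<subseteq> verts G'"
        using G'(1) by (auto simp: subhgraph_def)
      have finV: "finite (verts G')" using V(1) finite_subset by blast
      show "real (card (edges G')) \<le> exp 3 * (p * M)"
      proof (cases "card (verts F) \<le> card (verts G')")
        case True
        have "\<not> contains_copy (HGraph {..<n} (edges G')) F"
        proof
          assume "contains_copy (HGraph {..<n} (edges G')) F"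
          then have "contains_copy (HGraph (verts G') (edges G')) F"
            by (rule contains_copy_verts[OF _ fin_F(1) fin_F(3) finV _ True]) (use V(3) in auto)
          then show False using G'(2) by simp
        qed
        then obtain D where D: "D \<in> \<C>" "edges G' \<subseteq> D" using covC[OF V(2)] by blast
        have "edges G' \<subseteq> {e\<in>D. f e}" using D(2) V(3) by blast
        moreover have "finite D" using memC[OF D(1)] finite_r_sets finite_subset by blast
        ultimately have "card (edges G') \<le> card {e\<in>D. f e}" by (intro card_mono) auto
        moreover have "real (card {e\<in>D. f e}) \<le> exp 3 * (p * M)" using f D(1) by (simp add: not_less)
        ultimately show ?thesis by linarith
      next
        case False
        have "edges G' \<subseteq> {e. e \<subseteq> verts G' \<and> card e = r}" using V by (auto simp: r_sets_def)
        then have "card (edges G') \<le> card {e. e \<subseteq> verts G' \<and> card e = r}"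
          using finV by (intro card_mono) auto
        also have "\<dots> = card (verts G') choose r" using n_subsets[OF finV] by simp
        also have "\<dots> \<le> card (verts G') ^ r"
          by (cases "r \<le> card (verts G')") (auto simp: binomial_le_pow binomial_eq_0)
        also have "\<dots> \<le> card (verts F) ^ r" using False by (intro power_mono) auto
        finally have "real (card (edges G')) \<le> real (card (verts F)) ^ r" by (metis of_nat_le_iff of_nat_power)
        also have "\<dots> \<le> p * M" by (rule vF)
        also have "\<dots> \<le> exp 3 * (p * M)"
        proof -
          have "1 \<le> exp (3::real)" by simp
          then have "1 * (p * M) \<le> exp 3 * (p * M)" using pM by (intro mult_right_mono) auto
          then show ?thesis by simp
        qed
        finally show ?thesis .
      qed
    qed
    have "measure_pmf.prob (random_rgraph r n p) {G. \<not> real (ex_number G F) \<le> exp 3 * (p * M)}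
        = measure_pmf.prob ?P {f. \<not> real (ex_number (?G f) F) \<le> exp 3 * (p * M)}"
      unfolding random_rgraph_def by (simp add: vimage_def)
    also have "\<dots> \<le> measure_pmf.prob ?P {f. \<exists>D\<in>\<C>. exp 3 * (p * M) < real (card {e\<in>D. f e})}"
    proof (rule measure_pmf.finite_measure_mono)
      show "{f. \<not> real (ex_number (?G f) F) \<le> exp 3 * (p * M)}
          \<subseteq> {f. \<exists>D\<in>\<C>. exp 3 * (p * M) < real (card {e\<in>D. f e})}"
        using good by blast
    qed simp
    also have "\<dots> \<le> exp (- (p * M))"
      by (rule prob_some_dense_le[OF finite_r_sets p pM finC memC cC'])
    finally show ?thesis .
  qed
  then show ?thesis
    using BK by (intro exI[of _ B] exI[of _ K] conjI allI impI) assumption+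
qed

section \<open>The choice of M in the two ranges of p\<close>

text \<open>The exponent of \<open>rate\<close> is at most -1, so enlarging the argument by
  \<open>C1\<close> gains at least the factor \<open>K\<close>. In this way the constant in front of
  the container count is hidden in \<open>M\<close>.\<close>

lemma rate_le_scaled:
  assumes C1: "1 \<le> K" "K \<le> C1" and z: "0 < z"
  shows "K * rate (C1 * z) \<le> rate z"
proof -
  have q: "1 \<le> real (r - k) + 1" by simp
  have "- s / (real (r - k) + 1) \<le> - 1" using s_ge by (simp add: field_simps)
  then have "C1 powr (- s / (real (r - k) + 1)) \<le> C1 powr (- 1)" using C1 by (intro powr_mono) auto
  also have "\<dots> = 1 / C1" using C1 by (simp add: powr_minus divide_inverse)
  also have "\<dots> \<le> 1 / K" using C1 by (intro divide_left_mono) auto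
  finally have "K * C1 powr (- s / (real (r - k) + 1)) \<le> 1" using C1 by (simp add: field_simps)
  then have "(K * C1 powr (- s / (real (r - k) + 1))) * rate z \<le> 1 * rate z"
    using rate_pos[OF z] by (intro mult_right_mono) auto
  moreover have "rate (C1 * z) = C1 powr (- s / (real (r - k) + 1)) * rate z"
    unfolding rate_def by (rule powr_mult)
  ultimately show ?thesis by (simp add: mult.assoc)
qed

lemma powr_log_ge:
  fixes L :: real
  assumes "1 \<le> L" "2 \<le> b"
  shows "L ^ 2 \<le> L powr b"
proof -
  have "L ^ 2 = L powr 2" using assms by (simp add: powr_numeral)
  also have "\<dots> \<le> L powr b" using assms by (intro powr_mono) auto
  finally show ?thesis .
qed

text \<open>For M = C1 n^(r-1) the quotient by n^(k-1) is C1 n^\<Delta>, and \<open>rate\<close> of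
  n^\<Delta> is precisely the power of n in \<open>p1\<close>; the logarithmic factor of
  \<open>p1\<close> covers \<open>L ^ 2\<close>. The second claim rests on \<Delta> s/(\<Delta> + 1)
  \<le> r - 1, a consequence of \<open>s_le\<close>.\<close>

lemma above_threshold:
  fixes n :: nat and p :: real
  defines "\<Delta> \<equiv> real (r - k)" and "L \<equiv> ln (real n)"
  assumes n: "1 \<le> n" and L: "1 \<le> L" and C1: "1 \<le> K" "K \<le> C1"
    and p: "real n powr (- (\<Delta> / (\<Delta> + 1)) * s) * L powr (\<Delta> + 2 + \<Delta> * s / (\<Delta> + 1)) \<le> p"
  shows "K * rate (C1 * real n ^ (r - 1) / real n ^ (k - 1)) * L ^ 2 \<le> p"
    and "L powr 2 \<le> p * (C1 * real n ^ (r - 1))"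
proof -
  have \<Delta>: "0 \<le> \<Delta>" by (simp add: \<Delta>_def)
  have n0: "0 < real n" using n by simp
  have s0: "0 < s" using s_ge by linarith
  let ?b = "\<Delta> + 2 + \<Delta> * s / (\<Delta> + 1)"
  have b: "2 \<le> ?b" using \<Delta> s0 by simp
  have "r - 1 = (k - 1) + (r - k)" using kr k2 by simp
  then have "C1 * real n ^ (r - 1) / real n ^ (k - 1) = C1 * (real n powr \<Delta>)"
    using n0 by (simp add: power_add powr_realpow \<Delta>_def)
  then have "K * rate (C1 * real n ^ (r - 1) / real n ^ (k - 1)) \<le> rate (real n powr \<Delta>)"
    using rate_le_scaled[OF C1, of "real n powr \<Delta>"] n0 by simp
  also have "\<dots> = real n powr (- (\<Delta> / (\<Delta> + 1)) * s)"
    unfolding rate_def \<Delta>_def by (simp add: powr_powr)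
  finally have "K * rate (C1 * real n ^ (r - 1) / real n ^ (k - 1)) * L ^ 2
      \<le> real n powr (- (\<Delta> / (\<Delta> + 1)) * s) * L powr ?b"
    using powr_log_ge[OF L b] by (intro mult_mono) auto
  then show "K * rate (C1 * real n ^ (r - 1) / real n ^ (k - 1)) * L ^ 2 \<le> p" using p by linarith
  have e0: "0 \<le> - (\<Delta> / (\<Delta> + 1)) * s + real (r - 1)"
  proof -
    have "\<Delta> * s \<le> \<Delta> * real r" using s_le \<Delta> by (intro mult_left_mono) auto
    also have "\<dots> \<le> real (r - 1) * (\<Delta> + 1)"
      using kr k2 unfolding \<Delta>_def by (simp add: of_nat_diff algebra_simps)
    finally show ?thesis using \<Delta> by (simp add: field_simps)
  qed
  have "L powr 2 \<le> 1 * L powr ?b" unfolding mult_1 by (rule powr_mono[OF b L])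
  also have "\<dots> \<le> real n powr (- (\<Delta> / (\<Delta> + 1)) * s + real (r - 1)) * L powr ?b"
    using e0 n by (intro mult_right_mono ge_one_powr_ge_zero) auto
  also have "\<dots> = (real n powr (- (\<Delta> / (\<Delta> + 1)) * s) * L powr ?b) * real n ^ (r - 1)"
    by (simp only: powr_add powr_realpow[OF n0] mult_ac)
  also have "\<dots> \<le> p * real n ^ (r - 1)" using p by (intro mult_right_mono) auto
  also have "\<dots> \<le> p * (C1 * real n ^ (r - 1))"
  proof -
    have "0 \<le> real n powr (- (\<Delta> / (\<Delta> + 1)) * s) * L powr ?b" by simp
    then have p0: "0 \<le> p" using p by linarith
    have "1 * real n ^ (r - 1) \<le> C1 * real n ^ (r - 1)" using C1 by (intro mult_right_mono) auto
    then show ?thesis using p0 by (intro mult_left_mono) auto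
  qed
  finally show "L powr 2 \<le> p * (C1 * real n ^ (r - 1))" .
qed

text \<open>Up to \<open>C1\<close>, \<open>M\<close> solves the equation
  \<open>rate (M / n ^ (k - 1))\<close> = p L^-b, where b is the exponent of the logarithm in
  \<open>p1\<close>; hence \<open>g\<close> is b (\<Delta> + 1)/s. The upper bound on
  \<open>p\<close> turns into M \<ge> C1 n^(r-1), since equality in one is equality in the
  other.\<close>

lemma below_threshold:
  fixes n :: nat and p C1 :: real
  defines "\<Delta> \<equiv> real (r - k)" and "L \<equiv> ln (real n)"
  defines "g \<equiv> \<Delta> + (\<Delta> + 2) * (\<Delta> + 1) / s"
  defines "M \<equiv> C1 * (p powr (- (\<Delta> + 1) / s) * real n ^ (k - 1) * L powr g)"
  assumes n: "1 \<le> n" and L: "1 \<le> L" and C1: "1 \<le> K" "K \<le> C1"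
    and p: "real n powr (- s) \<le> p"
      "p \<le> real n powr (- (\<Delta> / (\<Delta> + 1)) * s) * L powr (\<Delta> + 2 + \<Delta> * s / (\<Delta> + 1))"
  shows "C1 * real n ^ (r - 1) \<le> M" and "K * rate (M / real n ^ (k - 1)) * L ^ 2 \<le> p"
    and "L powr g \<le> p * M"
    and "p * M = C1 * p powr ((s - \<Delta> - 1) / s) * real n ^ (k - 1) * L powr g"
proof -
  have \<Delta>: "0 \<le> \<Delta>" by (simp add: \<Delta>_def)
  have n0: "0 < real n" using n by simp
  have s\<Delta>: "\<Delta> + 1 \<le> s" using s_ge by (simp add: \<Delta>_def)
  have s0: "0 < s" using s\<Delta> \<Delta> by linarith
  have "0 < real n powr (- s)" using n0 by simp
  then have p0: "0 < p" using p(1) by linarith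
  let ?b = "\<Delta> + 2 + \<Delta> * s / (\<Delta> + 1)"
  have b: "2 \<le> ?b" using \<Delta> s0 by simp
  have L0: "0 < L" using L by linarith
  have q: "0 < \<Delta> + 1" using \<Delta> by simp
  have C0: "0 < C1" using C1 by linarith
  have bg: "?b * ((\<Delta> + 1) / s) = g"
  proof -
    have "?b * ((\<Delta> + 1) / s) = (\<Delta> + 2) * ((\<Delta> + 1) / s) + \<Delta> * s / (\<Delta> + 1) * ((\<Delta> + 1) / s)"
      by (rule distrib_right)
    also have "\<Delta> * s / (\<Delta> + 1) * ((\<Delta> + 1) / s) = \<Delta>" using s0 q by simp
    finally show ?thesis unfolding g_def by simp
  qed
  show "C1 * real n ^ (r - 1) \<le> M"
  proof -
    have "(real n powr (- (\<Delta> / (\<Delta> + 1)) * s) * L powr ?b) powr (- (\<Delta> + 1) / s) \<le> p powr (- (\<Delta> + 1) / s)"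
    proof (rule powr_mono2')
      show "- (\<Delta> + 1) / s \<le> 0" using s0 q by (intro divide_nonpos_pos) auto
    qed (use p0 p(2) in auto)
    moreover have "(real n powr (- (\<Delta> / (\<Delta> + 1)) * s) * L powr ?b) powr (- (\<Delta> + 1) / s)
        = real n powr \<Delta> * L powr (- g)"
    proof -
      have gen: "(- (a / b) * t) * (- b / t) = a" if "b \<noteq> 0" "t \<noteq> 0" for a b t :: real
        using that by (simp add: field_simps)
      have "(- (\<Delta> / (\<Delta> + 1)) * s) * (- (\<Delta> + 1) / s) = \<Delta>"
        by (rule gen) (use s0 q in auto)
      moreover have "?b * (- (\<Delta> + 1) / s) = - g"
      proof -
        have "?b * (- (\<Delta> + 1) / s) = - (?b * ((\<Delta> + 1) / s))" by (simp only: minus_divide_left[symmetric] mult_minus_right)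
        then show ?thesis using bg by simp
      qed
      ultimately show ?thesis by (simp only: powr_mult powr_powr)
    qed
    ultimately have "real n powr \<Delta> * L powr (- g) * L powr g \<le> p powr (- (\<Delta> + 1) / s) * L powr g"
      by (intro mult_right_mono) auto
    moreover have "L powr (- g) * L powr g = 1" using L0 by (simp flip: powr_add)
    ultimately have "real n powr \<Delta> \<le> p powr (- (\<Delta> + 1) / s) * L powr g" by (simp add: mult.assoc)
    then have "real n powr \<Delta> * real n ^ (k - 1) \<le> p powr (- (\<Delta> + 1) / s) * L powr g * real n ^ (k - 1)"
      by (rule mult_right_mono) simp
    moreover have "real n powr \<Delta> * real n ^ (k - 1) = real n ^ (r - 1)"
    proof -
      have "r - 1 = (r - k) + (k - 1)" using kr k2 by simp
      then show ?thesis using n0 by (simp add: \<Delta>_def powr_realpow power_add)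
    qed
    ultimately show ?thesis unfolding M_def using C0 by (intro mult_left_mono) (auto simp: mult_ac)
  qed
  show "K * rate (M / real n ^ (k - 1)) * L ^ 2 \<le> p"
  proof -
    have "M / real n ^ (k - 1) = C1 * (p powr (- (\<Delta> + 1) / s) * L powr g)"
      unfolding M_def using n0 by simp
    then have "K * rate (M / real n ^ (k - 1)) \<le> rate (p powr (- (\<Delta> + 1) / s) * L powr g)"
      using rate_le_scaled[OF C1, of "p powr (- (\<Delta> + 1) / s) * L powr g"] p0 L0 by simp
    also have "\<dots> = p * L powr (- ?b)"
    proof -
      have gen: "(- b / t) * (- t / b) = 1" "(b / t) * (- t / b) = - 1" if "b \<noteq> 0" "t \<noteq> 0" for b t :: real
        using that by simp_all
      have e1: "(- (\<Delta> + 1) / s) * (- s / (\<Delta> + 1)) = 1" by (rule gen(1)) (use s0 q in auto)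
      have "g * (- s / (\<Delta> + 1)) = ?b * (((\<Delta> + 1) / s) * (- s / (\<Delta> + 1)))"
        unfolding bg[symmetric] by (rule mult.assoc)
      also have "((\<Delta> + 1) / s) * (- s / (\<Delta> + 1)) = - 1" by (rule gen(2)) (use s0 q in auto)
      finally have e2: "g * (- s / (\<Delta> + 1)) = - ?b" by simp
      have "rate (p powr (- (\<Delta> + 1) / s) * L powr g)
          = p powr ((- (\<Delta> + 1) / s) * (- s / (\<Delta> + 1))) * L powr (g * (- s / (\<Delta> + 1)))"
        unfolding rate_def \<Delta>_def[symmetric] by (simp only: powr_mult powr_powr)
      then show ?thesis unfolding e1 e2 using p0 by simp
    qed
    finally have "K * rate (M / real n ^ (k - 1)) \<le> p * L powr (- ?b)" .
    then have "K * rate (M / real n ^ (k - 1)) * L ^ 2 \<le> p * L powr (- ?b) * L powr ?b"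
      by (rule mult_mono[OF _ powr_log_ge[OF L b]]) (use p0 in auto)
    also have "\<dots> = p"
    proof -
      have "L powr (- ?b) * L powr ?b = 1" using L0 by (simp flip: powr_add)
      then show ?thesis by (simp only: mult.assoc mult_1_right)
    qed
    finally show ?thesis .
  qed
  show eq: "p * M = C1 * p powr ((s - \<Delta> - 1) / s) * real n ^ (k - 1) * L powr g"
  proof -
    have "p * p powr (- (\<Delta> + 1) / s) = p powr (1 + - (\<Delta> + 1) / s)" using p0 by (simp only: powr_add) simp
    also have "1 + - (\<Delta> + 1) / s = (s - \<Delta> - 1) / s" using s0 by (simp add: field_simps)
    finally have pp: "p * p powr (- (\<Delta> + 1) / s) = p powr ((s - \<Delta> - 1) / s)" .
    have "p * M = C1 * (p * p powr (- (\<Delta> + 1) / s)) * real n ^ (k - 1) * L powr g"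
      unfolding M_def by (simp only: mult_ac)
    then show ?thesis unfolding pp .
  qed
  show "L powr g \<le> p * M"
  proof -
    have e0: "0 \<le> (s - \<Delta> - 1) / s" using s\<Delta> s0 by simp
    have "(real n powr (- s)) powr ((s - \<Delta> - 1) / s) \<le> p powr ((s - \<Delta> - 1) / s)"
      using p(1) e0 by (intro powr_mono2) auto
    moreover have "(real n powr (- s)) powr ((s - \<Delta> - 1) / s) = real n powr (\<Delta> + 1 - s)"
    proof -
      have "- s * ((s - \<Delta> - 1) / s) = \<Delta> + 1 - s" using s0 by simp
      then show ?thesis by (simp only: powr_powr)
    qed
    ultimately have "real n powr (\<Delta> + 1 - s) * real n ^ (k - 1) \<le> p powr ((s - \<Delta> - 1) / s) * real n ^ (k - 1)"
      by (intro mult_right_mono) auto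
    \<comment> \<open>The exponents of \<open>n\<close> add up to r - s, which is nonnegative by
      \<open>s_le\<close>.\<close>
    moreover have "1 \<le> real n powr (\<Delta> + 1 - s) * real n ^ (k - 1)"
    proof -
      have "0 \<le> \<Delta> + 1 - s + real (k - 1)" using s_le kr k2 by (simp add: \<Delta>_def of_nat_diff)
      then have "1 \<le> real n powr (\<Delta> + 1 - s + real (k - 1))" using n by (intro ge_one_powr_ge_zero) auto
      then show ?thesis using n0 by (simp only: powr_add powr_realpow)
    qed
    ultimately have "1 \<le> p powr ((s - \<Delta> - 1) / s) * real n ^ (k - 1)" by linarith
    moreover have "1 \<le> C1" using C1 by linarith
    ultimately have "1 * 1 \<le> C1 * (p powr ((s - \<Delta> - 1) / s) * real n ^ (k - 1))"
      by (intro mult_mono) auto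
    then have "1 * L powr g \<le> C1 * (p powr ((s - \<Delta> - 1) / s) * real n ^ (k - 1)) * L powr g"
      by (intro mult_right_mono) auto
    then show ?thesis unfolding eq by (simp add: mult.assoc)
  qed
qed

text \<open>The sequence \<open>p\<close> is fixed, so the range conditions do not depend on the
  random graph: outside its range an implication has failure probability 0. It remains to bound the
  two failure probabilities for each large \<open>n\<close> separately.\<close>

lemma ex_number_aas:
  defines "\<Delta> \<equiv> real (r - k)"
  shows "\<exists>C>0. \<forall>p :: nat \<Rightarrow> real. (\<forall>n. 0 \<le> p n \<and> p n \<le> 1) \<longrightarrow>
    aas (\<lambda>n. random_rgraph r n (p n)) (\<lambda>n G.
      (real n powr (- (\<Delta> / (\<Delta> + 1)) * s) * ln (real n) powr (\<Delta> + 2 + \<Delta> * s / (\<Delta> + 1)) \<le> p n \<longrightarrow>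
         real (ex_number G F) \<le> C * p n * real n ^ (r - 1)) \<and>
      (C * real n powr (- s) * ln (real n) powr (\<Delta> + 2 + \<Delta> * s / (\<Delta> + 1)) \<le> p n \<and>
       p n \<le> real n powr (- (\<Delta> / (\<Delta> + 1)) * s) * ln (real n) powr (\<Delta> + 2 + \<Delta> * s / (\<Delta> + 1)) \<longrightarrow>
         real (ex_number G F) \<le> C * p n powr ((s - \<Delta> - 1) / s) * real n ^ (k - 1)
           * ln (real n) powr (\<Delta> + (\<Delta> + 2) * (\<Delta> + 1) / s)))"
proof -
  obtain B K where BK0: "1 \<le> B \<and> 1 \<le> K \<and> (\<forall>n p M. 3 \<le> n \<longrightarrow> 0 \<le> p \<longrightarrow> p \<le> 1 \<longrightarrow> B * real n ^ (r - 1) \<le> M \<longrightarrow>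
     K * rate (M / real n ^ (k - 1)) * ln (real n) ^ 2 \<le> p \<longrightarrow> real (card (verts F)) ^ r \<le> p * M \<longrightarrow> 0 < p * M \<longrightarrow>
     measure_pmf.prob (random_rgraph r n p) {G. \<not> real (ex_number G F) \<le> exp 3 * (p * M)} \<le> exp (- (p * M)))"
    using ex_number_prob by (elim exE) (rule that)
  note BK = BK0[THEN conjunct1] BK0[THEN conjunct2, THEN conjunct1]
    and bound = BK0[THEN conjunct2, THEN conjunct2, rule_format]
  define C1 where "C1 = max B K"
  have C1: "1 \<le> C1" "B \<le> C1" "K \<le> C1" using BK by (auto simp: C1_def)
  \<comment> \<open>\<open>exp 3\<close> comes from the union bound over the containers, and
    \<open>C1\<close> has to dominate both \<open>B\<close> and \<open>K\<close>.\<close>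
  define C where "C = exp 3 * C1"
  have C: "1 \<le> C"
  proof -
    have "1 * 1 \<le> exp 3 * C1" using C1 by (intro mult_mono) auto
    then show ?thesis by (simp add: C_def)
  qed
  have \<Delta>: "0 \<le> \<Delta>" by (simp add: \<Delta>_def)
  have s0: "0 < s" using s_ge by linarith
  define g where "g = \<Delta> + (\<Delta> + 2) * (\<Delta> + 1) / s"
  \<comment> \<open>\<open>p n * M\<close> is at least (log n)^2 in the upper range and (log n)^g in
    the lower one; the exponent \<open>h\<close> serves both, so the failure probability has one
    common bound.\<close>
  define h where "h = min 2 g"
  have g0: "0 < g" unfolding g_def using \<Delta> s0 by (intro add_nonneg_pos divide_pos_pos mult_pos_pos) auto
  then have h0: "0 < h" "h \<le> 2" "h \<le> g" unfolding h_def by auto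
  have ln_top: "filterlim (\<lambda>n. ln (real n)) at_top sequentially"
    by (rule filterlim_compose[OF ln_at_top filterlim_real_sequentially])
  have h_top: "filterlim (\<lambda>n. ln (real n) powr h) at_top sequentially"
  proof (rule filterlim_compose[OF _ ln_top])
    have "filterlim (\<lambda>x. exp (h * ln x)) at_top at_top"
      by (intro filterlim_compose[OF exp_at_top] filterlim_tendsto_pos_mult_at_top[OF tendsto_const h0(1)] ln_at_top)
    then show "filterlim (\<lambda>x. x powr h) at_top at_top"
      by (rule filterlim_mono_eventually)
        (auto simp: powr_def intro: eventually_mono[OF eventually_gt_at_top[of 0]])
  qed
  show ?thesis
  proof (rule exI[of _ C], intro conjI allI impI)
    show "0 < C" using C by linarith
    fix p :: "nat \<Rightarrow> real" assume p01: "\<forall>n. 0 \<le> p n \<and> p n \<le> 1"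
    let ?p1 = "\<lambda>n. real n powr (- (\<Delta> / (\<Delta> + 1)) * s) * ln (real n) powr (\<Delta> + 2 + \<Delta> * s / (\<Delta> + 1))"
    let ?p0 = "\<lambda>n. C * real n powr (- s) * ln (real n) powr (\<Delta> + 2 + \<Delta> * s / (\<Delta> + 1))"
    let ?Q1 = "\<lambda>n G. ?p1 n \<le> p n \<longrightarrow> real (ex_number G F) \<le> C * p n * real n ^ (r - 1)"
    let ?Q2 = "\<lambda>n G. ?p0 n \<le> p n \<and> p n \<le> ?p1 n \<longrightarrow>
       real (ex_number G F) \<le> C * p n powr ((s - \<Delta> - 1) / s) * real n ^ (k - 1)
         * ln (real n) powr (\<Delta> + (\<Delta> + 2) * (\<Delta> + 1) / s)"
    let ?P = "\<lambda>n. measure_pmf.prob (random_rgraph r n (p n))"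
    let ?e = "\<lambda>n. exp (- (ln (real n) powr h))"
    have each: "1 - 2 * ?e n \<le> ?P n {G. ?Q1 n G \<and> ?Q2 n G}"
      if n: "3 \<le> n" and L: "1 \<le> ln (real n)" and big: "real (card (verts F)) ^ r \<le> ln (real n) powr h" for n
    proof -
      let ?L = "ln (real n)"
      have n1: "1 \<le> n" using n by simp
      have Lh: "1 \<le> ?L powr h" using L h0 by (intro ge_one_powr_ge_zero) auto
      have p: "0 \<le> p n" "p n \<le> 1" using p01 by auto
      have fin: "?P n {G. \<not> real (ex_number G F) \<le> exp 3 * (p n * M)} \<le> ?e n"
        if M: "B * real n ^ (r - 1) \<le> M" "K * rate (M / real n ^ (k - 1)) * ?L ^ 2 \<le> p n"
          "?L powr h \<le> p n * M" for M
      proof -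
        have "?P n {G. \<not> real (ex_number G F) \<le> exp 3 * (p n * M)} \<le> exp (- (p n * M))"
          by (rule bound[OF n p M(1,2)]) (use M(3) big Lh in linarith)+
        also have "\<dots> \<le> ?e n" using M(3) by simp
        finally show ?thesis .
      qed
      have B1: "B * real n ^ (r - 1) \<le> C1 * real n ^ (r - 1)" using C1 by (intro mult_right_mono) auto
      have 1: "?P n {G. \<not> ?Q1 n G} \<le> ?e n"
      proof (cases "?p1 n \<le> p n")
        case True
        note at = above_threshold[OF n1 L BK(2) C1(3), folded \<Delta>_def, OF True]
        have "?L powr h \<le> p n * (C1 * real n ^ (r - 1))"
          using at(2) powr_mono[OF h0(2) L] by linarith
        then have "?P n {G. \<not> real (ex_number G F) \<le> exp 3 * (p n * (C1 * real n ^ (r - 1)))} \<le> ?e n"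
          by (intro fin B1 at(1))
        then show ?thesis using True by (simp add: C_def mult_ac)
      next
        case False
        then show ?thesis by simp
      qed
      have 2: "?P n {G. \<not> ?Q2 n G} \<le> ?e n"
      proof (cases "?p0 n \<le> p n \<and> p n \<le> ?p1 n")
        case True
        \<comment> \<open>Both factors by which \<open>p0\<close> exceeds n^-s are at least 1, which
          supplies the lower bound on \<open>p n\<close> in the form used by
          \<open>below_threshold\<close>.\<close>
        have "1 * 1 \<le> C * ?L powr (\<Delta> + 2 + \<Delta> * s / (\<Delta> + 1))"
          using C L \<Delta> s0 by (intro mult_mono ge_one_powr_ge_zero) auto
        then have "1 * real n powr (- s) \<le> (C * ?L powr (\<Delta> + 2 + \<Delta> * s / (\<Delta> + 1))) * real n powr (- s)"
          by (intro mult_right_mono) auto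
        then have ps: "real n powr (- s) \<le> p n" using True by (simp add: mult_ac)
        define M where "M = C1 * (p n powr (- (\<Delta> + 1) / s) * real n ^ (k - 1) * ?L powr g)"
        note bt = below_threshold[OF n1 L BK(2) C1(3) ps, folded \<Delta>_def, OF conjunct2[OF True],
          folded g_def, folded M_def]
        have "?L powr h \<le> p n * M" using bt(3) powr_mono[OF h0(3) L] by linarith
        then have "?P n {G. \<not> real (ex_number G F) \<le> exp 3 * (p n * M)} \<le> ?e n"
          using B1 bt(1,2) by (intro fin) auto
        then show ?thesis using True unfolding bt(4) by (simp add: C_def g_def mult_ac)
      next
        case False
        then have empty: "{G. \<not> ?Q2 n G} = {}" by blast
        show ?thesis unfolding empty by simp
      qed
      show ?thesis by (rule prob_conj_ge[OF 1 2])
    qed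
    have ev: "eventually (\<lambda>n. 1 - 2 * ?e n \<le> ?P n {G. ?Q1 n G \<and> ?Q2 n G}) sequentially"
      using eventually_ge_at_top[of 3] filterlim_at_top[THEN iffD1, OF ln_top, rule_format, of 1]
        filterlim_at_top[THEN iffD1, OF h_top, rule_format, of "real (card (verts F)) ^ r"]
      by eventually_elim (rule each)
    have "?e \<longlonglongrightarrow> 0"
      by (rule filterlim_compose[OF exp_at_bot]) (use h_top in \<open>simp add: filterlim_uminus_at_bot\<close>)
    then have lim: "(\<lambda>n. 1 - 2 * ?e n) \<longlonglongrightarrow> 1 - 2 * 0" by (intro tendsto_intros)
    have "(\<lambda>n. ?P n {G. ?Q1 n G \<and> ?Q2 n G}) \<longlonglongrightarrow> 1"
      by (rule tendsto_sandwich[OF ev _ _ tendsto_const]) (use lim in auto)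
    then show "aas (\<lambda>n. random_rgraph r n (p n)) (\<lambda>n G. ?Q1 n G \<and> ?Q2 n G)"
      unfolding aas_def .
  qed
qed

end

theorem theorem1p3:
  fixes r k :: nat and T S :: "'a hgraph"
  assumes "2 \<le> k" and "k \<le> r"
    and "tight_tree k T"
    and "spanning_subhgraph S T"
    and "card (edges S) \<ge> 2"
  shows "let \<Delta> = real (r - k); F = expansion k r S; s = s_param r F in
    \<exists>C>0.
      let p0 = (\<lambda>n::nat. C * real n powr (- s) * ln (real n) powr (\<Delta> + 2 + \<Delta> * s / (\<Delta> + 1)));
          p1 = (\<lambda>n::nat. real n powr (- (\<Delta> / (\<Delta> + 1)) * s)
                        * ln (real n) powr (\<Delta> + 2 + \<Delta> * s / (\<Delta> + 1)))
      in \<forall>p :: nat \<Rightarrow> real. (\<forall>n. 0 \<le> p n \<and> p n \<le> 1) \<longrightarrow>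
        aas (\<lambda>n. random_rgraph r n (p n)) (\<lambda>n G.
          (p1 n \<le> p n \<longrightarrow> real (ex_number G F) \<le> C * p n * real n ^ (r - 1)) \<and>
          (p0 n \<le> p n \<and> p n \<le> p1 n \<longrightarrow>
             real (ex_number G F) \<le> C * p n powr ((s - \<Delta> - 1) / s) * real n ^ (k - 1)
               * ln (real n) powr (\<Delta> + (\<Delta> + 2) * (\<Delta> + 1) / s)))"
proof -
  interpret expanded_subtree r k T S by standard (use assms in auto)
  show ?thesis unfolding Let_def by (rule ex_number_aas)
qed

end
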